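(* Let $\mu$ be a Borel measure on $\mathbb{R}^n$ and $(s_t)_{t>0}$ a family of kernels satisfying the standing assumptions (power bound, size and continuity), and let $V$ be the associated vertical square function. Assume that to every cube $Q\subset\mathbb{R}^n$ there is associated a function $b_Q$ such that, with implicit constants independent of $Q$: (1) $\operatorname{spt} b_Q\subset Q$; (2) $|\langle b_Q\rangle_Q|\gtrsim 1$; (3) $\|b_Q\|_{L^\infty(\mu)}\lesssim 1$; (4) $\displaystyle \sup_{R\subset\mathbb{R}^n\text{ cube}} \frac{1}{\mu(3R)}\iint_{\widehat R}|\theta_t b_Q(x)|^2\,d\mu(x)\frac{dt}{t}\lesssim 1$. Then $V$ is bounded on $L^2(\mu)$, that is, $\displaystyle \iint_{\mathbb{R}^{n}\times(0,\infty)}|\theta_tf(x)|^2\,d\mu(x)\frac{dt}{t}\lesssim\|f\|_{L^2(\mu)}^2$ for all $f\in L^2(\mu)$.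
   Context: Standing assumptions: fix $n\ge 1$, $m>0$, $\alpha>0$. The Borel measure $\mu$ on $\mathbb{R}^n$ (not necessarily doubling) satisfies $\mu(B(x,r))\lesssim r^m$ for all $x\in\mathbb{R}^n$, $r>0$. The (measurable, complex-valued) kernels $s_t(x,y)$, $t>0$, satisfy $|s_t(x,y)|\lesssim \frac{t^\alpha}{(t+|x-y|)^{m+\alpha}}$ for all $x,y$, and $|s_t(x,y)-s_t(x,z)|\lesssim\frac{|y-z|^\alpha}{(t+|x-y|)^{m+\alpha}}$ whenever $|y-z|<t/2$. No regularity in the first variable is assumed. Set $\theta_tf(x)=\int_{\mathbb{R}^n}s_t(x,y)f(y)\,d\mu(y)$ and $Vf(x)=\left(\int_0^\infty|\theta_tf(x)|^2\frac{dt}{t}\right)^{1/2}$. Notation: $\langle b\rangle_Q=\mu(Q)^{-1}\int_Q b\,d\mu$; when $\mu(Q)=0$, condition (2) is read as $|\int_Q b_Q\,d\mu|\gtrsim\mu(Q)$, and condition (4) is likewise read as $\iint_{\widehat R}|\theta_tb_Q|^2\,d\mu\,dt/t\lesssim\mu(3R)$. $\operatorname{spt} b_Q\subset Q$ means that $b_Q$ vanishes outside $Q$. $\ell(R)$ is the side length of the cube $R$ (sides parallel to the axes), $3R$ is the concentric cube of side length $3\ell(R)$, and $\widehat R=R\times(0,\ell(R))$ is the Carleson box. $A\lesssim B$ means $A\le CB$ for a finite constant $C$ independent of the variable quantities (points, radii, $t$, cubes, $f$). *)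

theory Defs
  imports "HOL-Probability.Probability"
begin

text \<open>Throughout, \<open>A \<lesssim> B\<close> is rendered as \<open>\<exists>C. \<forall>\<dots>. A \<le> C * B\<close>, with the quantified constant outside
  all points, radii, times, cubes and functions.\<close>

definition power_bound :: "real \<Rightarrow> (real ^ 'n) measure \<Rightarrow> bool" where
  "power_bound m \<mu> \<longleftrightarrow>
     (\<exists>C. \<forall>x. \<forall>r>0. emeasure \<mu> (ball x r) \<le> ennreal (C * r powr m))"

text \<open>Only the values \<open>s t\<close> with \<open>t > 0\<close> matter. The kernels are measurable jointly in \<open>(t, x, y)\<close>,
  so that \<open>\<theta>\<^sub>t f(x)\<close> is measurable in \<open>(x, t)\<close>.\<close>

definition kernel_measurable :: "(real \<Rightarrow> real ^ 'n \<Rightarrow> real ^ 'n \<Rightarrow> complex) \<Rightarrow> bool" where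
  "kernel_measurable s \<longleftrightarrow>
     (\<lambda>(t, x, y). s t x y) \<in> borel_measurable (restrict_space borel ({0<..} \<times> UNIV))"

definition kernel_size ::
    "real \<Rightarrow> real \<Rightarrow> (real \<Rightarrow> real ^ 'n \<Rightarrow> real ^ 'n \<Rightarrow> complex) \<Rightarrow> bool" where
  "kernel_size m \<alpha> s \<longleftrightarrow>
     (\<exists>C. \<forall>t>0. \<forall>x y. norm (s t x y) \<le> C * (t powr \<alpha> / (t + norm (x - y)) powr (m + \<alpha>)))"

definition kernel_continuity ::
    "real \<Rightarrow> real \<Rightarrow> (real \<Rightarrow> real ^ 'n \<Rightarrow> real ^ 'n \<Rightarrow> complex) \<Rightarrow> bool" where
  "kernel_continuity m \<alpha> s \<longleftrightarrow>
     (\<exists>C. \<forall>t>0. \<forall>x y z. norm (y - z) < t / 2 \<longrightarrow>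
        norm (s t x y - s t x z)
          \<le> C * (norm (y - z) powr \<alpha> / (t + norm (x - y)) powr (m + \<alpha>)))"

definition theta ::
    "(real ^ 'n) measure \<Rightarrow> (real \<Rightarrow> real ^ 'n \<Rightarrow> real ^ 'n \<Rightarrow> complex)
      \<Rightarrow> real \<Rightarrow> (real ^ 'n \<Rightarrow> complex) \<Rightarrow> real ^ 'n \<Rightarrow> complex" where
  "theta \<mu> s t f x = (LINT y|\<mu>. s t x y * f y)"

text \<open>The integral of \<open>|\<theta>\<^sub>t f(x)|\<^sup>2 d\<mu>(x) dt/t\<close> over a set \<open>S\<close> of pairs \<open>(x, t)\<close>, \<open>t > 0\<close>.\<close>

definition square_integral ::
    "(real ^ 'n) measure \<Rightarrow> (real \<Rightarrow> real ^ 'n \<Rightarrow> real ^ 'n \<Rightarrow> complex)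
      \<Rightarrow> ((real ^ 'n) \<times> real) set \<Rightarrow> (real ^ 'n \<Rightarrow> complex) \<Rightarrow> ennreal" where
  "square_integral \<mu> s S f =
     (\<integral>\<^sup>+p\<in>S. ennreal ((norm (theta \<mu> s (snd p) f (fst p)))\<^sup>2 / snd p) \<partial>(\<mu> \<Otimes>\<^sub>M lborel))"

text \<open>Cubes are closed; for \<open>l > 0\<close> the centre \<open>c\<close> and the side length \<open>l\<close> are determined by the set,
  and the concentric dilate \<open>3R\<close> of \<open>R = cube c l\<close> is \<open>cube c (3 * l)\<close>.\<close>

definition cube :: "real ^ 'n \<Rightarrow> real \<Rightarrow> (real ^ 'n) set" where
  "cube c l = cbox (\<chi> i. c $ i - l / 2) (\<chi> i. c $ i + l / 2)"

definition cubes :: "(real ^ 'n) set set" where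
  "cubes = {cube c l | c l. l > 0}"

definition carleson_box :: "real ^ 'n \<Rightarrow> real \<Rightarrow> ((real ^ 'n) \<times> real) set" where
  "carleson_box c l = cube c l \<times> {0<..<l}"

definition average ::
    "(real ^ 'n) measure \<Rightarrow> (real ^ 'n) set \<Rightarrow> (real ^ 'n \<Rightarrow> complex) \<Rightarrow> complex" where
  "average \<mu> Q f = (LINT x:Q|\<mu>. f x) /\<^sub>R measure \<mu> Q"

text \<open>The supremum over all cubes \<open>R\<close> in the testing condition. Since \<open>a / 0 = \<infinity>\<close> for \<open>a > 0\<close> and
  \<open>0 / 0 = 0\<close> in \<^typ>\<open>ennreal\<close>, for a cube with \<open>\<mu>(3R) = 0\<close> a finite bound on the quotient
  says that the integral over the Carleson box is \<open>\<lesssim> \<mu>(3R)\<close>, i.e. vanishes.\<close>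

definition carleson_sup ::
    "(real ^ 'n) measure \<Rightarrow> (real \<Rightarrow> real ^ 'n \<Rightarrow> real ^ 'n \<Rightarrow> complex)
      \<Rightarrow> (real ^ 'n \<Rightarrow> complex) \<Rightarrow> ennreal" where
  "carleson_sup \<mu> s f =
     (SUP (c, l) \<in> UNIV \<times> {0<..}.
        square_integral \<mu> s (carleson_box c l) f / emeasure \<mu> (cube c (3 * l)))"

end

theory Submission imports Defs begin

text \<open>
  Fix a dyadic grid of cubes, shifted by a parameter \<open>\<tau>\<close>, with levels \<open>0, 1, 2, \<dots>\<close> of side lengths
  \<open>H, H/2, H/4, \<dots>\<close>. The square function is estimated for one shift at the points which are good for
  that shift, and the estimate is then averaged over all shifts.

  \<^bold>\<open>Stopping.\<close> Descending from a top cube, one keeps the test function of a cube until its mean over a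
  smaller cube drops below \<open>\<delta>/2\<close>; there the test function of the smaller cube takes over. A takeover
  lifts the mean from below \<open>\<delta>/2\<close> to at least \<open>\<delta>\<close>, whereas the sum over the subcubes of \<open>|mean|\<close>
  times the measure cannot decrease from one level to the next. As the test functions are bounded,
  this potential pays for the stopping cubes and for the squared oscillations of the means, so both
  satisfy a Carleson packing condition (\<open>oscillation_packing\<close>). Let \<open>E\<^sub>j f\<close> be, on each cube of level
  \<open>j\<close>, the multiple of the current test function that has the same mean as \<open>f\<close>. The packing condition
  and Carleson's embedding theorem (\<open>carleson_embedding\<close>) bound the sum of the squares of the
  differences \<open>E\<^sub>j f - E\<^sub>j\<^sub>-\<^sub>1 f\<close> by \<open>\<parallel>f\<parallel>\<^sup>2\<close> (\<open>adapted_square_function\<close>).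

  \<^bold>\<open>Decomposition.\<close> Let \<open>t\<close> be comparable to the side length of level \<open>k\<close>. A difference of a level finer
  than \<open>k\<close> has mean zero on cubes of side at most \<open>t\<close>, and the continuity of the kernel in \<open>y\<close> gains a
  factor that is geometric in the number of levels (\<open>fine_scale_bound\<close>). A difference of a coarser
  level coincides, on the cube of that level around \<open>x\<close>, with a combination of two test functions
  taken on all of space. These combinations telescope to one multiple of one test function \<open>G\<close>.
  The error lives outside the cube around \<open>x\<close>; if \<open>x\<close> is far from the boundaries of the grid, the
  decay of the kernel makes it geometrically small (\<open>coarse_scale_bound\<close>). Throughout, \<open>x\<close> is a
  fixed point, which is why the kernel may be rough in \<open>x\<close>. Schur's test sums all errors, and what
  remains is the paraproduct \<open>|mean of f|\<^sup>2 |\<theta>\<^sub>t G(x)|\<^sup>2\<close>.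

  \<^bold>\<open>Paraproduct.\<close> By Carleson's embedding theorem again, it suffices that the measures
  \<open>|\<theta>\<^sub>t G(x)|\<^sup>2 d\<mu> dt/t\<close>, restricted to good points, are packed. The testing condition bounds a box
  over a cube \<open>R\<close> by \<open>\<mu>(3R)\<close>, and \<open>\<mu>\<close> need not be doubling. But a point of a cube \<open>Q\<close> that is good at
  scale \<open>t\<close> has distance at least a multiple of \<open>t\<close> from the boundary of \<open>Q\<close>, so the box over \<open>Q\<close>
  can be cut into boxes over Whitney cubes, whose dilates stay in \<open>Q\<close> and overlap boundedly
  (\<open>whitney_packing\<close>).

  \<^bold>\<open>Averaging.\<close> For every point and level at least half of the shifts are good
  (\<open>good_shifts_large\<close>), so Fubini's theorem turns the bound for good points into a bound for all
  points. For almost every shift the hyperplanes of the grid are \<open>\<mu>\<close>-null, and then the half-open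
  cells of the grid may be exchanged for the closed cubes that carry the test functions.
\<close>

section \<open>Averages over nested partitions\<close>

text \<open>The squared norm is kept in \<^typ>\<open>ennreal\<close>, so that it makes sense for every function.\<close>

abbreviation L2_square :: "'a measure \<Rightarrow> ('a \<Rightarrow> 'b::real_normed_vector) \<Rightarrow> ennreal" where
  "L2_square M f \<equiv> \<integral>\<^sup>+x. ennreal ((norm (f x))\<^sup>2) \<partial>M"

text \<open>A sequence of countable partitions, each refining the one before. A partition is given by a labelling
  \<open>idx j\<close>, whose level sets are the cells of level \<open>j\<close>: a function that is constant on cells factors
  through a countable type, which settles its measurability.\<close>

locale nested_partition =
  fixes M :: "'a measure" and idx :: "nat \<Rightarrow> 'a \<Rightarrow> 'i::countable"
  assumes space_UNIV: "space M = UNIV"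
    and idx_measurable [measurable]: "\<And>j. idx j \<in> measurable M (count_space UNIV)"
    and idx_nested: "\<And>j x y. idx (Suc j) x = idx (Suc j) y \<Longrightarrow> idx j x = idx j y"
    and finite_idx_class: "\<And>j z. emeasure M {y. idx j y = z} < \<infinity>"
begin

definition cell :: "nat \<Rightarrow> 'a \<Rightarrow> 'a set" where
  "cell j x = {y. idx j y = idx j x}"

lemma in_cell_iff: "y \<in> cell j x \<longleftrightarrow> idx j y = idx j x"
  by (simp add: cell_def)

lemma self_in_cell [simp]: "x \<in> cell j x"
  by (simp add: cell_def)

lemma idx_mono: "i \<le> j \<Longrightarrow> idx j x = idx j y \<Longrightarrow> idx i x = idx i y"
  by (induction rule: inc_induct) (auto dest: idx_nested)

lemma cell_mono: "i \<le> j \<Longrightarrow> cell j x \<subseteq> cell i x"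
  by (auto simp: in_cell_iff intro: idx_mono)

lemma cell_eq: "idx j x = idx j y \<Longrightarrow> cell j x = cell j y"
  by (simp add: cell_def)

lemma class_measurable [measurable]: "{y. idx j y = z} \<in> sets M"
proof -
  have "idx j -` {z} \<inter> space M \<in> sets M"
    by (rule measurable_sets[OF idx_measurable]) auto
  then show ?thesis by (simp add: space_UNIV vimage_def)
qed

lemma cell_measurable [measurable]: "cell j x \<in> sets M"
  unfolding cell_def by (rule class_measurable)

lemma finite_cell: "emeasure M (cell j x) < \<infinity>"
  unfolding cell_def by (rule finite_idx_class)

lemma emeasure_cell: "emeasure M (cell j x) = ennreal (measure M (cell j x))"
  using finite_cell[of j x] by (simp add: emeasure_eq_ennreal_measure)

lemma cell_constant_measurable:
  assumes "\<And>x y. idx j x = idx j y \<Longrightarrow> h x = h y" "\<And>x. h x \<in> space N"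
  shows "h \<in> measurable M N"
proof -
  have "h x = h (SOME y. idx j y = idx j x)" for x
    by (rule assms(1)) (metis (mono_tags, lifting) someI)
  then have "h = (\<lambda>z. h (SOME y. idx j y = z)) \<circ> idx j" by (auto simp: fun_eq_iff)
  moreover have "(\<lambda>z. h (SOME y. idx j y = z)) \<circ> idx j \<in> measurable M N"
    by (rule measurable_comp[OF idx_measurable]) (auto intro: assms(2))
  ultimately show ?thesis by simp
qed

lemma cell_dependent_measurable:
  assumes "\<And>z. F z \<in> measurable M N"
  shows "(\<lambda>x. F (idx j x) x) \<in> measurable M N"
  by (rule measurable_compose_countable'[OF assms idx_measurable]) auto

lemma nn_integral_cells:
  assumes [measurable]: "u \<in> borel_measurable M"
  shows "(\<integral>\<^sup>+x. u x \<partial>M) = (\<integral>\<^sup>+z. (\<integral>\<^sup>+y\<in>{y. idx j y = z}. u y \<partial>M) \<partial>count_space UNIV)"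
proof -
  have 1: "(\<integral>\<^sup>+z. u y * indicator {y. idx j y = z} y \<partial>count_space UNIV) = u y" for y
  proof -
    have "(\<integral>\<^sup>+z. u y * indicator {y. idx j y = z} y \<partial>count_space UNIV)
        = (\<integral>\<^sup>+z. u y * indicator {idx j y} z \<partial>count_space UNIV)"
      by (rule nn_integral_cong) (auto simp: indicator_def)
    also have "\<dots> = u y" by (subst nn_integral_cmult_indicator) auto
    finally show ?thesis .
  qed
  have "(\<integral>\<^sup>+x. u x \<partial>M) = (\<integral>\<^sup>+y. \<integral>\<^sup>+z. u y * indicator {y. idx j y = z} y \<partial>count_space UNIV \<partial>M)"
    by (simp add: 1)
  also have "\<dots> = (\<integral>\<^sup>+z. (\<integral>\<^sup>+y\<in>{y. idx j y = z}. u y \<partial>M) \<partial>count_space UNIV)"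
    by (rule nn_integral_count_space_nn_integral) auto
  finally show ?thesis .
qed

lemma nn_integral_le_cells:
  assumes [measurable]: "u \<in> borel_measurable M" "v \<in> borel_measurable M"
    and le: "\<And>x. (\<integral>\<^sup>+y\<in>cell j x. u y \<partial>M) \<le> (\<integral>\<^sup>+y\<in>cell j x. v y \<partial>M)"
  shows "(\<integral>\<^sup>+x. u x \<partial>M) \<le> (\<integral>\<^sup>+x. v x \<partial>M)"
  unfolding nn_integral_cells[OF assms(1), of j] nn_integral_cells[OF assms(2), of j]
proof (rule nn_integral_mono)
  fix z
  show "(\<integral>\<^sup>+y\<in>{y. idx j y = z}. u y \<partial>M) \<le> (\<integral>\<^sup>+y\<in>{y. idx j y = z}. v y \<partial>M)"
  proof (cases "\<exists>x. idx j x = z")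
    case True
    then show ?thesis using le by (auto simp: cell_def)
  next
    case False
    then have "{y. idx j y = z} = {}" by auto
    then show ?thesis by simp
  qed
qed

lemma cell_inter:
  assumes "i \<le> j"
  shows "cell j y \<subseteq> cell i x \<or> cell j y \<inter> cell i x = {}"
proof (cases "idx i y = idx i x")
  case True
  then have "cell i y = cell i x" by (rule cell_eq)
  then show ?thesis using cell_mono[OF assms, of y] by blast
next
  case False
  have "t \<notin> cell i x" if "t \<in> cell j y" for t
    using False idx_mono[OF assms, of t y] that unfolding in_cell_iff by metis
  then show ?thesis by blast
qed

text \<open>How inequalities pass between levels: an inequality of integrals over every cell of level \<open>j\<close>
  sums to one over every cell of a coarser level \<open>i\<close>. All inductions over the levels rest on this.\<close>

lemma nn_integral_le_subcells:
  assumes [measurable]: "u \<in> borel_measurable M" "v \<in> borel_measurable M"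
    and le: "\<And>y. y \<in> cell i x \<Longrightarrow> (\<integral>\<^sup>+t\<in>cell j y. u t \<partial>M) \<le> (\<integral>\<^sup>+t\<in>cell j y. v t \<partial>M)"
    and "i \<le> j"
  shows "(\<integral>\<^sup>+t\<in>cell i x. u t \<partial>M) \<le> (\<integral>\<^sup>+t\<in>cell i x. v t \<partial>M)"
proof (rule nn_integral_le_cells[where j = j])
  fix y
  show "(\<integral>\<^sup>+t\<in>cell j y. u t * indicator (cell i x) t \<partial>M)
      \<le> (\<integral>\<^sup>+t\<in>cell j y. v t * indicator (cell i x) t \<partial>M)"
  proof (cases "cell j y \<subseteq> cell i x")
    case True
    then have eq: "w * indicator (cell i x) t * indicator (cell j y) t = w * indicator (cell j y) t" for t and w :: ennreal
      by (auto simp: indicator_def)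
    have "y \<in> cell i x" using True self_in_cell by blast
    from le[OF this] show ?thesis by (simp only: eq)
  next
    case False
    with cell_inter[OF \<open>i \<le> j\<close>, of y x]
    have "w * indicator (cell i x) t * indicator (cell j y) t = 0" for t and w :: ennreal
      by (auto simp: indicator_def)
    then show ?thesis by (simp only: order.refl)
  qed
qed auto

lemma nn_integral_cell_const:
  assumes "\<And>y. y \<in> cell j x \<Longrightarrow> h y = h x"
  shows "(\<integral>\<^sup>+y\<in>cell j x. h y \<partial>M) = h x * emeasure M (cell j x)"
proof -
  have "h y * indicator (cell j x) y = h x * indicator (cell j x) y" for y
    using assms[of y] by (cases "y \<in> cell j x") auto
  then have "(\<integral>\<^sup>+y\<in>cell j x. h y \<partial>M) = (\<integral>\<^sup>+y\<in>cell j x. h x \<partial>M)"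
    by (simp only:)
  then show ?thesis by (simp add: nn_integral_cmult_indicator)
qed

text \<open>The counterpart for signed integrands; integrability permits the sum over the countably many cells.\<close>

lemma integral_eq_0_cells:
  fixes f :: "'a \<Rightarrow> 'b::{banach, second_countable_topology}"
  assumes f: "integrable M f" and z: "\<And>x. (LINT y:cell j x|M. f y) = 0"
  shows "(LINT y|M. f y) = 0"
proof -
  define A where "A n = {y. to_nat (idx j y) = n}" for n
  have A: "A n \<in> sets M" for n
  proof -
    have "A n = (if n \<in> range (to_nat :: 'i \<Rightarrow> nat) then {y. idx j y = from_nat n} else {})"
      by (auto simp: A_def)
    then show ?thesis by simp
  qed
  have un: "(\<Union>n. A n) = UNIV" by (auto simp: A_def)
  have "(LINT x:(\<Union>n. A n)|M. f x) = (\<Sum>n. (LINT x:A n|M. f x))"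
  proof (rule lebesgue_integral_countable_add)
    show "set_integrable M (\<Union> (range A)) f"
      unfolding un set_integrable_def using f by simp
  qed (use A in \<open>auto simp: A_def\<close>)
  also have "(LINT x:A n|M. f x) = 0" for n
  proof (cases "\<exists>x. to_nat (idx j x) = n")
    case True
    then obtain x where x: "to_nat (idx j x) = n" by auto
    then have "A n = cell j x" by (auto simp: A_def cell_def)
    with z show ?thesis by simp
  next
    case False
    then have "A n = {}" by (auto simp: A_def)
    then show ?thesis by (simp add: set_lebesgue_integral_def)
  qed
  then have "(\<Sum>n. (LINT x:A n|M. f x)) = 0" by simp
  finally show ?thesis using f unfolding un by (simp add: set_lebesgue_integral_def)
qed

text \<open>On a cell of measure zero the average is \<open>0\<close>.\<close>

definition avg :: "nat \<Rightarrow> ('a \<Rightarrow> 'b::{banach, second_countable_topology}) \<Rightarrow> 'a \<Rightarrow> 'b" where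
  "avg j f x = (LINT y:cell j x|M. f y) /\<^sub>R measure M (cell j x)"

definition locally_integrable :: "('a \<Rightarrow> 'b::{banach, second_countable_topology}) \<Rightarrow> bool" where
  "locally_integrable f \<longleftrightarrow> f \<in> borel_measurable M \<and> (\<forall>x. set_integrable M (cell 0 x) f)"

lemma locally_integrable_measurable: "locally_integrable f \<Longrightarrow> f \<in> borel_measurable M"
  by (simp add: locally_integrable_def)

lemma locally_integrable_on_cell: "locally_integrable f \<Longrightarrow> set_integrable M (cell j x) f"
  unfolding locally_integrable_def
  by (meson cell_measurable cell_mono le0 set_integrable_subset)

lemma set_integrable_cellI:
  fixes f :: "'a \<Rightarrow> 'b::{banach, second_countable_topology}"
  assumes "f \<in> borel_measurable M" "(\<integral>\<^sup>+y\<in>cell j x. norm (f y) \<partial>M) < \<infinity>"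
  shows "set_integrable M (cell j x) f"
  unfolding set_integrable_def integrable_iff_bounded
proof
  show "(\<lambda>y. indicat_real (cell j x) y *\<^sub>R f y) \<in> borel_measurable M" using assms(1) by measurable
  have "(\<integral>\<^sup>+ y. ennreal (norm (indicat_real (cell j x) y *\<^sub>R f y)) \<partial>M) = (\<integral>\<^sup>+y\<in>cell j x. norm (f y) \<partial>M)"
    by (rule nn_integral_cong) (auto simp: indicator_def)
  with assms(2) show "(\<integral>\<^sup>+ y. ennreal (norm (indicat_real (cell j x) y *\<^sub>R f y)) \<partial>M) < \<infinity>" by simp
qed

lemma set_integrable_cellD:
  fixes f :: "'a \<Rightarrow> 'b::{banach, second_countable_topology}"
  assumes "set_integrable M (cell j x) f"
  shows "(\<integral>\<^sup>+y\<in>cell j x. norm (f y) \<partial>M) < \<infinity>"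
proof -
  have "(\<integral>\<^sup>+ y. ennreal (norm (indicat_real (cell j x) y *\<^sub>R f y)) \<partial>M) = (\<integral>\<^sup>+y\<in>cell j x. norm (f y) \<partial>M)"
    by (rule nn_integral_cong) (auto simp: indicator_def)
  with assms show ?thesis unfolding set_integrable_def integrable_iff_bounded by simp
qed

lemma locally_integrableI_bounded:
  fixes f :: "'a \<Rightarrow> 'b::{banach, second_countable_topology}"
  assumes [measurable]: "f \<in> borel_measurable M" and "\<And>x. norm (f x) \<le> B"
  shows "locally_integrable f"
  unfolding locally_integrable_def
proof (intro conjI allI set_integrable_cellI)
  fix x
  have "(\<integral>\<^sup>+y\<in>cell 0 x. norm (f y) \<partial>M) \<le> (\<integral>\<^sup>+y\<in>cell 0 x. ennreal B \<partial>M)"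
    by (rule nn_integral_mono) (auto simp: indicator_def assms ennreal_leI)
  also have "\<dots> = ennreal B * emeasure M (cell 0 x)" by (simp add: nn_integral_cmult_indicator)
  also have "\<dots> < \<infinity>" using finite_cell[of 0 x] by (simp add: ennreal_mult_less_top)
  finally show "(\<integral>\<^sup>+y\<in>cell 0 x. norm (f y) \<partial>M) < \<infinity>" .
qed (use assms in auto)

lemma locally_integrableI_square:
  fixes f :: "'a \<Rightarrow> 'b::{banach, second_countable_topology}"
  assumes [measurable]: "f \<in> borel_measurable M" and sq: "L2_square M f < \<infinity>"
  shows "locally_integrable f"
  unfolding locally_integrable_def
proof (intro conjI allI set_integrable_cellI)
  fix x
  have le: "norm (f y) \<le> (norm (f y))\<^sup>2 + 1" for y
  proof -
    have "0 \<le> (norm (f y) - 1)\<^sup>2" by simp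
    then have "2 * norm (f y) \<le> (norm (f y))\<^sup>2 + 1" by (simp add: power2_diff)
    then show ?thesis using norm_ge_zero[of "f y"] by linarith
  qed
  have "(\<integral>\<^sup>+y\<in>cell 0 x. norm (f y) \<partial>M) \<le> (\<integral>\<^sup>+y. ennreal ((norm (f y))\<^sup>2) + indicator (cell 0 x) y \<partial>M)"
  proof (rule nn_integral_mono)
    fix y
    have "ennreal (norm (f y)) \<le> ennreal ((norm (f y))\<^sup>2) + 1"
      using le[of y] by (metis ennreal_1 ennreal_leI ennreal_plus zero_le_one zero_le_power2)
    then show "ennreal (norm (f y)) * indicator (cell 0 x) y
        \<le> ennreal ((norm (f y))\<^sup>2) + indicator (cell 0 x) y"
      by (simp add: indicator_def)
  qed
  also have "\<dots> = L2_square M f + emeasure M (cell 0 x)"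
    by (simp add: nn_integral_add)
  also have "\<dots> < \<infinity>" using finite_cell[of 0 x] sq by simp
  finally show "(\<integral>\<^sup>+y\<in>cell 0 x. norm (f y) \<partial>M) < \<infinity>" .
qed (use assms in auto)

lemma avg_cong_cell: "idx j x = idx j y \<Longrightarrow> avg j f x = avg j f y"
  by (simp only: avg_def cell_eq[of j x y])

lemma avg_measurable [measurable]: "avg j f \<in> borel_measurable M"
  by (rule cell_constant_measurable[of j]) (auto intro: avg_cong_cell)

lemma set_integral_null_cell:
  fixes f :: "'a \<Rightarrow> 'b::{banach, second_countable_topology}"
  assumes "measure M (cell j x) = 0"
  shows "(LINT y:cell j x|M. f y) = 0"
proof -
  have "emeasure M (cell j x) = 0" using assms emeasure_cell by simp
  then have "AE y in M. y \<notin> cell j x" by (rule AE_not_in[OF null_setsI]) simp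
  then have "AE y in M. indicat_real (cell j x) y *\<^sub>R f y = 0" by (auto simp: indicator_def)
  then show ?thesis unfolding set_lebesgue_integral_def by (rule integral_eq_zero_AE)
qed

lemma measure_scaleR_avg:
  "measure M (cell j x) *\<^sub>R avg j f x = (LINT y:cell j x|M. f y)"
  by (cases "measure M (cell j x) = 0") (auto simp: avg_def set_integral_null_cell)

lemma set_integral_cell_const:
  fixes f :: "'a \<Rightarrow> 'b::{banach, second_countable_topology}"
  assumes "\<And>y. y \<in> cell j x \<Longrightarrow> f y = c"
  shows "(LINT y:cell j x|M. f y) = measure M (cell j x) *\<^sub>R c"
proof -
  have "(LINT y:cell j x|M. f y) = (LINT y:cell j x|M. c)"
    by (rule set_lebesgue_integral_cong) (auto simp: assms)
  then show ?thesis using finite_cell[of j x] by (simp add: set_lebesgue_integral_def)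
qed

lemma set_integral_avg:
  "(LINT y:cell j x|M. avg j f y) = (LINT y:cell j x|M. f y)"
  by (subst set_integral_cell_const[where c = "avg j f x"])
     (auto intro: avg_cong_cell simp: in_cell_iff measure_scaleR_avg)

lemma norm_set_integral_cell_le:
  fixes f :: "'a \<Rightarrow> 'b::{banach, second_countable_topology}"
  assumes "set_integrable M (cell j x) f"
  shows "ennreal (norm (LINT y:cell j x|M. f y)) \<le> (\<integral>\<^sup>+y\<in>cell j x. norm (f y) \<partial>M)"
proof -
  have "ennreal (norm (LINT y:cell j x|M. f y)) \<le> (\<integral>\<^sup>+y. norm (indicat_real (cell j x) y *\<^sub>R f y) \<partial>M)"
    unfolding set_lebesgue_integral_def
    by (rule integral_norm_bound_ennreal) (use assms in \<open>simp add: set_integrable_def\<close>)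
  also have "\<dots> = (\<integral>\<^sup>+y\<in>cell j x. norm (f y) \<partial>M)"
    by (rule nn_integral_cong) (auto simp: indicator_def)
  finally show ?thesis .
qed

lemma nn_integral_norm_avg_le:
  assumes "locally_integrable f"
  shows "(\<integral>\<^sup>+y\<in>cell j x. norm (avg j f y) \<partial>M) \<le> (\<integral>\<^sup>+y\<in>cell j x. norm (f y) \<partial>M)"
proof -
  have "(\<integral>\<^sup>+y\<in>cell j x. norm (avg j f y) \<partial>M) = ennreal (norm (avg j f x)) * emeasure M (cell j x)"
    by (rule nn_integral_cell_const) (metis avg_cong_cell in_cell_iff)
  also have "\<dots> = ennreal (norm (measure M (cell j x) *\<^sub>R avg j f x))"
    by (simp add: emeasure_cell ennreal_mult' mult.commute)
  also have "\<dots> \<le> (\<integral>\<^sup>+y\<in>cell j x. norm (f y) \<partial>M)"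
    unfolding measure_scaleR_avg
    by (rule norm_set_integral_cell_le[OF locally_integrable_on_cell[OF assms]])
  finally show ?thesis .
qed

lemma locally_integrable_avg:
  assumes f: "locally_integrable f"
  shows "locally_integrable (avg j f)"
  unfolding locally_integrable_def
proof (intro conjI allI set_integrable_cellI avg_measurable)
  fix x
  note [measurable] = locally_integrable_measurable[OF f]
  have "(\<integral>\<^sup>+y\<in>cell 0 x. norm (avg j f y) \<partial>M) \<le> (\<integral>\<^sup>+y\<in>cell 0 x. norm (f y) \<partial>M)"
    by (rule nn_integral_le_subcells[where j = j]) (auto intro: nn_integral_norm_avg_le f)
  also have "\<dots> < \<infinity>" by (rule set_integrable_cellD[OF locally_integrable_on_cell[OF f]])
  finally show "(\<integral>\<^sup>+y\<in>cell 0 x. norm (avg j f y) \<partial>M) < \<infinity>" .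
qed

lemma set_integral_eq_subcells:
  fixes f g :: "'a \<Rightarrow> 'b::{banach, second_countable_topology}"
  assumes f: "set_integrable M (cell i x) f" and g: "set_integrable M (cell i x) g"
    and eq: "\<And>y. y \<in> cell i x \<Longrightarrow> (LINT t:cell j y|M. f t) = (LINT t:cell j y|M. g t)"
    and "i \<le> j"
  shows "(LINT t:cell i x|M. f t) = (LINT t:cell i x|M. g t)"
proof -
  have "(LINT t|M. indicat_real (cell i x) t *\<^sub>R (f t - g t)) = 0"
  proof (rule integral_eq_0_cells[where j = j])
    show "integrable M (\<lambda>t. indicat_real (cell i x) t *\<^sub>R (f t - g t))"
      using set_integral_diff(1)[OF f g] by (simp add: set_integrable_def)
    fix y
    show "(LINT t:cell j y|M. indicat_real (cell i x) t *\<^sub>R (f t - g t)) = 0"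
    proof (cases "cell j y \<subseteq> cell i x")
      case True
      then have "(LINT t:cell j y|M. indicat_real (cell i x) t *\<^sub>R (f t - g t)) = (LINT t:cell j y|M. f t - g t)"
        by (intro set_lebesgue_integral_cong) (auto simp: indicator_def)
      also have "\<dots> = (LINT t:cell j y|M. f t) - (LINT t:cell j y|M. g t)"
        by (intro set_integral_diff set_integrable_subset[OF f] set_integrable_subset[OF g] True) auto
      also have "\<dots> = 0" using eq[of y] True self_in_cell[of y j] by (simp add: subset_iff)
      finally show ?thesis .
    next
      case False
      then have "cell j y \<inter> cell i x = {}" using cell_inter[OF \<open>i \<le> j\<close>] by blast
      then have "(LINT t:cell j y|M. indicat_real (cell i x) t *\<^sub>R (f t - g t)) = (LINT t:cell j y|M. 0)"
        by (intro set_lebesgue_integral_cong) (auto simp: indicator_def)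
      then show ?thesis by (simp add: set_lebesgue_integral_def)
    qed
  qed
  moreover have "(LINT t:cell i x|M. f t - g t) = (LINT t:cell i x|M. f t) - (LINT t:cell i x|M. g t)"
    by (rule set_integral_diff[OF f g])
  ultimately show ?thesis by (simp add: set_lebesgue_integral_def)
qed

lemma set_integral_avg_coarse:
  assumes f: "locally_integrable f" and "i \<le> j"
  shows "(LINT y:cell i x|M. avg j f y) = (LINT y:cell i x|M. f y)"
  by (rule set_integral_eq_subcells[where j = j])
     (use assms in \<open>auto intro: locally_integrable_on_cell locally_integrable_avg set_integral_avg\<close>)

lemma avg_avg:
  assumes "locally_integrable f" "i \<le> j"
  shows "avg i (avg j f) x = avg i f x"
  by (simp add: avg_def[of i] set_integral_avg_coarse[OF assms])

text \<open>Pythagoras: \<open>f - avg j f x\<close> is orthogonal to constants on the cell. Only an inequality is stated, since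
  it then holds whether or not the right-hand side is finite.\<close>

lemma variance_decomposition:
  fixes f :: "'a \<Rightarrow> complex"
  assumes f: "locally_integrable f"
  shows "(\<integral>\<^sup>+y\<in>cell j x. ennreal ((norm (f y - avg j f x))\<^sup>2 + (norm (avg j f x))\<^sup>2) \<partial>M)
      \<le> (\<integral>\<^sup>+y\<in>cell j x. ennreal ((norm (f y))\<^sup>2) \<partial>M)"
proof (cases "(\<integral>\<^sup>+y\<in>cell j x. ennreal ((norm (f y))\<^sup>2) \<partial>M) = \<infinity>")
  case False
  let ?Q = "cell j x" and ?a = "avg j f x"
  note [measurable] = locally_integrable_measurable[OF f]
  have i1: "set_integrable M ?Q f" by (rule locally_integrable_on_cell[OF f])
  have i2: "set_integrable M ?Q (\<lambda>y. (norm (f y))\<^sup>2)"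
    by (rule set_integrable_cellI) (use False in \<open>auto simp: top.not_eq_extremum\<close>)
  have i3: "set_integrable M ?Q (\<lambda>y. f y \<bullet> ?a)"
    using i1 by (simp add: set_integrable_def flip: inner_scaleR_left)
  have i4: "set_integrable M ?Q (\<lambda>y. (norm ?a)\<^sup>2)"
    using finite_cell by (simp add: set_integrable_def)
  have eq: "(norm (f y - ?a))\<^sup>2 + (norm ?a)\<^sup>2 = (norm (f y))\<^sup>2 + (2 * (norm ?a)\<^sup>2 - 2 * (f y \<bullet> ?a))" for y
    by (simp add: power2_norm_eq_inner inner_diff_left inner_diff_right inner_commute)
  have i5: "set_integrable M ?Q (\<lambda>y. 2 * (norm ?a)\<^sup>2 - 2 * (f y \<bullet> ?a))"
    using i3 i4 by auto
  have z: "(LINT y:?Q|M. 2 * (norm ?a)\<^sup>2 - 2 * (f y \<bullet> ?a)) = 0"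
  proof -
    have "(LINT y:?Q|M. f y \<bullet> ?a) = (LINT y:?Q|M. f y) \<bullet> ?a"
      using i1 by (simp add: set_lebesgue_integral_def set_integrable_def flip: inner_scaleR_left)
    also have "\<dots> = measure M ?Q * (norm ?a)\<^sup>2"
      by (simp add: power2_norm_eq_inner flip: measure_scaleR_avg)
    finally have 1: "(LINT y:?Q|M. f y \<bullet> ?a) = measure M ?Q * (norm ?a)\<^sup>2" .
    have 2: "(LINT y:?Q|M. (norm ?a)\<^sup>2) = measure M ?Q * (norm ?a)\<^sup>2"
      by (subst set_integral_cell_const[where c = "(norm ?a)\<^sup>2"]) auto
    have "(LINT y:?Q|M. 2 * (norm ?a)\<^sup>2 - 2 * (f y \<bullet> ?a))
        = (LINT y:?Q|M. 2 * (norm ?a)\<^sup>2) - (LINT y:?Q|M. 2 * (f y \<bullet> ?a))"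
      using i3 i4 by (intro set_integral_diff) auto
    also have "\<dots> = 2 * (LINT y:?Q|M. (norm ?a)\<^sup>2) - 2 * (LINT y:?Q|M. f y \<bullet> ?a)"
      by (simp only: set_integral_mult_right)
    also have "\<dots> = 0" by (simp only: 1 2 diff_self)
    finally show ?thesis .
  qed
  have "(\<integral>\<^sup>+y\<in>?Q. ennreal ((norm (f y - ?a))\<^sup>2 + (norm ?a)\<^sup>2) \<partial>M)
      = (\<integral>\<^sup>+y. ennreal (indicat_real ?Q y * ((norm (f y - ?a))\<^sup>2 + (norm ?a)\<^sup>2)) \<partial>M)"
    by (rule nn_integral_cong) (auto simp: indicator_def)
  also have "\<dots> = ennreal (LINT y:?Q|M. (norm (f y - ?a))\<^sup>2 + (norm ?a)\<^sup>2)"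
    unfolding set_lebesgue_integral_def real_scaleR_def
  proof (rule nn_integral_eq_integral)
    show "integrable M (\<lambda>y. indicat_real ?Q y * ((norm (f y - ?a))\<^sup>2 + (norm ?a)\<^sup>2))"
      using set_integral_add(1)[OF i2 i5] unfolding eq set_integrable_def by simp
  qed auto
  also have "(LINT y:?Q|M. (norm (f y - ?a))\<^sup>2 + (norm ?a)\<^sup>2) = (LINT y:?Q|M. (norm (f y))\<^sup>2)"
    unfolding eq using set_integral_add(2)[OF i2 i5] z by simp
  also have "ennreal \<dots> = (\<integral>\<^sup>+y. ennreal (indicat_real ?Q y * (norm (f y))\<^sup>2) \<partial>M)"
    unfolding set_lebesgue_integral_def real_scaleR_def
    by (rule nn_integral_eq_integral[symmetric]) (use i2 in \<open>auto simp: set_integrable_def\<close>)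
  also have "\<dots> = (\<integral>\<^sup>+y\<in>?Q. ennreal ((norm (f y))\<^sup>2) \<partial>M)"
    by (rule nn_integral_cong) (auto simp: indicator_def)
  finally show ?thesis by simp
qed auto

end

context nested_partition begin

lemma nn_integral_cell_cong:
  "(\<And>y. y \<in> cell j x \<Longrightarrow> u y = v y) \<Longrightarrow> (\<integral>\<^sup>+y\<in>cell j x. u y \<partial>M) = (\<integral>\<^sup>+y\<in>cell j x. v y \<partial>M)"
  by (rule nn_integral_cong) (auto simp: indicator_def)

lemma avg_on_cell: "y \<in> cell j x \<Longrightarrow> avg j f y = avg j f x"
  by (rule avg_cong_cell) (simp add: in_cell_iff)

lemma nn_integral_avg_square_le:
  fixes f :: "'a \<Rightarrow> complex"
  assumes f: "locally_integrable f"
  shows "(\<integral>\<^sup>+y\<in>cell j x. ennreal ((norm (avg j f y))\<^sup>2) \<partial>M) \<le> (\<integral>\<^sup>+y\<in>cell j x. ennreal ((norm (f y))\<^sup>2) \<partial>M)"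
proof -
  have "(\<integral>\<^sup>+y\<in>cell j x. ennreal ((norm (avg j f y))\<^sup>2) \<partial>M)
      = (\<integral>\<^sup>+y. ennreal ((norm (avg j f x))\<^sup>2) * indicator (cell j x) y \<partial>M)"
    by (rule nn_integral_cell_cong) (frule avg_on_cell[where f = f], simp)
  also have "\<dots> \<le> (\<integral>\<^sup>+y\<in>cell j x. ennreal ((norm (f y - avg j f x))\<^sup>2 + (norm (avg j f x))\<^sup>2) \<partial>M)"
    by (intro nn_integral_mono mult_right_mono ennreal_leI) auto
  also note variance_decomposition[OF f]
  finally show ?thesis .
qed

lemma nn_integral_avg_square_le':
  fixes f :: "'a \<Rightarrow> complex"
  assumes f: "locally_integrable f"
  shows "L2_square M (avg j f) \<le> L2_square M f"
  by (rule nn_integral_le_cells[where j = j])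
     (use locally_integrable_measurable[OF f] in \<open>auto intro: nn_integral_avg_square_le[OF f]\<close>)

text \<open>The variance decomposition of \<open>avg (Suc j) f\<close> on the cells of level \<open>j\<close>, whose means are \<open>avg j f\<close>.\<close>

lemma martingale_difference_square:
  fixes f :: "'a \<Rightarrow> complex"
  assumes f: "locally_integrable f"
  shows "(\<integral>\<^sup>+y. ennreal ((norm (avg (Suc j) f y - avg j f y))\<^sup>2) \<partial>M) + L2_square M (avg j f)
    \<le> (\<integral>\<^sup>+y. ennreal ((norm (avg (Suc j) f y))\<^sup>2) \<partial>M)"
proof -
  have "(\<integral>\<^sup>+y. ennreal ((norm (avg (Suc j) f y - avg j f y))\<^sup>2 + (norm (avg j f y))\<^sup>2) \<partial>M)
    \<le> (\<integral>\<^sup>+y. ennreal ((norm (avg (Suc j) f y))\<^sup>2) \<partial>M)"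
  proof (rule nn_integral_le_cells[where j = j])
    fix x
    have "(\<integral>\<^sup>+y\<in>cell j x. ennreal ((norm (avg (Suc j) f y - avg j f y))\<^sup>2 + (norm (avg j f y))\<^sup>2) \<partial>M)
      = (\<integral>\<^sup>+y\<in>cell j x. ennreal ((norm (avg (Suc j) f y - avg j (avg (Suc j) f) x))\<^sup>2
           + (norm (avg j (avg (Suc j) f) x))\<^sup>2) \<partial>M)"
      unfolding avg_avg[OF f le_SucI[OF order.refl]]
      by (rule nn_integral_cell_cong) (frule avg_on_cell[where f = f], simp)
    also note variance_decomposition[OF locally_integrable_avg[OF f]]
    finally show "(\<integral>\<^sup>+y\<in>cell j x. ennreal ((norm (avg (Suc j) f y - avg j f y))\<^sup>2 + (norm (avg j f y))\<^sup>2) \<partial>M)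
      \<le> (\<integral>\<^sup>+y\<in>cell j x. ennreal ((norm (avg (Suc j) f y))\<^sup>2) \<partial>M)" .
  qed auto
  then show ?thesis by (simp add: nn_integral_add)
qed

lemma sum_martingale_differences:
  fixes f :: "'a \<Rightarrow> complex"
  assumes f: "locally_integrable f"
  shows "(\<Sum>j<N. \<integral>\<^sup>+y. ennreal ((norm (avg (Suc j) f y - avg j f y))\<^sup>2) \<partial>M)
    \<le> L2_square M f"
proof -
  have "(\<Sum>j<N. \<integral>\<^sup>+y. ennreal ((norm (avg (Suc j) f y - avg j f y))\<^sup>2) \<partial>M)
      + L2_square M (avg 0 f) \<le> L2_square M (avg N f)"
  proof (induction N)
    case (Suc N)
    have "(\<Sum>j<Suc N. \<integral>\<^sup>+y. ennreal ((norm (avg (Suc j) f y - avg j f y))\<^sup>2) \<partial>M)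
        + L2_square M (avg 0 f)
      \<le> (\<integral>\<^sup>+y. ennreal ((norm (avg (Suc N) f y - avg N f y))\<^sup>2) \<partial>M) + L2_square M (avg N f)"
      using add_left_mono[OF Suc, of "\<integral>\<^sup>+y. ennreal ((norm (avg (Suc N) f y - avg N f y))\<^sup>2) \<partial>M"]
      by (simp add: ac_simps)
    also note martingale_difference_square[OF f]
    finally show ?case .
  qed auto
  also note nn_integral_avg_square_le'[OF f]
  finally show ?thesis by (meson add_increasing2 dual_order.trans le_iff_add zero_le)
qed

lemma nn_integral_cell_real:
  fixes f :: "'a \<Rightarrow> real"
  assumes f: "locally_integrable f" and pos: "\<And>x. 0 \<le> f x"
  shows "(\<integral>\<^sup>+y\<in>cell j x. ennreal (f y) \<partial>M) = ennreal (measure M (cell j x) * avg j f x)"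
proof -
  have "(\<integral>\<^sup>+y\<in>cell j x. ennreal (f y) \<partial>M) = (\<integral>\<^sup>+y. ennreal (indicat_real (cell j x) y * f y) \<partial>M)"
    by (rule nn_integral_cong) (auto simp: indicator_def)
  also have "\<dots> = ennreal (LINT y:cell j x|M. f y)"
    unfolding set_lebesgue_integral_def real_scaleR_def
    by (rule nn_integral_eq_integral)
       (use locally_integrable_on_cell[OF f] pos in \<open>auto simp: set_integrable_def\<close>)
  also have "(LINT y:cell j x|M. f y) = measure M (cell j x) * avg j f x"
    by (simp flip: measure_scaleR_avg)
  finally show ?thesis .
qed

lemma avg_nonneg: "(\<And>x. 0 \<le> f x) \<Longrightarrow> 0 \<le> (avg j f x :: real)"
  unfolding avg_def set_lebesgue_integral_def
  by (auto intro!: mult_nonneg_nonneg integral_nonneg)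

section \<open>Carleson's embedding theorem\<close>

text \<open>The convexity of \<open>(g, w) \<mapsto> g\<^sup>2 / w\<close>. Passing to a cell \<open>Q\<close> from its subcells turns the pair of means
  \<open>(u, v - a)\<close> into \<open>(u, v)\<close>, and the function \<open>4 u\<^sup>2 / v\<close> thereby loses at least the contribution
  \<open>a u\<^sup>2\<close> of the weight \<open>a\<close> of \<open>Q\<close>, because \<open>v (v - a) \<le> 4\<close>.\<close>

lemma carleson_embedding_step:
  fixes g w :: "'a \<Rightarrow> real" and u v a \<mu> :: real
  assumes [measurable]: "g \<in> borel_measurable M" "w \<in> borel_measurable M" "Q \<in> sets M"
    and pos: "\<And>x. 0 \<le> g x" "\<And>x. 1 \<le> w x" "0 \<le> u" "0 \<le> a" "0 \<le> \<mu>"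
    and v: "v \<le> 2" "1 \<le> v - a"
    and g: "(\<integral>\<^sup>+y\<in>Q. ennreal (g y) \<partial>M) = ennreal (\<mu> * u)"
    and w: "(\<integral>\<^sup>+y\<in>Q. ennreal (w y) \<partial>M) = ennreal (\<mu> * (v - a))"
  shows "ennreal (\<mu> * (a * u\<^sup>2 + 4 * u\<^sup>2 / v)) \<le> (\<integral>\<^sup>+y\<in>Q. ennreal (4 * (g y)\<^sup>2 / w y) \<partial>M)"
proof (cases "(\<integral>\<^sup>+y\<in>Q. ennreal (4 * (g y)\<^sup>2 / w y) \<partial>M) = \<infinity>")
  case False
  then obtain X where X: "(\<integral>\<^sup>+y\<in>Q. ennreal (4 * (g y)\<^sup>2 / w y) \<partial>M) = ennreal X" "0 \<le> X"
    by (cases "\<integral>\<^sup>+y\<in>Q. ennreal (4 * (g y)\<^sup>2 / w y) \<partial>M") auto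
  \<comment> \<open>The slope of the supporting line of \<open>g\<^sup>2 / w\<close> at the point \<open>(u, v - a)\<close>.\<close>
  define c where "c = u / (v - a)"
  have c: "0 \<le> c" using pos v by (simp add: c_def)
  have pt: "ennreal (8 * c * g y) \<le> ennreal (4 * (g y)\<^sup>2 / w y) + ennreal (4 * c\<^sup>2 * w y)" for y
  proof -
    have "w y > 0" using pos(2)[of y] by linarith
    have "0 \<le> 4 * (g y - c * w y)\<^sup>2 / w y" using \<open>w y > 0\<close> by simp
    also have "\<dots> = 4 * (g y)\<^sup>2 / w y + 4 * c\<^sup>2 * w y - 8 * c * g y"
      using \<open>w y > 0\<close> by (simp add: field_simps power2_eq_square)
    finally have "8 * c * g y \<le> 4 * (g y)\<^sup>2 / w y + 4 * c\<^sup>2 * w y" by simp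
    then have "ennreal (8 * c * g y) \<le> ennreal (4 * (g y)\<^sup>2 / w y + 4 * c\<^sup>2 * w y)" by (rule ennreal_leI)
    also have "\<dots> = ennreal (4 * (g y)\<^sup>2 / w y) + ennreal (4 * c\<^sup>2 * w y)"
      using \<open>w y > 0\<close> by (intro ennreal_plus) auto
    finally show ?thesis .
  qed
  have "ennreal (8 * c * (\<mu> * u)) = ennreal (8 * c) * (\<integral>\<^sup>+y\<in>Q. ennreal (g y) \<partial>M)"
    unfolding g using c pos by (simp add: ennreal_mult)
  also have "\<dots> = (\<integral>\<^sup>+y\<in>Q. ennreal (8 * c * g y) \<partial>M)"
    using c pos by (subst nn_integral_cmult[symmetric]) (auto simp: ennreal_mult mult.assoc)
  also have "\<dots> \<le> (\<integral>\<^sup>+y. ennreal (4 * (g y)\<^sup>2 / w y) * indicator Q y + ennreal (4 * c\<^sup>2) * (ennreal (w y) * indicator Q y) \<partial>M)"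
  proof (rule nn_integral_mono)
    fix y
    show "ennreal (8 * c * g y) * indicator Q y
        \<le> ennreal (4 * (g y)\<^sup>2 / w y) * indicator Q y + ennreal (4 * c\<^sup>2) * (ennreal (w y) * indicator Q y)"
      using pt[of y] pos(2)[of y] by (cases "y \<in> Q") (auto simp: ennreal_mult)
  qed
  also have "\<dots> = ennreal X + ennreal (4 * c\<^sup>2) * ennreal (\<mu> * (v - a))"
    by (simp add: nn_integral_add nn_integral_cmult X w)
  also have "\<dots> = ennreal (X + 4 * c\<^sup>2 * (\<mu> * (v - a)))"
    using X pos v by (simp add: ennreal_mult)
  finally have "8 * c * (\<mu> * u) \<le> X + 4 * c\<^sup>2 * (\<mu> * (v - a))"
    using X pos v by (subst (asm) ennreal_le_iff) auto
  moreover have "8 * c * (\<mu> * u) - 4 * c\<^sup>2 * (\<mu> * (v - a)) = \<mu> * (4 * u\<^sup>2 / (v - a))"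
  proof -
    have cu: "c * (v - a) = u" using v by (simp add: c_def)
    have "4 * c\<^sup>2 * (\<mu> * (v - a)) = 4 * c * \<mu> * (c * (v - a))" by (simp add: power2_eq_square)
    moreover have "u\<^sup>2 / (v - a) = c * u" by (simp add: c_def power2_eq_square)
    ultimately have "u\<^sup>2 / (v - a) = c * u" "4 * c\<^sup>2 * (\<mu> * (v - a)) = 4 * c * \<mu> * u"
      by (simp_all only: cu)
    moreover have "4 * u\<^sup>2 / (v - a) = 4 * (u\<^sup>2 / (v - a))" by simp
    ultimately show ?thesis by (simp only:) simp
  qed
  ultimately have 1: "\<mu> * (4 * u\<^sup>2 / (v - a)) \<le> X" by linarith
  have "v * (v - a) \<le> 2 * 2"
    by (rule mult_mono) (use v pos in auto)
  then have "a * (v * (v - a)) \<le> a * 4" using pos by (intro mult_left_mono) auto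
  then have "a + 4 / v \<le> 4 / (v - a)" using v pos by (simp add: field_simps)
  then have "u\<^sup>2 * (a + 4 / v) \<le> u\<^sup>2 * (4 / (v - a))" by (intro mult_left_mono) auto
  then have "a * u\<^sup>2 + 4 * u\<^sup>2 / v \<le> 4 * u\<^sup>2 / (v - a)" by (simp add: algebra_simps)
  then have "\<mu> * (a * u\<^sup>2 + 4 * u\<^sup>2 / v) \<le> \<mu> * (4 * u\<^sup>2 / (v - a))" using pos by (intro mult_left_mono) auto
  with 1 show ?thesis unfolding X by (intro ennreal_leI) linarith
qed simp

text \<open>The Bellman function proof. With \<open>u\<^sub>j\<close> the average of \<open>f\<close> and \<open>v\<^sub>j\<close> one plus the average of the weights
  of level \<open>j\<close> and finer, so that \<open>1 \<le> v\<^sub>j \<le> 2\<close>, the induction from fine to coarse levels shows that on every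
  cell of level \<open>j\<close> the integral of \<open>\<Sum>\<^sub>l\<^sub>\<ge>\<^sub>j a\<^sub>l u\<^sub>l\<^sup>2 + 4 u\<^sub>j\<^sup>2 / v\<^sub>j\<close> is at most that of \<open>4 f\<^sup>2\<close>. The weights
  may vary inside the cells.\<close>

lemma carleson_embedding_normalized:
  fixes f :: "'a \<Rightarrow> real" and a :: "nat \<Rightarrow> 'a \<Rightarrow> ennreal"
  assumes f: "locally_integrable f" and f0: "\<And>x. 0 \<le> f x"
    and a [measurable]: "\<And>l. a l \<in> borel_measurable M"
    and packing: "\<And>j x. j \<le> N \<Longrightarrow> (\<integral>\<^sup>+y\<in>cell j x. (\<Sum>l\<in>{j..<N}. a l y) \<partial>M) \<le> emeasure M (cell j x)"
  shows "(\<integral>\<^sup>+y. (\<Sum>l<N. a l y * ennreal ((avg l f y)\<^sup>2)) \<partial>M) \<le> 4 * (\<integral>\<^sup>+y. ennreal ((f y)\<^sup>2) \<partial>M)"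
proof -
  note [measurable] = locally_integrable_measurable[OF f]
  define s where "s j x = enn2real (\<integral>\<^sup>+y\<in>cell j x. (\<Sum>l\<in>{j..<N}. a l y) \<partial>M)" for j x
  have s: "(\<integral>\<^sup>+y\<in>cell j x. (\<Sum>l\<in>{j..<N}. a l y) \<partial>M) = ennreal (s j x)" "0 \<le> s j x"
    "s j x \<le> measure M (cell j x)" if "j \<le> N" for j x
  proof -
    have le: "(\<integral>\<^sup>+y\<in>cell j x. (\<Sum>l\<in>{j..<N}. a l y) \<partial>M) \<le> ennreal (measure M (cell j x))"
      using packing[OF that, of x] by (simp add: emeasure_cell)
    then show 1: "(\<integral>\<^sup>+y\<in>cell j x. (\<Sum>l\<in>{j..<N}. a l y) \<partial>M) = ennreal (s j x)"
      unfolding s_def by (metis ennreal_enn2real ennreal_less_top le_less_trans)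
    show "0 \<le> s j x" by (simp add: s_def)
    from le show "s j x \<le> measure M (cell j x)" unfolding 1 by (simp add: ennreal_le_iff)
  qed
  define v where "v j x = 1 + s j x / measure M (cell j x)" for j x
  have v1: "1 \<le> v j x" "v j x \<le> 2" if "j \<le> N" for j x
    using s(2,3)[OF that, of x] by (auto simp: v_def divide_le_eq_1)
  have sv: "measure M (cell j x) * v j x = measure M (cell j x) + s j x" if "j \<le> N" for j x
    using s(2,3)[OF that, of x] by (cases "measure M (cell j x) = 0") (auto simp: v_def algebra_simps)
  have s_cell: "s j x = s j y" if "idx j x = idx j y" for j x y
    using cell_eq[OF that] by (simp add: s_def)
  have v_cell: "v j x = v j y" if "idx j x = idx j y" for j x y
    using cell_eq[OF that] s_cell[OF that] by (simp add: v_def)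
  have vm [measurable]: "v j \<in> borel_measurable M" for j
    by (rule cell_constant_measurable[of j]) (auto intro: v_cell)
  \<comment> \<open>The finest level is the pair \<open>(f, 1)\<close> itself, so that the induction needs only one kind of step.\<close>
  define g where "g j = (if j < N then avg j f else f)" for j
  define w where "w j = (if j < N then v j else (\<lambda>_. 1))" for j
  have gm [measurable]: "g j \<in> borel_measurable M" and wm [measurable]: "w j \<in> borel_measurable M" for j
    by (auto simp: g_def w_def)
  have g0: "0 \<le> g j x" for j x by (auto simp: g_def f0 avg_nonneg)
  have w1: "1 \<le> w j x" for j x by (auto simp: w_def v1)
  have int_g: "(\<integral>\<^sup>+y\<in>cell j x. ennreal (g (Suc j) y) \<partial>M) = ennreal (measure M (cell j x) * avg j f x)" for j x
  proof (cases "Suc j < N")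
    case True
    then show ?thesis
      using nn_integral_cell_real[OF locally_integrable_avg[OF f, of "Suc j"], of j x]
      by (simp add: g_def avg_nonneg f0 avg_avg f)
  next
    case False
    then show ?thesis using nn_integral_cell_real[OF f, of j x] by (simp add: g_def f0)
  qed
  have int_v: "(\<integral>\<^sup>+y\<in>cell j x. ennreal (v j y) \<partial>M) = (\<integral>\<^sup>+y\<in>cell j x. (1 + (\<Sum>l\<in>{j..<N}. a l y)) \<partial>M)"
    if "j \<le> N" for j x
  proof -
    have "(\<integral>\<^sup>+y\<in>cell j x. ennreal (v j y) \<partial>M) = ennreal (v j x) * emeasure M (cell j x)"
      by (rule nn_integral_cell_const) (metis v_cell in_cell_iff)
    also have "\<dots> = ennreal (measure M (cell j x) * v j x)"
      using v1(1)[OF that, of x] by (simp add: emeasure_cell ennreal_mult mult.commute)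
    also have "\<dots> = emeasure M (cell j x) + (\<integral>\<^sup>+y\<in>cell j x. (\<Sum>l\<in>{j..<N}. a l y) \<partial>M)"
      using s(2)[OF that, of x] by (simp add: sv[OF that] s(1)[OF that] emeasure_cell)
    also have "\<dots> = (\<integral>\<^sup>+y\<in>cell j x. (1 + (\<Sum>l\<in>{j..<N}. a l y)) \<partial>M)"
      by (simp add: distrib_right nn_integral_add)
    finally show ?thesis .
  qed
  have int_w: "(\<integral>\<^sup>+y\<in>cell j x. ennreal (w (Suc j) y) \<partial>M) = (\<integral>\<^sup>+y\<in>cell j x. (1 + (\<Sum>l\<in>{Suc j..<N}. a l y)) \<partial>M)"
    if "j < N" for j x
  proof (cases "Suc j < N")
    case True
    have le: "Suc j \<le> N" using True by simp
    show ?thesis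
      unfolding w_def if_P[OF True]
      by (rule antisym; rule nn_integral_le_subcells[where j = "Suc j"])
         (auto simp: int_v[OF le])
  qed (simp add: w_def)
  have cell_step: "(\<integral>\<^sup>+y\<in>cell j x. (a j y * ennreal ((avg j f y)\<^sup>2) + ennreal (4 * (avg j f y)\<^sup>2 / v j y)) \<partial>M)
      \<le> (\<integral>\<^sup>+y\<in>cell j x. ennreal (4 * (g (Suc j) y)\<^sup>2 / w (Suc j) y) \<partial>M)" if "j < N" for j x
  proof -
    let ?Q = "cell j x" and ?\<mu> = "measure M (cell j x)"
    have jN: "j \<le> N" "Suc j \<le> N" using that by auto
    define \<alpha> where "\<alpha> = (\<integral>\<^sup>+y\<in>?Q. a j y \<partial>M)"
    define r where "r = (\<integral>\<^sup>+y\<in>?Q. (\<Sum>l\<in>{Suc j..<N}. a l y) \<partial>M)"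
    have split: "\<alpha> + r = ennreal (s j x)"
      unfolding s(1)[OF jN(1), symmetric] \<alpha>_def r_def using that
      by (simp add: nn_integral_add[symmetric] sum.atLeast_Suc_lessThan distrib_right)
    then have "\<alpha> < \<infinity>" "r < \<infinity>" by (metis ennreal_less_top infinity_ennreal_def le_iff_add le_less_trans add.commute)+
    then obtain \<alpha>' r' where \<alpha>': "\<alpha> = ennreal \<alpha>'" "0 \<le> \<alpha>'" and r': "r = ennreal r'" "0 \<le> r'"
      by (metis enn2real_nonneg ennreal_enn2real infinity_ennreal_def)
    have sum: "\<alpha>' + r' = s j x"
      using split s(2)[OF jN(1), of x] by (simp add: \<alpha>' r' flip: ennreal_plus)
    define b where "b = \<alpha>' / ?\<mu>"
    have null: "\<alpha>' = 0" if "?\<mu> = 0" using s(2,3)[OF jN(1), of x] sum that \<alpha>' r' by simp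
    have b: "0 \<le> b" "?\<mu> * b = \<alpha>'" using \<alpha>' null by (auto simp: b_def)
    have "ennreal (?\<mu> * (b * (avg j f x)\<^sup>2 + 4 * (avg j f x)\<^sup>2 / v j x))
        \<le> (\<integral>\<^sup>+y\<in>?Q. ennreal (4 * (g (Suc j) y)\<^sup>2 / w (Suc j) y) \<partial>M)"
    proof (rule carleson_embedding_step[where u = "avg j f x" and v = "v j x" and a = b and \<mu> = ?\<mu>])
      show "1 \<le> v j x - b"
        using sum r' by (auto simp: v_def b_def simp flip: diff_divide_distrib)
      have "(\<integral>\<^sup>+y\<in>?Q. ennreal (w (Suc j) y) \<partial>M) = emeasure M ?Q + r"
        unfolding int_w[OF that] r_def by (simp add: distrib_right nn_integral_add)
      also have "\<dots> = ennreal (?\<mu> + r')"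
        using r' by (simp add: emeasure_cell)
      also have "?\<mu> + r' = ?\<mu> * (v j x - b)"
        using b(2) sum sv[OF jN(1), of x] unfolding right_diff_distrib by linarith
      finally show "(\<integral>\<^sup>+y\<in>?Q. ennreal (w (Suc j) y) \<partial>M) = ennreal (?\<mu> * (v j x - b))" .
      show "0 \<le> avg j f x" by (rule avg_nonneg[OF f0])
      show "v j x \<le> 2" by (rule v1(2)[OF jN(1)])
    qed (simp_all add: g0 w1 int_g b(1))
    moreover have "(\<integral>\<^sup>+y\<in>?Q. (a j y * ennreal ((avg j f y)\<^sup>2) + ennreal (4 * (avg j f y)\<^sup>2 / v j y)) \<partial>M)
        = ennreal (?\<mu> * (b * (avg j f x)\<^sup>2 + 4 * (avg j f x)\<^sup>2 / v j x))"
    proof -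
      have "(\<integral>\<^sup>+y\<in>?Q. (a j y * ennreal ((avg j f y)\<^sup>2) + ennreal (4 * (avg j f y)\<^sup>2 / v j y)) \<partial>M)
          = (\<integral>\<^sup>+y\<in>?Q. (a j y * ennreal ((avg j f x)\<^sup>2) + ennreal (4 * (avg j f x)\<^sup>2 / v j x)) \<partial>M)"
      proof (rule nn_integral_cell_cong)
        fix y assume "y \<in> ?Q"
        then have "avg j f y = avg j f x" and "v j y = v j x"
          by (rule avg_on_cell, intro v_cell, simp add: in_cell_iff)
        then show "a j y * ennreal ((avg j f y)\<^sup>2) + ennreal (4 * (avg j f y)\<^sup>2 / v j y)
            = a j y * ennreal ((avg j f x)\<^sup>2) + ennreal (4 * (avg j f x)\<^sup>2 / v j x)" by simp
      qed
      also have "\<dots> = (\<integral>\<^sup>+y. (a j y * indicator ?Q y * ennreal ((avg j f x)\<^sup>2) + ennreal (4 * (avg j f x)\<^sup>2 / v j x) * indicator ?Q y) \<partial>M)"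
        by (rule nn_integral_cong) (simp add: indicator_def)
      also have "\<dots> = \<alpha> * ennreal ((avg j f x)\<^sup>2) + ennreal (4 * (avg j f x)\<^sup>2 / v j x) * emeasure M ?Q"
        by (simp add: nn_integral_add nn_integral_multc nn_integral_cmult_indicator \<alpha>_def)
      also have "\<dots> = ennreal (\<alpha>' * (avg j f x)\<^sup>2 + 4 * (avg j f x)\<^sup>2 / v j x * ?\<mu>)"
        using \<alpha>'(2) v1(1)[OF jN(1), of x] by (simp add: \<alpha>'(1) emeasure_cell ennreal_mult[symmetric])
      also have "\<alpha>' * (avg j f x)\<^sup>2 + 4 * (avg j f x)\<^sup>2 / v j x * ?\<mu>
          = ?\<mu> * (b * (avg j f x)\<^sup>2 + 4 * (avg j f x)\<^sup>2 / v j x)"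
        unfolding b(2)[symmetric] by (simp add: algebra_simps)
      finally show ?thesis .
    qed
    ultimately show ?thesis by simp
  qed
  have main: "(\<integral>\<^sup>+y\<in>cell j x. ((\<Sum>l\<in>{j..<N}. a l y * ennreal ((avg l f y)\<^sup>2)) + ennreal (4 * (g j y)\<^sup>2 / w j y)) \<partial>M)
      \<le> (\<integral>\<^sup>+y\<in>cell j x. ennreal (4 * (f y)\<^sup>2) \<partial>M)" if "j \<le> N" for j x
    using that
  proof (induction j arbitrary: x rule: inc_induct)
    case base
    then show ?case by (simp add: g_def w_def)
  next
    case (step n)
    let ?T = "\<lambda>y. \<Sum>l\<in>{Suc n..<N}. a l y * ennreal ((avg l f y)\<^sup>2)"
    have "(\<integral>\<^sup>+y\<in>cell n x. ((\<Sum>l\<in>{n..<N}. a l y * ennreal ((avg l f y)\<^sup>2)) + ennreal (4 * (g n y)\<^sup>2 / w n y)) \<partial>M)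
        = (\<integral>\<^sup>+y. ?T y * indicator (cell n x) y + (a n y * ennreal ((avg n f y)\<^sup>2) + ennreal (4 * (avg n f y)\<^sup>2 / v n y)) * indicator (cell n x) y \<partial>M)"
      using \<open>n < N\<close> by (intro nn_integral_cong) (simp add: sum.atLeast_Suc_lessThan g_def w_def indicator_def ac_simps)
    also have "\<dots> = (\<integral>\<^sup>+y\<in>cell n x. ?T y \<partial>M) + (\<integral>\<^sup>+y\<in>cell n x. (a n y * ennreal ((avg n f y)\<^sup>2) + ennreal (4 * (avg n f y)\<^sup>2 / v n y)) \<partial>M)"
      by (rule nn_integral_add) auto
    also have "\<dots> \<le> (\<integral>\<^sup>+y\<in>cell n x. ?T y \<partial>M) + (\<integral>\<^sup>+y\<in>cell n x. ennreal (4 * (g (Suc n) y)\<^sup>2 / w (Suc n) y) \<partial>M)"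
      by (rule add_left_mono[OF cell_step[OF \<open>n < N\<close>]])
    also have "\<dots> = (\<integral>\<^sup>+y\<in>cell n x. (?T y + ennreal (4 * (g (Suc n) y)\<^sup>2 / w (Suc n) y)) \<partial>M)"
      by (simp add: distrib_right nn_integral_add)
    also have "\<dots> \<le> (\<integral>\<^sup>+y\<in>cell n x. ennreal (4 * (f y)\<^sup>2) \<partial>M)"
      by (rule nn_integral_le_subcells[where j = "Suc n"]) (use step.IH in auto)
    finally show ?case .
  qed
  have "(\<integral>\<^sup>+y. (\<Sum>l<N. a l y * ennreal ((avg l f y)\<^sup>2)) \<partial>M) \<le> (\<integral>\<^sup>+y. ennreal (4 * (f y)\<^sup>2) \<partial>M)"
  proof (rule nn_integral_le_cells[where j = 0])
    fix x
    have "(\<integral>\<^sup>+y\<in>cell 0 x. (\<Sum>l<N. a l y * ennreal ((avg l f y)\<^sup>2)) \<partial>M)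
      \<le> (\<integral>\<^sup>+y\<in>cell 0 x. ((\<Sum>l\<in>{0..<N}. a l y * ennreal ((avg l f y)\<^sup>2)) + ennreal (4 * (g 0 y)\<^sup>2 / w 0 y)) \<partial>M)"
      by (intro nn_integral_mono mult_right_mono) (auto simp: lessThan_atLeast0)
    also note main[of 0 x]
    finally show "(\<integral>\<^sup>+y\<in>cell 0 x. (\<Sum>l<N. a l y * ennreal ((avg l f y)\<^sup>2)) \<partial>M)
      \<le> (\<integral>\<^sup>+y\<in>cell 0 x. ennreal (4 * (f y)\<^sup>2) \<partial>M)" by simp
  qed auto
  then show ?thesis by (simp add: ennreal_mult nn_integral_cmult)
qed

end

text \<open>There are only countably many cells.\<close>

lemma (in nested_partition) AE_cell_not_null: "AE y in M. measure M (cell j y) \<noteq> 0"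
proof -
  define h :: "'a \<Rightarrow> ennreal" where "h y = (if measure M (cell j y) = 0 then 1 else 0)" for y
  have h_cell: "h x = h y" if "idx j x = idx j y" for x y
    using cell_eq[OF that] by (simp add: h_def)
  have [measurable]: "h \<in> borel_measurable M"
    by (rule cell_constant_measurable[of j]) (auto intro: h_cell)
  have "(\<integral>\<^sup>+y. h y \<partial>M) \<le> (\<integral>\<^sup>+y. 0 \<partial>M)"
  proof (rule nn_integral_le_cells[where j = j])
    fix x
    have "(\<integral>\<^sup>+y\<in>cell j x. h y \<partial>M) = h x * emeasure M (cell j x)"
      by (rule nn_integral_cell_const) (metis h_cell in_cell_iff)
    also have "\<dots> = 0" by (simp add: h_def emeasure_cell)
    finally show "(\<integral>\<^sup>+y\<in>cell j x. h y \<partial>M) \<le> (\<integral>\<^sup>+y\<in>cell j x. 0 \<partial>M)" by simp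
  qed auto
  then have "(\<integral>\<^sup>+y. h y \<partial>M) = 0" by simp
  then have "AE y in M. h y = 0" by (subst (asm) nn_integral_0_iff_AE) auto
  then show ?thesis by eventually_elim (auto simp: h_def split: if_splits)
qed

lemma (in nested_partition) carleson_embedding:
  fixes f :: "'a \<Rightarrow> real" and a :: "nat \<Rightarrow> 'a \<Rightarrow> ennreal"
  assumes f: "locally_integrable f" and f0: "\<And>x. 0 \<le> f x"
    and a [measurable]: "\<And>l. a l \<in> borel_measurable M" and \<Lambda>: "0 < \<Lambda>"
    and packing: "\<And>j x. j \<le> N \<Longrightarrow> (\<integral>\<^sup>+y\<in>cell j x. (\<Sum>l\<in>{j..<N}. a l y) \<partial>M) \<le> ennreal \<Lambda> * emeasure M (cell j x)"
  shows "(\<integral>\<^sup>+y. (\<Sum>l<N. a l y * ennreal ((avg l f y)\<^sup>2)) \<partial>M) \<le> ennreal (4 * \<Lambda>) * (\<integral>\<^sup>+y. ennreal ((f y)\<^sup>2) \<partial>M)"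
proof -
  note [measurable] = locally_integrable_measurable[OF f]
  have inv: "ennreal \<Lambda> * (ennreal (1 / \<Lambda>) * t) = t" "ennreal (1 / \<Lambda>) * (ennreal \<Lambda> * t) = t" for t
    using \<Lambda> by (simp_all add: mult.assoc[symmetric] flip: ennreal_mult)
  have "(\<integral>\<^sup>+y. (\<Sum>l<N. (ennreal (1 / \<Lambda>) * a l y) * ennreal ((avg l f y)\<^sup>2)) \<partial>M) \<le> 4 * (\<integral>\<^sup>+y. ennreal ((f y)\<^sup>2) \<partial>M)"
  proof (rule carleson_embedding_normalized[OF f f0])
    fix j x assume "j \<le> N"
    have "(\<integral>\<^sup>+y\<in>cell j x. (\<Sum>l\<in>{j..<N}. ennreal (1 / \<Lambda>) * a l y) \<partial>M)
        = ennreal (1 / \<Lambda>) * (\<integral>\<^sup>+y\<in>cell j x. (\<Sum>l\<in>{j..<N}. a l y) \<partial>M)"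
      by (simp add: sum_distrib_left[symmetric] mult.assoc nn_integral_cmult)
    also have "\<dots> \<le> ennreal (1 / \<Lambda>) * (ennreal \<Lambda> * emeasure M (cell j x))"
      by (rule mult_left_mono[OF packing[OF \<open>j \<le> N\<close>]]) simp
    finally show "(\<integral>\<^sup>+y\<in>cell j x. (\<Sum>l\<in>{j..<N}. ennreal (1 / \<Lambda>) * a l y) \<partial>M) \<le> emeasure M (cell j x)"
      by (simp only: inv)
  qed auto
  also have "(\<integral>\<^sup>+y. (\<Sum>l<N. (ennreal (1 / \<Lambda>) * a l y) * ennreal ((avg l f y)\<^sup>2)) \<partial>M)
      = ennreal (1 / \<Lambda>) * (\<integral>\<^sup>+y. (\<Sum>l<N. a l y * ennreal ((avg l f y)\<^sup>2)) \<partial>M)"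
    by (simp add: sum_distrib_left[symmetric] mult.assoc nn_integral_cmult)
  finally have "ennreal \<Lambda> * (ennreal (1 / \<Lambda>) * (\<integral>\<^sup>+y. (\<Sum>l<N. a l y * ennreal ((avg l f y)\<^sup>2)) \<partial>M))
      \<le> ennreal \<Lambda> * (4 * (\<integral>\<^sup>+y. ennreal ((f y)\<^sup>2) \<partial>M))" by (rule mult_left_mono) simp
  then show ?thesis using \<Lambda> by (simp add: inv ennreal_mult mult.left_commute mult.assoc)
qed

section \<open>Stopping times of accretive systems\<close>

text \<open>The test functions of a local \<open>Tb\<close> theorem. They are functions on the whole space, since the operators
  are not local.\<close>

locale accretive_system = nested_partition M idx
  for M :: "'a measure" and idx :: "nat \<Rightarrow> 'a \<Rightarrow> 'i::countable" +
  fixes b :: "nat \<Rightarrow> 'i \<Rightarrow> 'a \<Rightarrow> complex" and K \<delta> :: real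
  assumes b_measurable [measurable]: "\<And>j z. b j z \<in> borel_measurable M"
    and b_bound: "\<And>j z x. norm (b j z x) \<le> K"
    and K_ge_1: "1 \<le> K" and \<delta>_pos: "0 < \<delta>"
    and accretive: "\<And>j x. \<delta> * measure M (cell j x) \<le> norm (LINT y:cell j x|M. b j (idx j x) y)"
begin

text \<open>The level of the cell around \<open>x\<close> whose test function is in force at level \<open>j\<close>. On a cell of measure
  zero the average is \<open>0\<close>, so that such a cell always stops.\<close>

primrec stop :: "nat \<Rightarrow> 'a \<Rightarrow> nat" where
  "stop 0 x = 0"
| "stop (Suc j) x =
    (if norm (avg (Suc j) (b (stop j x) (idx (stop j x) x)) x) < \<delta> / 2 then Suc j else stop j x)"

text \<open>The test function in force at level \<open>j\<close> around \<open>x\<close>, as a function on the whole space, and its mean over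
  the cell of level \<open>j\<close>.\<close>

definition G :: "nat \<Rightarrow> 'a \<Rightarrow> 'a \<Rightarrow> complex" where
  "G j x = b (stop j x) (idx (stop j x) x)"

definition \<beta> :: "nat \<Rightarrow> 'a \<Rightarrow> complex" where
  "\<beta> j x = avg j (G j x) x"

lemma stop_le: "stop j x \<le> j"
  by (induction j) auto

lemma stop_cong_cell: "idx j x = idx j y \<Longrightarrow> stop j x = stop j y"
proof (induction j)
  case (Suc j)
  have j: "idx j x = idx j y" using idx_nested[OF Suc.prems] .
  have "stop j x = stop j y" by (rule Suc.IH[OF j])
  moreover have "idx (stop j x) x = idx (stop j x) y" by (rule idx_mono[OF stop_le j])
  ultimately show ?case using avg_cong_cell[OF Suc.prems, of "b (stop j y) (idx (stop j y) y)"] by simp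
qed simp

lemma G_cong_cell: "idx j x = idx j y \<Longrightarrow> G j x = G j y"
  unfolding G_def using stop_cong_cell[of j x y] idx_mono[OF stop_le, of j x y x] by metis

lemma \<beta>_cong_cell: "idx j x = idx j y \<Longrightarrow> \<beta> j x = \<beta> j y"
  unfolding \<beta>_def using G_cong_cell[of j x y] avg_cong_cell[of j x y] by metis

lemma G_stop: "stop j x = j \<Longrightarrow> G j x = b j (idx j x)"
  by (simp add: G_def)

lemma G_nonstop: "stop (Suc j) x \<noteq> Suc j \<Longrightarrow> G (Suc j) x = G j x"
  by (auto simp: G_def)

lemma stop_measurable [measurable]: "stop j \<in> measurable M (count_space UNIV)"
  by (rule cell_constant_measurable[of j]) (auto intro: stop_cong_cell)

lemma \<beta>_measurable [measurable]: "\<beta> j \<in> borel_measurable M"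
  by (rule cell_constant_measurable[of j]) (auto intro: \<beta>_cong_cell)

lemma G_measurable [measurable]: "G j x \<in> borel_measurable M"
  by (simp add: G_def)

lemma G_bound: "norm (G j x y) \<le> K"
  by (simp add: G_def b_bound)

lemma G_locally_integrable: "locally_integrable (G j x)"
  by (rule locally_integrableI_bounded[OF G_measurable G_bound])

text \<open>The stopping cell takes countably many values, so measurability can be checked for each of them.\<close>

lemma stopped_measurable:
  assumes "\<And>l z. F l z \<in> measurable M N"
  shows "(\<lambda>x. F (stop j x) (idx (stop j x) x) x) \<in> measurable M N"
proof (rule measurable_compose_countable'[OF _ stop_measurable])
  show "(\<lambda>x. F l (idx l x) x) \<in> measurable M N" for l
    by (rule cell_dependent_measurable[OF assms])
qed auto

lemma b_avg_ge: "measure M (cell j x) \<noteq> 0 \<Longrightarrow> \<delta> \<le> norm (avg j (b j (idx j x)) x)"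
  using accretive[of j x] zero_less_measure_iff[of M "cell j x"]
  by (simp add: avg_def divide_simps mult.commute)

lemma \<beta>_stop: "measure M (cell j x) \<noteq> 0 \<Longrightarrow> stop j x = j \<Longrightarrow> \<delta> \<le> norm (\<beta> j x)"
  by (simp add: \<beta>_def G_stop b_avg_ge)

lemma stop_iff: "stop (Suc j) x = Suc j \<longleftrightarrow> norm (avg (Suc j) (G j x) x) < \<delta> / 2"
  using stop_le[of j x] by (auto simp: G_def)

lemma stop_null_cell: "measure M (cell (Suc j) x) = 0 \<Longrightarrow> stop (Suc j) x = Suc j"
  unfolding stop_iff using \<delta>_pos by (simp add: avg_def)

lemma \<beta>_nonstop:
  assumes "stop (Suc j) x \<noteq> Suc j"
  shows "\<beta> (Suc j) x = avg (Suc j) (G j x) x"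
  by (simp add: \<beta>_def G_nonstop[OF assms])

text \<open>By construction: at a stop the mean is that of a test function over its own cell, and otherwise the
  stopping condition fails.\<close>

lemma \<beta>_ge: "measure M (cell j x) \<noteq> 0 \<Longrightarrow> \<delta> / 2 \<le> norm (\<beta> j x)"
proof (cases "stop j x = j")
  case True
  assume "measure M (cell j x) \<noteq> 0"
  from \<beta>_stop[OF this True] show ?thesis using \<delta>_pos by simp
next
  case False
  then obtain i where "j = Suc i" by (cases j) auto
  with False show ?thesis using \<beta>_nonstop[of i x] stop_iff[of i x] by simp
qed

text \<open>A bound for the potential \<open>2/\<delta> |\<beta>| + |\<beta>|\<^sup>2\<close>.\<close>

definition packing_const :: real where
  "packing_const = 2 / \<delta> * K + K\<^sup>2"

text \<open>The weight that has to be packed in order to bound the differences of the adapted expectations.\<close>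

definition oscillation :: "nat \<Rightarrow> 'a \<Rightarrow> real" where
  "oscillation j x = (norm (avg (Suc j) (G j x) x - \<beta> j x))\<^sup>2 + (if stop (Suc j) x = Suc j then 1 else 0)"

lemma avg_G_cong_cell: "idx (Suc j) x = idx (Suc j) y \<Longrightarrow> avg (Suc j) (G j x) x = avg (Suc j) (G j y) y"
  using G_cong_cell[of j x y] idx_nested[of j x y] avg_cong_cell[of "Suc j" x y] by metis

lemma avg_G_measurable [measurable]: "(\<lambda>x. avg (Suc j) (G j x) x) \<in> borel_measurable M"
  by (rule cell_constant_measurable[of "Suc j"]) (auto intro: avg_G_cong_cell)

lemma oscillation_measurable [measurable]: "oscillation j \<in> borel_measurable M"
  unfolding oscillation_def by measurable

lemma \<beta>_bound: "norm (\<beta> j x) \<le> K"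
proof -
  have "norm (LINT y:cell j x|M. G j x y) \<le> (LINT y:cell j x|M. norm (G j x y))"
    by (rule set_integral_norm_bound[OF locally_integrable_on_cell[OF G_locally_integrable]])
  also have "\<dots> \<le> (LINT y:cell j x|M. K)"
  proof (rule set_integral_mono)
    show "set_integrable M (cell j x) (\<lambda>y. norm (G j x y))"
      by (rule set_integrable_norm[OF locally_integrable_on_cell[OF G_locally_integrable]])
    show "set_integrable M (cell j x) (\<lambda>y. K)" using finite_cell by (simp add: set_integrable_def)
  qed (rule G_bound)
  also have "\<dots> = measure M (cell j x) * K" by (subst set_integral_cell_const) auto
  finally have *: "norm (LINT y:cell j x|M. G j x y) \<le> measure M (cell j x) * K" .
  show ?thesis
  proof (cases "measure M (cell j x) = 0")
    case True
    then show ?thesis using K_ge_1 by (simp add: \<beta>_def avg_def)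
  next
    case False
    then have "0 < measure M (cell j x)" by (simp add: zero_less_measure_iff)
    with * show ?thesis by (simp add: \<beta>_def avg_def divide_simps mult.commute)
  qed
qed

text \<open>Let \<open>v\<close> be the averages of level \<open>Suc j\<close> of the function in force at level \<open>j\<close>. By convexity the integral
  of \<open>2/\<delta> |v| + |v|\<^sup>2\<close> exceeds that of \<open>2/\<delta> |\<beta> j| + |\<beta> j|\<^sup>2\<close> at least by the integral of \<open>|v - \<beta> j|\<^sup>2\<close>.
  Where level \<open>Suc j\<close> stops, \<open>|v| < \<delta>/2\<close> is replaced by \<open>|\<beta> (Suc j)| \<ge> \<delta>\<close>, and the linear term gains at least
  one. Together this is the oscillation.\<close>

lemma potential_step:
  "(\<integral>\<^sup>+y\<in>cell j x. ennreal (oscillation j y + (2 / \<delta> * norm (\<beta> j y) + (norm (\<beta> j y))\<^sup>2)) \<partial>M)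
   \<le> (\<integral>\<^sup>+y\<in>cell j x. ennreal (2 / \<delta> * norm (\<beta> (Suc j) y) + (norm (\<beta> (Suc j) y))\<^sup>2) \<partial>M)"
proof -
  let ?Q = "cell j x" and ?B = "2 / \<delta>"
  define v where "v = avg (Suc j) (G j x)"
  have B: "0 < ?B" using \<delta>_pos by simp
  have vl: "locally_integrable v" unfolding v_def by (rule locally_integrable_avg[OF G_locally_integrable])
  note [measurable] = locally_integrable_measurable[OF vl]
  have av: "avg j v x = \<beta> j x" by (simp add: v_def avg_avg[OF G_locally_integrable] \<beta>_def)
  define st :: "'a \<Rightarrow> real" where "st y = (if stop (Suc j) y = Suc j then 1 else 0)" for y
  have [measurable]: "st \<in> borel_measurable M" unfolding st_def by measurable
  have on_Q: "avg (Suc j) (G j y) y = v y" "\<beta> j y = \<beta> j x" if "y \<in> ?Q" for y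
    using G_cong_cell[of j y x] \<beta>_cong_cell[of j y x] that by (auto simp: v_def in_cell_iff)
  have lin: "ennreal (norm (\<beta> j x)) * emeasure M ?Q \<le> (\<integral>\<^sup>+y\<in>?Q. ennreal (norm (v y)) \<partial>M)"
  proof -
    have "ennreal (norm (\<beta> j x)) * emeasure M ?Q = ennreal (norm (measure M ?Q *\<^sub>R avg j v x))"
      unfolding av emeasure_cell by (simp add: ennreal_mult' mult.commute)
    also have "\<dots> = ennreal (norm (LINT y:?Q|M. v y))"
      by (simp only: measure_scaleR_avg)
    also have "\<dots> \<le> (\<integral>\<^sup>+y\<in>?Q. ennreal (norm (v y)) \<partial>M)"
      by (rule norm_set_integral_cell_le[OF locally_integrable_on_cell[OF vl]])
    finally show ?thesis .
  qed
  have "(\<integral>\<^sup>+y\<in>?Q. ennreal (oscillation j y + (?B * norm (\<beta> j y) + (norm (\<beta> j y))\<^sup>2)) \<partial>M)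
      = (\<integral>\<^sup>+y\<in>?Q. (ennreal ((norm (v y - \<beta> j x))\<^sup>2 + (norm (\<beta> j x))\<^sup>2) + (ennreal ?B * ennreal (norm (\<beta> j x)) + ennreal (st y))) \<partial>M)"
  proof (rule nn_integral_cell_cong)
    fix y assume y: "y \<in> ?Q"
    have split: "ennreal (X + (c * n + s)) = ennreal X + (ennreal c * ennreal n + ennreal s)"
      if "0 \<le> X" "0 \<le> c" "0 \<le> n" "0 \<le> s" for X c n s :: real
      using that by (simp add: ennreal_mult)
    have "oscillation j y + (?B * norm (\<beta> j y) + (norm (\<beta> j y))\<^sup>2)
        = ((norm (v y - \<beta> j x))\<^sup>2 + (norm (\<beta> j x))\<^sup>2) + (?B * norm (\<beta> j x) + st y)"
      unfolding oscillation_def on_Q[OF y] st_def by linarith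
    then show "ennreal (oscillation j y + (?B * norm (\<beta> j y) + (norm (\<beta> j y))\<^sup>2))
      = ennreal ((norm (v y - \<beta> j x))\<^sup>2 + (norm (\<beta> j x))\<^sup>2) + (ennreal ?B * ennreal (norm (\<beta> j x)) + ennreal (st y))"
      using B by (simp only:) (rule split, auto simp: st_def)
  qed
  also have "\<dots> = (\<integral>\<^sup>+y\<in>?Q. ennreal ((norm (v y - avg j v x))\<^sup>2 + (norm (avg j v x))\<^sup>2) \<partial>M)
      + (ennreal ?B * (ennreal (norm (\<beta> j x)) * emeasure M ?Q) + (\<integral>\<^sup>+y\<in>?Q. ennreal (st y) \<partial>M))"
    by (simp add: distrib_right nn_integral_add nn_integral_cmult nn_integral_cmult_indicator av mult.assoc del: ennreal_plus)
  also have "\<dots> \<le> (\<integral>\<^sup>+y\<in>?Q. ennreal ((norm (v y))\<^sup>2) \<partial>M)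
      + (ennreal ?B * (\<integral>\<^sup>+y\<in>?Q. ennreal (norm (v y)) \<partial>M) + (\<integral>\<^sup>+y\<in>?Q. ennreal (st y) \<partial>M))"
    by (intro add_mono variance_decomposition[OF vl] mult_left_mono lin) auto
  also have "\<dots> = (\<integral>\<^sup>+y\<in>?Q. (ennreal ((norm (v y))\<^sup>2) + (ennreal ?B * ennreal (norm (v y)) + ennreal (st y))) \<partial>M)"
    by (simp add: distrib_right nn_integral_add nn_integral_cmult[symmetric] mult.assoc)
  also have "\<dots> \<le> (\<integral>\<^sup>+y\<in>?Q. ennreal (?B * norm (\<beta> (Suc j) y) + (norm (\<beta> (Suc j) y))\<^sup>2) \<partial>M)"
  proof (rule nn_integral_mono_AE)
    show "AE y in M. (ennreal ((norm (v y))\<^sup>2) + (ennreal ?B * ennreal (norm (v y)) + ennreal (st y))) * indicator ?Q y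
        \<le> ennreal (?B * norm (\<beta> (Suc j) y) + (norm (\<beta> (Suc j) y))\<^sup>2) * indicator ?Q y"
      using AE_cell_not_null[of "Suc j"]
    proof eventually_elim
      case (elim y)
      have "(norm (v y))\<^sup>2 + (?B * norm (v y) + st y) \<le> ?B * norm (\<beta> (Suc j) y) + (norm (\<beta> (Suc j) y))\<^sup>2"
        if "y \<in> ?Q"
      proof (cases "stop (Suc j) y = Suc j")
        case True
        have \<beta>: "\<delta> \<le> norm (\<beta> (Suc j) y)" by (rule \<beta>_stop[OF elim True])
        have v: "norm (v y) < \<delta> / 2" using True on_Q(1)[OF that] unfolding stop_iff by simp
        have "?B * norm (v y) \<le> ?B * (\<delta> / 2)" by (rule mult_left_mono) (use v B in auto)
        then have 1: "?B * norm (v y) \<le> 1" using \<delta>_pos by simp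
        have "?B * \<delta> \<le> ?B * norm (\<beta> (Suc j) y)" by (rule mult_left_mono) (use \<beta> B in auto)
        then have 2: "2 \<le> ?B * norm (\<beta> (Suc j) y)" using \<delta>_pos by simp
        have 3: "(norm (v y))\<^sup>2 \<le> (norm (\<beta> (Suc j) y))\<^sup>2"
          by (rule power_mono) (use v \<beta> \<delta>_pos in auto)
        have "st y = 1" unfolding st_def using True by (rule if_P)
        with 1 2 3 show ?thesis by linarith
      next
        case False
        then show ?thesis using \<beta>_nonstop[OF False] on_Q(1)[OF that] by (simp add: st_def)
      qed
      then show ?case using B
        by (cases "y \<in> ?Q") (simp_all add: ennreal_leI st_def flip: ennreal_mult ennreal_plus)
    qed
  qed
  finally show ?thesis .
qed

lemma oscillation_packing:
  assumes "j \<le> N"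
  shows "(\<integral>\<^sup>+y\<in>cell j x. (\<Sum>l\<in>{j..<N}. ennreal (oscillation l y)) \<partial>M) \<le> ennreal packing_const * emeasure M (cell j x)"
proof -
  let ?P = "\<lambda>j y. 2 / \<delta> * norm (\<beta> j y) + (norm (\<beta> j y))\<^sup>2"
  have P: "0 \<le> ?P j y" "?P j y \<le> packing_const" for j y
    using \<delta>_pos \<beta>_bound[of j y] unfolding packing_const_def
    by (auto intro!: add_mono mult_left_mono power_mono divide_right_mono)
  have osc0: "0 \<le> oscillation j y" for j y by (simp add: oscillation_def)
  have "(\<integral>\<^sup>+y\<in>cell j x. ((\<Sum>l\<in>{j..<N}. ennreal (oscillation l y)) + ennreal (?P j y)) \<partial>M)
      \<le> (\<integral>\<^sup>+y\<in>cell j x. ennreal packing_const \<partial>M)" using assms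
  proof (induction j arbitrary: x rule: inc_induct)
    case base
    show ?case
    proof (intro nn_integral_mono mult_right_mono)
      fix y
      show "(\<Sum>l\<in>{N..<N}. ennreal (oscillation l y)) + ennreal (?P N y) \<le> ennreal packing_const"
        using ennreal_leI[OF P(2)[of N y]] by simp
    qed simp
  next
    case (step n)
    let ?S = "\<lambda>y. \<Sum>l\<in>{Suc n..<N}. ennreal (oscillation l y)"
    have "(\<Sum>l\<in>{n..<N}. ennreal (oscillation l y)) + ennreal (?P n y)
        = ?S y + ennreal (oscillation n y + ?P n y)" for y
      unfolding ennreal_plus[OF osc0 P(1)] sum.atLeast_Suc_lessThan[OF \<open>n < N\<close>] by (simp only: ac_simps)
    then have "(\<integral>\<^sup>+y\<in>cell n x. ((\<Sum>l\<in>{n..<N}. ennreal (oscillation l y)) + ennreal (?P n y)) \<partial>M)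
        = (\<integral>\<^sup>+y\<in>cell n x. (?S y + ennreal (oscillation n y + ?P n y)) \<partial>M)"
      by (simp only:)
    also have "\<dots> = (\<integral>\<^sup>+y\<in>cell n x. ?S y \<partial>M) + (\<integral>\<^sup>+y\<in>cell n x. ennreal (oscillation n y + ?P n y) \<partial>M)"
      by (simp add: distrib_right nn_integral_add del: ennreal_plus)
    also have "\<dots> \<le> (\<integral>\<^sup>+y\<in>cell n x. ?S y \<partial>M) + (\<integral>\<^sup>+y\<in>cell n x. ennreal (?P (Suc n) y) \<partial>M)"
      by (rule add_left_mono[OF potential_step])
    also have "\<dots> = (\<integral>\<^sup>+y\<in>cell n x. (?S y + ennreal (?P (Suc n) y)) \<partial>M)"
      by (simp add: distrib_right nn_integral_add del: ennreal_plus)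
    also have "\<dots> \<le> (\<integral>\<^sup>+y\<in>cell n x. ennreal packing_const \<partial>M)"
      by (rule nn_integral_le_subcells[where j = "Suc n"]) (use step.IH in auto)
    finally show ?case .
  qed
  also have "\<dots> = ennreal packing_const * emeasure M (cell j x)" by (simp add: nn_integral_cmult_indicator)
  finally have "(\<integral>\<^sup>+y\<in>cell j x. ((\<Sum>l\<in>{j..<N}. ennreal (oscillation l y)) + ennreal (?P j y)) \<partial>M)
    \<le> ennreal packing_const * emeasure M (cell j x)" .
  moreover have "(\<integral>\<^sup>+y\<in>cell j x. (\<Sum>l\<in>{j..<N}. ennreal (oscillation l y)) \<partial>M)
    \<le> (\<integral>\<^sup>+y\<in>cell j x. ((\<Sum>l\<in>{j..<N}. ennreal (oscillation l y)) + ennreal (?P j y)) \<partial>M)"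
    by (intro nn_integral_mono mult_right_mono) auto
  ultimately show ?thesis by (rule order.trans[rotated])
qed

end

section \<open>Packing of paraproducts\<close>

lemma (in nested_partition) norm_avg_le:
  assumes f: "locally_integrable f"
  shows "norm (avg j f x) \<le> avg j (\<lambda>y. norm (f y)) x"
proof -
  have "norm (LINT y:cell j x|M. f y) \<le> (LINT y:cell j x|M. norm (f y))"
    by (rule set_integral_norm_bound[OF locally_integrable_on_cell[OF f]])
  from mult_left_mono[OF this, of "inverse (measure M (cell j x))"] show ?thesis by (simp add: avg_def)
qed

lemma (in nested_partition) locally_integrable_norm:
  "locally_integrable f \<Longrightarrow> locally_integrable (\<lambda>y. norm (f y))"
  unfolding locally_integrable_def by (auto intro: set_integrable_norm)

lemma set_nn_integral_add_sum:
  fixes u :: "'a \<Rightarrow> ennreal"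
  assumes [measurable]: "u \<in> borel_measurable M" "\<And>l. l \<in> I \<Longrightarrow> v l \<in> borel_measurable M" "Q \<in> sets M"
  shows "(\<integral>\<^sup>+y\<in>Q. (u y + (\<Sum>l\<in>I. v l y)) \<partial>M) = (\<integral>\<^sup>+y\<in>Q. u y \<partial>M) + (\<Sum>l\<in>I. \<integral>\<^sup>+y\<in>Q. v l y \<partial>M)"
proof -
  have "(\<integral>\<^sup>+y\<in>Q. (u y + (\<Sum>l\<in>I. v l y)) \<partial>M) = (\<integral>\<^sup>+y. (u y * indicator Q y + (\<Sum>l\<in>I. v l y * indicator Q y)) \<partial>M)"
    by (simp only: distrib_right sum_distrib_right)
  then show ?thesis by (simp add: nn_integral_add nn_integral_sum)
qed

context accretive_system begin

declare stop.simps(2) [simp del]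

text \<open>Either nothing stops strictly after level \<open>j\<close>, or the function in force was chosen at some later level
  \<open>l\<close>, at which \<open>x\<close> stops.\<close>

lemma stop_cases: "j \<le> k \<Longrightarrow> stop k y = stop j y \<or> (\<exists>l. j < l \<and> l \<le> k \<and> stop l y = l \<and> stop k y = l)"
proof (induction k rule: dec_induct)
  case (step k)
  show ?case
  proof (cases "stop (Suc k) y = Suc k")
    case False
    then have "stop (Suc k) y = stop k y" by (auto simp: stop.simps(2) split: if_splits)
    with step.IH show ?thesis by (metis le_SucI)
  qed (use step in auto)
qed simp

lemma stop_count_packing:
  assumes "j \<le> N"
  shows "(\<integral>\<^sup>+y\<in>cell j x. (\<Sum>l\<in>{Suc j..<N}. if stop l y = l then 1 else 0 :: ennreal) \<partial>M)
    \<le> ennreal packing_const * emeasure M (cell j x)"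
proof -
  have pt: "(\<Sum>l\<in>{Suc j..<N}. if stop l y = l then 1 else 0 :: ennreal) \<le> (\<Sum>l\<in>{j..<N}. ennreal (oscillation l y))" for y
  proof -
    have "(\<Sum>l\<in>{Suc j..<N}. if stop l y = l then 1 else 0 :: ennreal)
        \<le> (\<Sum>l\<in>{Suc j..<Suc N}. if stop l y = l then 1 else 0 :: ennreal)"
      by (rule sum_mono2) auto
    also have "\<dots> = (\<Sum>l\<in>{j..<N}. if stop (Suc l) y = Suc l then 1 else 0 :: ennreal)"
      by (rule sum.shift_bounds_Suc_ivl)
    also have "\<dots> \<le> (\<Sum>l\<in>{j..<N}. ennreal (oscillation l y))"
    proof (rule sum_mono)
      fix l
      have "(if stop (Suc l) y = Suc l then 1 else 0 :: ennreal) = ennreal (if stop (Suc l) y = Suc l then 1 else 0)" by simp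
      also have "\<dots> \<le> ennreal (oscillation l y)" unfolding oscillation_def by (rule ennreal_leI) simp
      finally show "(if stop (Suc l) y = Suc l then 1 else 0 :: ennreal) \<le> ennreal (oscillation l y)" .
    qed
    finally show ?thesis .
  qed
  have "(\<integral>\<^sup>+y\<in>cell j x. (\<Sum>l\<in>{Suc j..<N}. if stop l y = l then 1 else 0 :: ennreal) \<partial>M)
      \<le> (\<integral>\<^sup>+y\<in>cell j x. (\<Sum>l\<in>{j..<N}. ennreal (oscillation l y)) \<partial>M)"
    by (intro nn_integral_mono mult_right_mono pt) simp
  also note oscillation_packing[OF assms]
  finally show ?thesis .
qed

text \<open>Cut the levels at the stopping cells. Up to the next stop a single test function is in force, and
  the assumption for fixed \<open>l\<close> and \<open>z\<close> applies. Every stopping cell starts a new such piece,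
  and the stopping cells themselves are packed.\<close>

lemma paraproduct_packing:
  fixes p :: "nat \<Rightarrow> nat \<Rightarrow> 'i \<Rightarrow> 'a \<Rightarrow> ennreal" and C :: real
  assumes p [measurable]: "\<And>k l z. p k l z \<in> borel_measurable M" and C: "0 \<le> C"
    and test: "\<And>l z j x. j \<le> N \<Longrightarrow> (\<integral>\<^sup>+y\<in>cell j x. (\<Sum>k\<in>{j..<N}. p k l z y) \<partial>M) \<le> ennreal C * emeasure M (cell j x)"
    and "j \<le> N"
  shows "(\<integral>\<^sup>+y\<in>cell j x. (\<Sum>k\<in>{j..<N}. p k (stop k y) (idx (stop k y) y) y) \<partial>M)
    \<le> ennreal (C * (1 + packing_const)) * emeasure M (cell j x)"
proof -
  let ?Q = "cell j x"
  define s where "s = stop j x"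
  define z where "z = idx s x"
  define ind :: "nat \<Rightarrow> 'a \<Rightarrow> ennreal" where "ind l y = (if stop l y = l then 1 else 0)" for l y
  have [measurable]: "ind l \<in> borel_measurable M" for l
  proof (rule cell_constant_measurable[of l])
    fix x y assume "idx l x = idx l y"
    from stop_cong_cell[OF this] show "ind l x = ind l y" by (simp only: ind_def)
  qed simp
  define r where "r l y = (\<Sum>k\<in>{l..<N}. p k l (idx l y) y)" for l y
  have [measurable]: "r l \<in> borel_measurable M" for l
    unfolding r_def by (rule borel_measurable_sum) (rule cell_dependent_measurable[of "p _ l", OF p])
  have pk: "0 \<le> packing_const" using K_ge_1 \<delta>_pos by (simp add: packing_const_def)
  have pt: "(\<Sum>k\<in>{j..<N}. p k (stop k y) (idx (stop k y) y) y)
      \<le> (\<Sum>k\<in>{j..<N}. p k s z y) + (\<Sum>l\<in>{Suc j..<N}. ind l y * r l y)" if y: "y \<in> ?Q" for y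
  proof -
    have sj: "stop j y = s" using y stop_cong_cell[of j y x] by (simp add: s_def in_cell_iff)
    have zj: "idx s y = z" using y idx_mono[OF stop_le[of j x], of y x] by (simp add: z_def s_def in_cell_iff)
    have one: "p k (stop k y) (idx (stop k y) y) y
        \<le> p k s z y + (\<Sum>l\<in>{Suc j..<N}. if l \<le> k then ind l y * p k l (idx l y) y else 0)"
      if "k \<in> {j..<N}" for k
    proof -
      have "j \<le> k" using that by simp
      from stop_cases[OF this, of y] show ?thesis
      proof (elim disjE exE conjE)
        fix l assume l: "j < l" "l \<le> k" "stop l y = l" "stop k y = l"
        have "p k (stop k y) (idx (stop k y) y) y = (if l \<le> k then ind l y * p k l (idx l y) y else 0)"
          unfolding l(4) using l(2) by (simp add: ind_def l(3))
        also have "\<dots> \<le> (\<Sum>l\<in>{Suc j..<N}. if l \<le> k then ind l y * p k l (idx l y) y else 0)"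
        proof (rule member_le_sum)
          show "l \<in> {Suc j..<N}" using l(1,2) that by simp
        qed simp_all
        finally have "p k (stop k y) (idx (stop k y) y) y
            \<le> (\<Sum>l\<in>{Suc j..<N}. if l \<le> k then ind l y * p k l (idx l y) y else 0)" .
        then show ?thesis by (rule add_increasing[OF zero_le])
      next
        assume "stop k y = stop j y"
        then have "p k (stop k y) (idx (stop k y) y) y = p k s z y" by (simp only: sj zj)
        then show ?thesis by (simp only: le_iff_add) blast
      qed
    qed
    have "(\<Sum>k\<in>{j..<N}. p k (stop k y) (idx (stop k y) y) y)
        \<le> (\<Sum>k\<in>{j..<N}. p k s z y + (\<Sum>l\<in>{Suc j..<N}. if l \<le> k then ind l y * p k l (idx l y) y else 0))"
      by (rule sum_mono[OF one])
    also have "\<dots> = (\<Sum>k\<in>{j..<N}. p k s z y)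
        + (\<Sum>l\<in>{Suc j..<N}. \<Sum>k\<in>{j..<N}. if l \<le> k then ind l y * p k l (idx l y) y else 0)"
      unfolding sum.distrib by (subst sum.swap) simp
    also have "(\<Sum>l\<in>{Suc j..<N}. \<Sum>k\<in>{j..<N}. if l \<le> k then ind l y * p k l (idx l y) y else 0)
        = (\<Sum>l\<in>{Suc j..<N}. ind l y * r l y)"
    proof (rule sum.cong)
      fix l assume l: "l \<in> {Suc j..<N}"
      have "(\<Sum>k\<in>{j..<N}. if l \<le> k then ind l y * p k l (idx l y) y else 0)
          = (\<Sum>k\<in>{k\<in>{j..<N}. l \<le> k}. ind l y * p k l (idx l y) y)"
        by (rule sum.inter_filter[symmetric]) simp
      also have "{k\<in>{j..<N}. l \<le> k} = {l..<N}" using l by auto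
      finally show "(\<Sum>k\<in>{j..<N}. if l \<le> k then ind l y * p k l (idx l y) y else 0) = ind l y * r l y"
        by (simp add: r_def sum_distrib_left)
    qed simp
    finally show ?thesis .
  qed
  have sub: "(\<integral>\<^sup>+y\<in>?Q. (ind l y * r l y) \<partial>M) \<le> (\<integral>\<^sup>+y\<in>?Q. (ennreal C * ind l y) \<partial>M)"
    if l: "l \<in> {Suc j..<N}" for l
  proof (rule nn_integral_le_subcells[where j = l])
    fix u
    have on: "stop l y = stop l u" "idx l y = idx l u" if "y \<in> cell l u" for y
      using that stop_cong_cell[of l y u] by (auto simp: in_cell_iff)
    have "(\<integral>\<^sup>+y\<in>cell l u. (ind l y * r l y) \<partial>M)
        = (\<integral>\<^sup>+y\<in>cell l u. (ind l u * (\<Sum>k\<in>{l..<N}. p k l (idx l u) y)) \<partial>M)"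
    proof (rule nn_integral_cell_cong)
      fix y assume "y \<in> cell l u"
      from on[OF this] show "ind l y * r l y = ind l u * (\<Sum>k\<in>{l..<N}. p k l (idx l u) y)"
        by (simp only: ind_def r_def)
    qed
    also have "\<dots> = ind l u * (\<integral>\<^sup>+y\<in>cell l u. (\<Sum>k\<in>{l..<N}. p k l (idx l u) y) \<partial>M)"
      by (simp add: mult.assoc nn_integral_cmult)
    also have "\<dots> \<le> ind l u * (ennreal C * emeasure M (cell l u))"
      by (rule mult_left_mono[OF test]) (use l in auto)
    also have "\<dots> = (\<integral>\<^sup>+y\<in>cell l u. (ennreal C * ind l y) \<partial>M)"
    proof -
      have "(\<integral>\<^sup>+y\<in>cell l u. (ennreal C * ind l y) \<partial>M) = (ennreal C * ind l u) * emeasure M (cell l u)"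
      proof (rule nn_integral_cell_const)
        fix y assume "y \<in> cell l u"
        from on(1)[OF this] show "ennreal C * ind l y = ennreal C * ind l u" by (simp only: ind_def)
      qed
      then show ?thesis by (simp add: ac_simps)
    qed
    finally show "(\<integral>\<^sup>+y\<in>cell l u. (ind l y * r l y) \<partial>M) \<le> (\<integral>\<^sup>+y\<in>cell l u. (ennreal C * ind l y) \<partial>M)" .
  qed (use l in auto)
  have "(\<integral>\<^sup>+y\<in>?Q. (\<Sum>k\<in>{j..<N}. p k (stop k y) (idx (stop k y) y) y) \<partial>M)
      \<le> (\<integral>\<^sup>+y\<in>?Q. ((\<Sum>k\<in>{j..<N}. p k s z y) + (\<Sum>l\<in>{Suc j..<N}. ind l y * r l y)) \<partial>M)"
  proof (rule nn_integral_mono)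
    fix y
    show "(\<Sum>k\<in>{j..<N}. p k (stop k y) (idx (stop k y) y) y) * indicator ?Q y
        \<le> ((\<Sum>k\<in>{j..<N}. p k s z y) + (\<Sum>l\<in>{Suc j..<N}. ind l y * r l y)) * indicator ?Q y"
      by (cases "y \<in> ?Q") (auto intro!: pt)
  qed
  also have "\<dots> = (\<integral>\<^sup>+y\<in>?Q. (\<Sum>k\<in>{j..<N}. p k s z y) \<partial>M) + (\<Sum>l\<in>{Suc j..<N}. \<integral>\<^sup>+y\<in>?Q. (ind l y * r l y) \<partial>M)"
    by (rule set_nn_integral_add_sum) auto
  also have "\<dots> \<le> ennreal C * emeasure M ?Q + (\<Sum>l\<in>{Suc j..<N}. \<integral>\<^sup>+y\<in>?Q. (ennreal C * ind l y) \<partial>M)"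
    by (intro add_mono sum_mono sub test \<open>j \<le> N\<close>)
  also have "(\<Sum>l\<in>{Suc j..<N}. \<integral>\<^sup>+y\<in>?Q. (ennreal C * ind l y) \<partial>M)
      = ennreal C * (\<integral>\<^sup>+y\<in>?Q. (\<Sum>l\<in>{Suc j..<N}. ind l y) \<partial>M)"
  proof -
    have "(\<Sum>l\<in>{Suc j..<N}. \<integral>\<^sup>+y\<in>?Q. (ennreal C * ind l y) \<partial>M)
        = (\<Sum>l\<in>{Suc j..<N}. ennreal C * (\<integral>\<^sup>+y\<in>?Q. ind l y \<partial>M))"
      by (simp add: mult.assoc nn_integral_cmult)
    also have "\<dots> = ennreal C * (\<Sum>l\<in>{Suc j..<N}. \<integral>\<^sup>+y\<in>?Q. ind l y \<partial>M)"
      by (rule sum_distrib_left[symmetric])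
    also have "(\<Sum>l\<in>{Suc j..<N}. \<integral>\<^sup>+y\<in>?Q. ind l y \<partial>M) = (\<integral>\<^sup>+y\<in>?Q. (\<Sum>l\<in>{Suc j..<N}. ind l y) \<partial>M)"
      using set_nn_integral_add_sum[of "\<lambda>_. 0" M "{Suc j..<N}" ind ?Q] by simp
    finally show ?thesis .
  qed
  also have "ennreal C * emeasure M ?Q + \<dots> \<le> ennreal C * emeasure M ?Q + ennreal C * (ennreal packing_const * emeasure M ?Q)"
    unfolding ind_def by (intro add_left_mono mult_left_mono stop_count_packing \<open>j \<le> N\<close>) simp
  also have "\<dots> = ennreal (C * (1 + packing_const)) * emeasure M ?Q"
    using C pk by (simp add: ennreal_mult distrib_left distrib_right mult.assoc)
  finally show ?thesis .
qed

section \<open>Expectations adapted to the accretive system\<close>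

text \<open>The factor by which \<open>G j x\<close> has to be multiplied to have the same mean as \<open>f\<close> over the cell of level \<open>j\<close>
  around \<open>x\<close>.\<close>

definition coef :: "('a \<Rightarrow> complex) \<Rightarrow> nat \<Rightarrow> 'a \<Rightarrow> complex" where
  "coef f j x = avg j f x / \<beta> j x"

definition adapted :: "('a \<Rightarrow> complex) \<Rightarrow> nat \<Rightarrow> 'a \<Rightarrow> complex" where
  "adapted f j y = coef f j y * G j y y"

text \<open>A bound, up to the factor \<open>K\<close>, for the difference of two consecutive adapted expectations. It is constant
  on cells, and it also bounds the difference of the global functions \<open>coef f j x * G j x\<close>, not
  only of their restrictions to the cell (\<open>jump_extension\<close>).\<close>

primrec jump :: "('a \<Rightarrow> complex) \<Rightarrow> nat \<Rightarrow> 'a \<Rightarrow> real" where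
  "jump f 0 x = norm (coef f 0 x)"
| "jump f (Suc j) x =
    (if stop (Suc j) x = Suc j then norm (coef f (Suc j) x) + norm (coef f j x)
     else norm (coef f (Suc j) x - coef f j x))"

lemma coef_bound: "norm (coef f j x) \<le> 2 / \<delta> * norm (avg j f x)"
proof (cases "measure M (cell j x) = 0")
  case True
  then show ?thesis by (simp add: coef_def avg_def)
next
  case False
  from \<beta>_ge[OF this] have b: "\<delta> / 2 \<le> norm (\<beta> j x)" .
  have "norm (avg j f x) / norm (\<beta> j x) \<le> norm (avg j f x) / (\<delta> / 2)"
    by (rule divide_left_mono[OF b]) (use \<delta>_pos b in \<open>auto intro!: mult_pos_pos\<close>)
  then show ?thesis by (simp add: coef_def norm_divide mult.commute)
qed

lemma coef_cong_cell: "idx j x = idx j y \<Longrightarrow> coef f j x = coef f j y"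
  using avg_cong_cell[of j x y f] \<beta>_cong_cell[of j x y] by (simp add: coef_def)

lemma coef_measurable [measurable]: "coef f j \<in> borel_measurable M"
  by (rule cell_constant_measurable[of j]) (auto intro: coef_cong_cell)

lemma diagonal_G_measurable [measurable]: "(\<lambda>y. G j y y) \<in> borel_measurable M"
  unfolding G_def by (rule stopped_measurable) simp

lemma adapted_measurable [measurable]: "adapted f j \<in> borel_measurable M"
  unfolding adapted_def by measurable

lemma jump_measurable [measurable]: "jump f j \<in> borel_measurable M"
  by (cases j) (auto simp: fun_eq_iff cong: measurable_cong)

lemma jump_nonneg: "0 \<le> jump f j x"
  by (cases j) auto

lemma adapted_on_cell: "y \<in> cell j x \<Longrightarrow> adapted f j y = coef f j x * G j x y"
  using coef_cong_cell[of j y x f] G_cong_cell[of j y x] by (simp add: adapted_def in_cell_iff)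

lemma adapted_bound: "norm (adapted f j y) \<le> K * (2 / \<delta>) * norm (avg j f y)"
proof -
  have "norm (coef f j y) * norm (G j y y) \<le> (2 / \<delta> * norm (avg j f y)) * K"
    by (rule mult_mono[OF coef_bound G_bound]) (use \<delta>_pos in auto)
  then show ?thesis by (simp add: adapted_def norm_mult ac_simps)
qed

lemma locally_integrable_adapted:
  assumes "locally_integrable f"
  shows "locally_integrable (adapted f j)"
  unfolding locally_integrable_def
proof (intro conjI allI adapted_measurable)
  fix x
  have "set_integrable M (cell 0 x) (\<lambda>y. (K * (2 / \<delta>)) *\<^sub>R avg j f y)"
    using locally_integrable_on_cell[OF locally_integrable_avg[OF assms]]
    by (rule set_integrable_scaleR_right)
  then show "set_integrable M (cell 0 x) (adapted f j)"
    by (rule set_integrable_bound)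
       (use adapted_bound[of f j] K_ge_1 \<delta>_pos in \<open>auto simp: set_borel_measurable_def\<close>)
qed

lemma set_integral_adapted:
  assumes "locally_integrable f"
  shows "(LINT y:cell j x|M. adapted f j y) = (LINT y:cell j x|M. f y)"
proof (cases "measure M (cell j x) = 0")
  case True
  then show ?thesis by (simp add: set_integral_null_cell)
next
  case False
  have b: "\<beta> j x \<noteq> 0" using \<beta>_ge[OF False] \<delta>_pos by auto
  have "(LINT y:cell j x|M. adapted f j y) = (LINT y:cell j x|M. coef f j x * G j x y)"
    by (rule set_lebesgue_integral_cong) (auto intro: adapted_on_cell)
  also have "\<dots> = coef f j x * (LINT y:cell j x|M. G j x y)" by simp
  also have "\<dots> = measure M (cell j x) *\<^sub>R avg j f x"
    using b by (simp add: coef_def \<beta>_def flip: measure_scaleR_avg)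
  finally show ?thesis by (simp only: measure_scaleR_avg)
qed

lemma set_integral_adapted_diff:
  assumes f: "locally_integrable f"
  shows "(LINT y:cell j x|M. adapted f (Suc j) y - adapted f j y) = 0"
proof -
  have "(LINT y:cell j x|M. adapted f (Suc j) y) = (LINT y:cell j x|M. f y)"
    by (rule set_integral_eq_subcells[where j = "Suc j"])
       (auto intro: locally_integrable_on_cell locally_integrable_adapted f set_integral_adapted)
  then show ?thesis
    by (subst set_integral_diff)
       (auto intro: locally_integrable_on_cell locally_integrable_adapted f simp: set_integral_adapted[OF f])
qed

lemma jump_extension:
  "norm (coef f (Suc j) x * G (Suc j) x y - coef f j x * G j x y) \<le> K * jump f (Suc j) x"
proof (cases "stop (Suc j) x = Suc j")
  case True
  have "norm (coef f (Suc j) x * G (Suc j) x y - coef f j x * G j x y)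
      \<le> norm (coef f (Suc j) x) * norm (G (Suc j) x y) + norm (coef f j x) * norm (G j x y)"
    by (rule norm_triangle_le_diff) (simp add: norm_mult)
  also have "\<dots> \<le> norm (coef f (Suc j) x) * K + norm (coef f j x) * K"
    by (intro add_mono mult_left_mono G_bound) auto
  finally show ?thesis using True by (simp add: algebra_simps)
next
  case False
  have "norm (coef f (Suc j) x * G (Suc j) x y - coef f j x * G j x y)
      = norm (coef f (Suc j) x - coef f j x) * norm (G j x y)"
    by (simp add: G_nonstop[OF False] norm_mult flip: left_diff_distrib)
  also have "\<dots> \<le> norm (coef f (Suc j) x - coef f j x) * K"
    by (intro mult_left_mono G_bound) auto
  finally show ?thesis using False by (simp add: mult.commute)
qed

lemma jump_extension_0: "norm (coef f 0 x * G 0 x y) \<le> K * jump f 0 x"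
  using mult_left_mono[OF G_bound[of 0 x y], of "norm (coef f 0 x)"] by (simp add: norm_mult mult.commute)

definition jump_const :: real where
  "jump_const = 2 * (2 / \<delta>)\<^sup>2 + 2 * (2 / \<delta>) ^ 4 + 8 * (2 / \<delta>)\<^sup>2"

text \<open>Without a stop the same test function serves both levels, and the change of the quotient
  \<open>avg j f / \<beta> j\<close> is controlled by the changes of numerator and denominator. At a stop the sizes of both
  quotients are used, and \<open>oscillation\<close> contains a one that pays for them.\<close>

lemma jump_square:
  "(jump f (Suc j) x)\<^sup>2 \<le> jump_const * ((norm (avg (Suc j) f x - avg j f x))\<^sup>2 + oscillation j x * (norm (avg j f x))\<^sup>2)"
proof -
  define B where B_def: "B = 2 / \<delta>"
  note cb = coef_bound[folded B_def] and jc = jump_const_def[folded B_def]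
  let ?d = "norm (avg (Suc j) f x - avg j f x)" and ?a = "norm (avg j f x)"
  have B: "0 < B" using \<delta>_pos by (simp add: B_def)
  have two: "(p + q)\<^sup>2 \<le> 2 * p\<^sup>2 + 2 * q\<^sup>2" for p q :: real
    using zero_le_power2[of "p - q"] by (simp add: power2_eq_square algebra_simps)
  show ?thesis
  proof (cases "stop (Suc j) x = Suc j")
    case True
    have "norm (avg (Suc j) f x) \<le> ?d + ?a" by norm
    then have "B * norm (avg (Suc j) f x) \<le> B * (?d + ?a)" using B by (intro mult_left_mono) auto
    then have "norm (coef f (Suc j) x) \<le> B * (?d + ?a)" using cb[of f "Suc j" x] by (rule order.trans[rotated])
    then have "jump f (Suc j) x \<le> B * ?d + 2 * (B * ?a)"
      using cb[of f j x] True by (simp add: distrib_left)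
    then have "(jump f (Suc j) x)\<^sup>2 \<le> (B * ?d + 2 * (B * ?a))\<^sup>2" by (rule power_mono) (rule jump_nonneg)
    also have "\<dots> \<le> 2 * (B * ?d)\<^sup>2 + 2 * (2 * (B * ?a))\<^sup>2" by (rule two)
    also have "\<dots> = 2 * B\<^sup>2 * ?d\<^sup>2 + 8 * B\<^sup>2 * ?a\<^sup>2" by (simp add: power_mult_distrib)
    also have "\<dots> \<le> jump_const * ?d\<^sup>2 + jump_const * ?a\<^sup>2"
      using B by (intro add_mono mult_right_mono) (auto simp: jc)
    also have "\<dots> \<le> jump_const * ?d\<^sup>2 + jump_const * (oscillation j x * ?a\<^sup>2)"
    proof -
      have "1 * ?a\<^sup>2 \<le> oscillation j x * ?a\<^sup>2" using True by (intro mult_right_mono) (auto simp: oscillation_def)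
      moreover have "0 \<le> jump_const" using B by (simp add: jc)
      ultimately show ?thesis by (simp add: mult_left_mono)
    qed
    finally show ?thesis by (simp add: distrib_left)
  next
    case False
    have mu: "measure M (cell (Suc j) x) \<noteq> 0" using stop_null_cell False by blast
    have mu': "measure M (cell j x) \<noteq> 0"
    proof
      assume z: "measure M (cell j x) = 0"
      have "emeasure M (cell (Suc j) x) \<le> emeasure M (cell j x)"
        by (rule emeasure_mono[OF cell_mono]) auto
      with z mu show False by (simp add: emeasure_cell)
    qed
    let ?b1 = "\<beta> (Suc j) x" and ?b0 = "\<beta> j x" and ?v = "norm (avg (Suc j) (G j x) x - \<beta> j x)"
    have b: "\<delta> / 2 \<le> norm ?b1" "\<delta> / 2 \<le> norm ?b0" using \<beta>_ge[OF mu] \<beta>_ge[OF mu'] by auto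
    then have nz: "?b1 \<noteq> 0" "?b0 \<noteq> 0" using \<delta>_pos by auto
    have inv: "inverse (norm ?b1) \<le> B" "inverse (norm ?b0) \<le> B"
      using b \<delta>_pos le_imp_inverse_le[OF b(1)] le_imp_inverse_le[OF b(2)] by (auto simp: B_def)
    have "coef f (Suc j) x - coef f j x
        = (avg (Suc j) f x - avg j f x) * inverse ?b1 + avg j f x * (inverse ?b1 * (?b0 - ?b1) * inverse ?b0)"
      using nz by (simp add: coef_def field_simps)
    then have "norm (coef f (Suc j) x - coef f j x)
        \<le> norm ((avg (Suc j) f x - avg j f x) * inverse ?b1) + norm (avg j f x * (inverse ?b1 * (?b0 - ?b1) * inverse ?b0))"
      by (simp only: norm_triangle_ineq)
    also have "\<dots> = ?d * inverse (norm ?b1) + ?a * (inverse (norm ?b1) * ?v * inverse (norm ?b0))"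
      by (simp add: norm_mult norm_inverse \<beta>_nonstop[OF False] norm_minus_commute)
    also have "\<dots> \<le> ?d * B + ?a * (B * ?v * B)"
      by (intro add_mono mult_left_mono mult_mono inv) (use B in auto)
    finally have "jump f (Suc j) x \<le> ?d * B + ?a * (B * ?v * B)" using False by simp
    then have "(jump f (Suc j) x)\<^sup>2 \<le> (?d * B + ?a * (B * ?v * B))\<^sup>2" by (rule power_mono) (rule jump_nonneg)
    also have "\<dots> \<le> 2 * (?d * B)\<^sup>2 + 2 * (?a * (B * ?v * B))\<^sup>2" by (rule two)
    also have "\<dots> = 2 * B\<^sup>2 * ?d\<^sup>2 + 2 * B ^ 4 * (oscillation j x * ?a\<^sup>2)"
      using False by (simp add: oscillation_def power_mult_distrib power2_eq_square eval_nat_numeral)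
    also have "\<dots> \<le> jump_const * ?d\<^sup>2 + jump_const * (oscillation j x * ?a\<^sup>2)"
      using B by (intro add_mono mult_right_mono) (auto simp: jc oscillation_def)
    finally show ?thesis by (simp add: distrib_left)
  qed
qed

definition square_const :: real where
  "square_const = (2 / \<delta>)\<^sup>2 + jump_const * (1 + 4 * packing_const) + (2 + 2 * (K * (2 / \<delta>))\<^sup>2)"

text \<open>The increments of the averages of \<open>f\<close> are orthogonal, and the terms with \<open>oscillation\<close> are summed by the
  embedding theorem and \<open>oscillation_packing\<close>.\<close>

lemma adapted_square_function:
  assumes f [measurable]: "f \<in> borel_measurable M" and sq: "L2_square M f < \<infinity>"
  shows "(\<Sum>j\<le>N. \<integral>\<^sup>+x. ennreal ((jump f j x)\<^sup>2) \<partial>M) + (\<integral>\<^sup>+x. ennreal ((norm (f x - adapted f N x))\<^sup>2) \<partial>M)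
    \<le> ennreal square_const * L2_square M f"
proof -
  let ?F = "\<integral>\<^sup>+x. ennreal ((norm (f x))\<^sup>2) \<partial>M"
  define B where B_def: "B = 2 / \<delta>"
  note cb = coef_bound[folded B_def] and ab = adapted_bound[folded B_def] and sc = square_const_def[folded B_def]
  have fl: "locally_integrable f" by (rule locally_integrableI_square[OF f sq])
  have B: "0 < B" using \<delta>_pos by (simp add: B_def)
  have cs: "0 < packing_const" "0 \<le> jump_const"
    using K_ge_1 \<delta>_pos by (auto simp: packing_const_def jump_const_def add_nonneg_pos)
  have avgF: "L2_square M (avg j f) \<le> ?F" for j
    by (rule nn_integral_avg_square_le'[OF fl])
  have j0: "(\<integral>\<^sup>+x. ennreal ((jump f 0 x)\<^sup>2) \<partial>M) \<le> ennreal (B\<^sup>2) * ?F"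
  proof -
    have "(jump f 0 x)\<^sup>2 \<le> B\<^sup>2 * (norm (avg 0 f x))\<^sup>2" for x
      using power_mono[OF cb[of f 0 x], of 2] by (simp add: power_mult_distrib)
    then have "(\<integral>\<^sup>+x. ennreal ((jump f 0 x)\<^sup>2) \<partial>M) \<le> (\<integral>\<^sup>+x. ennreal (B\<^sup>2) * ennreal ((norm (avg 0 f x))\<^sup>2) \<partial>M)"
      by (intro nn_integral_mono) (simp flip: ennreal_mult add: ennreal_leI)
    also have "\<dots> = ennreal (B\<^sup>2) * L2_square M (avg 0 f)"
      by (simp add: nn_integral_cmult)
    also have "\<dots> \<le> ennreal (B\<^sup>2) * ?F" by (rule mult_left_mono[OF avgF]) simp
    finally show ?thesis .
  qed
  have carl: "(\<integral>\<^sup>+x. (\<Sum>j<N. ennreal (oscillation j x) * ennreal ((norm (avg j f x))\<^sup>2)) \<partial>M)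
      \<le> ennreal (4 * packing_const) * ?F"
  proof -
    have "(\<integral>\<^sup>+x. (\<Sum>j<N. ennreal (oscillation j x) * ennreal ((norm (avg j f x))\<^sup>2)) \<partial>M)
        \<le> (\<integral>\<^sup>+x. (\<Sum>j<N. ennreal (oscillation j x) * ennreal ((avg j (\<lambda>y. norm (f y)) x)\<^sup>2)) \<partial>M)"
      by (intro nn_integral_mono sum_mono mult_left_mono ennreal_leI power_mono norm_avg_le fl) auto
    also have "\<dots> \<le> ennreal (4 * packing_const) * ?F"
      by (rule carleson_embedding[OF locally_integrable_norm[OF fl] _ _ cs(1) oscillation_packing]) auto
    finally show ?thesis .
  qed
  have js: "(\<Sum>j<N. \<integral>\<^sup>+x. ennreal ((jump f (Suc j) x)\<^sup>2) \<partial>M) \<le> ennreal (jump_const * (1 + 4 * packing_const)) * ?F"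
  proof -
    have "(\<Sum>j<N. \<integral>\<^sup>+x. ennreal ((jump f (Suc j) x)\<^sup>2) \<partial>M)
      \<le> (\<Sum>j<N. \<integral>\<^sup>+x. ennreal jump_const * (ennreal ((norm (avg (Suc j) f x - avg j f x))\<^sup>2)
           + ennreal (oscillation j x) * ennreal ((norm (avg j f x))\<^sup>2)) \<partial>M)"
    proof (intro sum_mono nn_integral_mono)
      fix j x
      show "ennreal ((jump f (Suc j) x)\<^sup>2) \<le> ennreal jump_const * (ennreal ((norm (avg (Suc j) f x - avg j f x))\<^sup>2)
           + ennreal (oscillation j x) * ennreal ((norm (avg j f x))\<^sup>2))"
        using ennreal_leI[OF jump_square[of f j x]] cs
        by (simp add: ennreal_mult ennreal_plus oscillation_def del: jump.simps)
    qed
    also have "\<dots> = ennreal jump_const * ((\<Sum>j<N. \<integral>\<^sup>+x. ennreal ((norm (avg (Suc j) f x - avg j f x))\<^sup>2) \<partial>M)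
        + (\<integral>\<^sup>+x. (\<Sum>j<N. ennreal (oscillation j x) * ennreal ((norm (avg j f x))\<^sup>2)) \<partial>M))"
      by (simp add: nn_integral_cmult nn_integral_add nn_integral_sum sum_distrib_left[symmetric] sum.distrib)
    also have "\<dots> \<le> ennreal jump_const * (?F + ennreal (4 * packing_const) * ?F)"
      by (intro mult_left_mono add_mono carl sum_martingale_differences fl) simp
    also have "\<dots> = ennreal (jump_const * (1 + 4 * packing_const)) * ?F"
      using cs by (simp add: ennreal_mult distrib_left distrib_right mult.assoc)
    finally show ?thesis .
  qed
  have rest: "(\<integral>\<^sup>+x. ennreal ((norm (f x - adapted f N x))\<^sup>2) \<partial>M) \<le> ennreal (2 + 2 * (K * B)\<^sup>2) * ?F"
  proof -
    have "(norm (f x - adapted f N x))\<^sup>2 \<le> 2 * (norm (f x))\<^sup>2 + 2 * (K * B)\<^sup>2 * (norm (avg N f x))\<^sup>2" for x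
    proof -
      have "norm (f x - adapted f N x) \<le> norm (f x) + norm (adapted f N x)" by norm
      also have "\<dots> \<le> norm (f x) + K * B * norm (avg N f x)" by (rule add_left_mono[OF ab])
      finally have "(norm (f x - adapted f N x))\<^sup>2 \<le> (norm (f x) + K * B * norm (avg N f x))\<^sup>2"
        by (rule power_mono) simp
      also have "\<dots> \<le> 2 * (norm (f x))\<^sup>2 + 2 * (K * B * norm (avg N f x))\<^sup>2"
        using zero_le_power2[of "norm (f x) - K * B * norm (avg N f x)"]
        unfolding power2_sum power2_diff by linarith
      finally show ?thesis by (simp add: power_mult_distrib)
    qed
    then have "ennreal ((norm (f x - adapted f N x))\<^sup>2)
        \<le> ennreal (2 * (norm (f x))\<^sup>2 + 2 * (K * B)\<^sup>2 * (norm (avg N f x))\<^sup>2)" for x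
      by (rule ennreal_leI)
    also have "ennreal (2 * (norm (f x))\<^sup>2 + 2 * (K * B)\<^sup>2 * (norm (avg N f x))\<^sup>2)
        = ennreal 2 * ennreal ((norm (f x))\<^sup>2) + ennreal (2 * (K * B)\<^sup>2) * ennreal ((norm (avg N f x))\<^sup>2)" for x
      by (simp add: ennreal_mult)
    finally have pt: "ennreal ((norm (f x - adapted f N x))\<^sup>2)
        \<le> ennreal 2 * ennreal ((norm (f x))\<^sup>2) + ennreal (2 * (K * B)\<^sup>2) * ennreal ((norm (avg N f x))\<^sup>2)" for x .
    have "(\<integral>\<^sup>+x. ennreal ((norm (f x - adapted f N x))\<^sup>2) \<partial>M)
        \<le> (\<integral>\<^sup>+x. ennreal 2 * ennreal ((norm (f x))\<^sup>2) + ennreal (2 * (K * B)\<^sup>2) * ennreal ((norm (avg N f x))\<^sup>2) \<partial>M)"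
      by (rule nn_integral_mono[OF pt])
    also have "\<dots> = ennreal 2 * ?F + ennreal (2 * (K * B)\<^sup>2) * L2_square M (avg N f)"
      by (simp add: nn_integral_add nn_integral_cmult)
    also have "\<dots> \<le> ennreal 2 * ?F + ennreal (2 * (K * B)\<^sup>2) * ?F"
      by (intro add_left_mono mult_left_mono avgF) simp
    also have "\<dots> = ennreal (2 + 2 * (K * B)\<^sup>2) * ?F"
      by (subst ennreal_plus) (auto simp: distrib_right)
    finally show ?thesis .
  qed
  have "(\<Sum>j\<le>N. \<integral>\<^sup>+x. ennreal ((jump f j x)\<^sup>2) \<partial>M)
      = (\<integral>\<^sup>+x. ennreal ((jump f 0 x)\<^sup>2) \<partial>M) + (\<Sum>j<N. \<integral>\<^sup>+x. ennreal ((jump f (Suc j) x)\<^sup>2) \<partial>M)"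
    by (rule sum.atMost_shift)
  then have "(\<Sum>j\<le>N. \<integral>\<^sup>+x. ennreal ((jump f j x)\<^sup>2) \<partial>M) + (\<integral>\<^sup>+x. ennreal ((norm (f x - adapted f N x))\<^sup>2) \<partial>M)
      \<le> (ennreal (B\<^sup>2) * ?F + ennreal (jump_const * (1 + 4 * packing_const)) * ?F) + ennreal (2 + 2 * (K * B)\<^sup>2) * ?F"
    by (simp only:) (intro add_mono j0 js rest)
  also have "\<dots> = ennreal square_const * ?F"
  proof -
    have "ennreal square_const = ennreal (B\<^sup>2) + ennreal (jump_const * (1 + 4 * packing_const)) + ennreal (2 + 2 * (K * B)\<^sup>2)"
      unfolding sc using cs by (subst ennreal_plus, simp, simp, subst ennreal_plus) auto
    then show ?thesis by (simp only: distrib_right)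
  qed
  finally show ?thesis .
qed

end

section \<open>Kernel estimates\<close>

text \<open>The size bound for the kernel, a Poisson kernel of the scale \<open>t\<close>.\<close>

definition poisson :: "real \<Rightarrow> real \<Rightarrow> real \<Rightarrow> real ^ 'n \<Rightarrow> real ^ 'n \<Rightarrow> real" where
  "poisson m \<alpha> t x y = t powr \<alpha> / (t + norm (x - y)) powr (m + \<alpha>)"

lemma poisson_nonneg [simp]: "0 \<le> poisson m \<alpha> t x y"
  by (simp add: poisson_def)

lemma poisson_commute: "poisson m \<alpha> t x y = poisson m \<alpha> t y x"
  by (simp add: poisson_def norm_minus_commute)

lemma poisson_measurable [measurable (raw)]:
  assumes [measurable]: "f \<in> borel_measurable M" "g \<in> borel_measurable M"
  shows "(\<lambda>x. poisson m \<alpha> t (f x) (g x)) \<in> borel_measurable M"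
  unfolding poisson_def by measurable

lemma poisson_le_powr:
  assumes "0 < t" "0 < m" "0 < \<alpha>"
  shows "poisson m \<alpha> t x y \<le> t powr (- m)"
proof -
  have "t powr \<alpha> / (t + norm (x - y)) powr (m + \<alpha>) \<le> t powr \<alpha> / t powr (m + \<alpha>)"
    using assms add_pos_nonneg[OF assms(1) norm_ge_zero[of "x - y"]]
    by (intro divide_left_mono powr_mono2) (auto intro!: mult_pos_pos)
  also have "\<dots> = t powr (- m)" using assms by (simp add: powr_diff[symmetric])
  finally show ?thesis by (simp add: poisson_def)
qed

lemma poisson_comparable_scale:
  assumes "0 < l" "l \<le> t" "t \<le> 2 * l" "0 < m" "0 < \<alpha>"
  shows "poisson m \<alpha> t x y \<le> 2 powr \<alpha> * poisson m \<alpha> l x y"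
proof -
  have "t powr \<alpha> / (t + norm (x - y)) powr (m + \<alpha>) \<le> (2 * l) powr \<alpha> / (l + norm (x - y)) powr (m + \<alpha>)"
    using assms add_pos_nonneg[OF assms(1) norm_ge_zero[of "x - y"]]
    by (intro frac_le powr_mono2) auto
  then show ?thesis using assms by (simp add: poisson_def powr_mult)
qed

text \<open>A good point keeps, from the boundary of its cell \<open>j\<close> levels above the current one, a distance of at
  least a multiple of \<open>good_ratio ^ j\<close> times the side of that cell. The exponent \<open>\<alpha> / (2 (m + \<alpha>))\<close> is
  small enough that the decay of the kernel wins over the smallness of this distance.\<close>

definition good_ratio :: "real \<Rightarrow> real \<Rightarrow> real" where
  "good_ratio m \<alpha> = 2 powr (- (\<alpha> / (2 * (m + \<alpha>))))"

lemma good_ratio_pos: "0 < good_ratio m \<alpha>" by (simp add: good_ratio_def)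

lemma good_ratio_less_1: "0 < m \<Longrightarrow> 0 < \<alpha> \<Longrightarrow> good_ratio m \<alpha> < 1"
  by (simp add: good_ratio_def powr_less_one)

lemma good_ratio_ge_half: "0 < m \<Longrightarrow> 0 < \<alpha> \<Longrightarrow> 1 / 2 \<le> good_ratio m \<alpha>"
proof -
  assume "0 < m" "0 < \<alpha>"
  then have "\<alpha> / (2 * (m + \<alpha>)) \<le> 1" by (simp add: divide_le_eq_1)
  then have "2 powr (- 1 :: real) \<le> 2 powr (- (\<alpha> / (2 * (m + \<alpha>))))" by (intro powr_mono) auto
  then show ?thesis by (simp add: good_ratio_def powr_minus_divide)
qed

text \<open>At distance \<open>d \<ge> \<eta> l\<close> with \<open>\<eta> \<le> 1\<close> one has \<open>l + d \<le> 2 d / \<eta>\<close>, so that replacing \<open>t\<close> by \<open>l\<close> in the denominator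
  costs \<open>(2 / \<eta>)\<^bsup>m + \<alpha>\<^esup>\<close>, while the numerator gains \<open>(t / l)\<^bsup>\<alpha>\<^esup>\<close>, about \<open>2\<^bsup>-j \<alpha>\<^esup>\<close>. For this \<open>\<eta>\<close>
  the cost eats only half of the gain.\<close>

lemma poisson_off_diagonal:
  fixes x y :: "real ^ 'n"
  assumes l: "0 < l" and m: "0 < m" "0 < \<alpha>" and c: "0 < c" "c \<le> 1"
    and t: "l / 2 ^ j \<le> t" "t \<le> 2 * (l / 2 ^ j)"
    and d: "c * good_ratio m \<alpha> ^ j * l \<le> norm (x - y)"
  shows "poisson m \<alpha> t x y \<le> 2 powr \<alpha> * (2 / c) powr (m + \<alpha>) * (2 powr (- \<alpha> / 2)) ^ j * poisson m \<alpha> l x y"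
proof -
  let ?d = "norm (x - y)" and ?r = "good_ratio m \<alpha>"
  define \<eta> where "\<eta> = c * ?r ^ j"
  have r: "0 < ?r" "?r \<le> 1" using good_ratio_pos[of m \<alpha>] good_ratio_less_1[OF m] by auto
  have \<eta>: "0 < \<eta>" "\<eta> \<le> 1"
    using r c by (auto simp: \<eta>_def intro!: mult_le_one power_le_one)
  have d0: "0 < ?d" using d l \<eta> unfolding \<eta>_def[symmetric] by (meson less_le_trans mult_pos_pos)
  have t0: "0 < t" using t(1) l by (meson divide_pos_pos less_le_trans zero_less_numeral zero_less_power)
  have "l \<le> ?d / \<eta>" using d \<eta> unfolding \<eta>_def[symmetric] by (simp add: field_simps)
  moreover have "?d \<le> ?d / \<eta>" using \<eta> d0 by (simp add: field_simps)
  ultimately have "l + ?d \<le> (2 / \<eta>) * ?d" by simp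
  then have "(l + ?d) powr (m + \<alpha>) \<le> ((2 / \<eta>) * ?d) powr (m + \<alpha>)"
    using l d0 m by (intro powr_mono2) auto
  also have "\<dots> = (2 / \<eta>) powr (m + \<alpha>) * ?d powr (m + \<alpha>)"
    by (rule powr_mult)
  finally have A: "(l + ?d) powr (m + \<alpha>) \<le> (2 / \<eta>) powr (m + \<alpha>) * ?d powr (m + \<alpha>)" .
  have r_pow: "(?r ^ j) powr (m + \<alpha>) = (2 powr (- \<alpha> / 2)) ^ j"
  proof -
    have "(?r ^ j) powr (m + \<alpha>) = (2 powr (- (\<alpha> / (2 * (m + \<alpha>))) * (m + \<alpha>))) ^ j"
      by (simp add: good_ratio_def powr_powr powr_power mult.commute mult.left_commute)
    also have "- (\<alpha> / (2 * (m + \<alpha>))) * (m + \<alpha>) = - \<alpha> / 2" using m by (simp add: field_simps)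
    finally show ?thesis .
  qed
  have eta_pow: "(2 / \<eta>) powr (m + \<alpha>) = (2 / c) powr (m + \<alpha>) / (2 powr (- \<alpha> / 2)) ^ j"
    using c r r_pow by (simp add: \<eta>_def powr_divide powr_mult)
  have "t powr \<alpha> / (t + ?d) powr (m + \<alpha>) \<le> (2 * (l / 2 ^ j)) powr \<alpha> / ?d powr (m + \<alpha>)"
    using t t0 d0 m by (intro frac_le powr_mono2) auto
  also have "(2 * (l / 2 ^ j)) powr \<alpha> = 2 powr \<alpha> * (l powr \<alpha> * ((2 powr (- \<alpha> / 2)) ^ j * (2 powr (- \<alpha> / 2)) ^ j))"
  proof -
    have "(2 ^ j) powr (- \<alpha>) = (2 powr (- \<alpha> / 2)) ^ j * (2 powr (- \<alpha> / 2)) ^ j"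
      by (simp add: powr_realpow[symmetric] powr_powr powr_add[symmetric] field_simps powr_power)
    moreover have "(l / 2 ^ j) powr \<alpha> = l powr \<alpha> * (2 ^ j) powr (- \<alpha>)"
      using l by (simp add: powr_divide powr_minus_divide)
    ultimately have "(l / 2 ^ j) powr \<alpha> = l powr \<alpha> * ((2 powr (- \<alpha> / 2)) ^ j * (2 powr (- \<alpha> / 2)) ^ j)"
      by (simp only:)
    then show ?thesis by (simp only: powr_mult[of 2 "l / 2 ^ j"])
  qed
  also have "2 powr \<alpha> * (l powr \<alpha> * ((2 powr (- \<alpha> / 2)) ^ j * (2 powr (- \<alpha> / 2)) ^ j)) / ?d powr (m + \<alpha>)
     \<le> 2 powr \<alpha> * (l powr \<alpha> * ((2 powr (- \<alpha> / 2)) ^ j * (2 powr (- \<alpha> / 2)) ^ j)) * ((2 / \<eta>) powr (m + \<alpha>) / (l + ?d) powr (m + \<alpha>))"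
  proof -
    have "1 / ?d powr (m + \<alpha>) \<le> (2 / \<eta>) powr (m + \<alpha>) / (l + ?d) powr (m + \<alpha>)"
    proof -
      have "0 < ?d powr (m + \<alpha>)" "0 < (l + ?d) powr (m + \<alpha>)"
        using d0 add_pos_pos[OF l d0] by auto
      with A show ?thesis by (simp add: pos_divide_le_eq pos_le_divide_eq)
    qed
    then show ?thesis
      by (subst divide_inverse, intro mult_left_mono) (auto simp: inverse_eq_divide)
  qed
  also have "\<dots> = 2 powr \<alpha> * (2 / c) powr (m + \<alpha>) * (2 powr (- \<alpha> / 2)) ^ j * poisson m \<alpha> l x y"
    unfolding eta_pow poisson_def by (simp add: field_simps)
  finally show ?thesis by (simp add: poisson_def)
qed

text \<open>The standing assumptions, with named constants.\<close>

locale kernel_family =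
  fixes \<mu> :: "(real ^ 'n) measure" and m \<alpha> :: real
    and s :: "real \<Rightarrow> real ^ 'n \<Rightarrow> real ^ 'n \<Rightarrow> complex"
    and C\<^sub>\<mu> C\<^sub>s C\<^sub>c :: real
  assumes m_pos: "0 < m" and \<alpha>_pos: "0 < \<alpha>"
    and sets_\<mu> [measurable_cong, simp]: "sets \<mu> = sets borel"
    and C_nonneg: "0 \<le> C\<^sub>\<mu>" "0 \<le> C\<^sub>s" "0 \<le> C\<^sub>c"
    and power: "\<And>x r. 0 < r \<Longrightarrow> emeasure \<mu> (ball x r) \<le> ennreal (C\<^sub>\<mu> * r powr m)"
    and measurable_s: "kernel_measurable s"
    and size: "\<And>t x y. 0 < t \<Longrightarrow> norm (s t x y) \<le> C\<^sub>s * poisson m \<alpha> t x y"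
    and continuity: "\<And>t x y z. 0 < t \<Longrightarrow> norm (y - z) < t / 2 \<Longrightarrow>
        norm (s t x y - s t x z) \<le> C\<^sub>c * (norm (y - z) powr \<alpha> / (t + norm (x - y)) powr (m + \<alpha>))"
begin

lemma space_\<mu> [simp]: "space \<mu> = UNIV"
  using sets_eq_imp_space_eq[OF sets_\<mu>] by simp

lemma emeasure_ball_finite: "emeasure \<mu> (ball x r) < \<infinity>"
proof (cases "0 < r")
  case True
  from power[OF this, of x] show ?thesis by (rule le_less_trans) simp
next
  case False
  then have "ball x r = {}" by simp
  then show ?thesis by (simp only: emeasure_empty) simp
qed

lemma emeasure_bounded_finite: "bounded S \<Longrightarrow> emeasure \<mu> S < \<infinity>"
proof -
  assume "bounded S"
  then obtain r where "S \<subseteq> ball 0 r" using bounded_subset_ballD by metis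
  then have "emeasure \<mu> S \<le> emeasure \<mu> (ball 0 r)" by (intro emeasure_mono) auto
  then show ?thesis using emeasure_ball_finite le_less_trans by blast
qed

lemma sigma_finite: "sigma_finite_measure \<mu>"
proof
  show "\<exists>A. countable A \<and> A \<subseteq> sets \<mu> \<and> \<Union> A = space \<mu> \<and> (\<forall>a\<in>A. emeasure \<mu> a \<noteq> \<infinity>)"
  proof (intro exI conjI ballI)
    show "countable (range (\<lambda>n. ball (0 :: real ^ 'n) (real n)))" by simp
    show "\<Union> (range (\<lambda>n. ball (0 :: real ^ 'n) (real n))) = space \<mu>"
      by (auto simp: reals_Archimedean2)
  qed (use emeasure_ball_finite in \<open>auto simp: less_top[symmetric]\<close>)
qed

sublocale sigma_finite_measure \<mu> by (rule sigma_finite)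

sublocale self_pair: pair_sigma_finite \<mu> \<mu> ..

sublocale half_space: pair_sigma_finite \<mu> lborel ..

definition C\<^sub>P :: real where
  "C\<^sub>P = C\<^sub>\<mu> * 2 powr (m + \<alpha>) / (1 - 2 powr (- \<alpha>))"

lemma two_powr_minus: "2 powr (- \<alpha>) < 1" using \<alpha>_pos by (simp add: powr_less_one)

lemma C\<^sub>P_nonneg: "0 \<le> C\<^sub>P"
  using C_nonneg two_powr_minus by (simp add: C\<^sub>P_def)

text \<open>On the annulus \<open>2\<^sup>i\<^sup>-\<^sup>1 t \<le> |x - y| < 2\<^sup>i t\<close> the kernel is at most \<open>c i\<close>, and the power bound for the
  ball of radius \<open>2\<^sup>i t\<close> leaves a geometric series of ratio \<open>2\<^bsup>-\<alpha>\<^esup>\<close>.\<close>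

lemma nn_integral_poisson_le:
  assumes t: "0 < t"
  shows "(\<integral>\<^sup>+y. ennreal (poisson m \<alpha> t x y) \<partial>\<mu>) \<le> ennreal C\<^sub>P"
proof -
  define c where "c i = t powr (- m) * 2 powr ((1 - real i) * (m + \<alpha>))" for i :: nat
  have c0: "0 \<le> c i" for i by (simp add: c_def)
  have [measurable]: "ball x r \<in> sets \<mu>" for r by simp
  have pt: "ennreal (poisson m \<alpha> t x y) \<le> (\<Sum>i. ennreal (c i) * indicator (ball x (2 ^ i * t)) y)" for y
  proof -
    obtain n0 where "norm (x - y) / t < 2 ^ n0" using real_arch_pow[of 2 "norm (x - y) / t"] by auto
    then have n0: "norm (x - y) < 2 ^ n0 * t" using t by (simp add: field_simps)
    define i where "i = (LEAST i. norm (x - y) < 2 ^ i * t)"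
    have i: "norm (x - y) < 2 ^ i * t" unfolding i_def by (rule LeastI[of _ n0]) (rule n0)
    have "poisson m \<alpha> t x y \<le> c i"
    proof (cases i)
      case 0
      have "poisson m \<alpha> t x y \<le> t powr (- m)" by (rule poisson_le_powr[OF t m_pos \<alpha>_pos])
      also have "\<dots> \<le> t powr (- m) * 2 powr (m + \<alpha>)"
        using mult_left_mono[OF ge_one_powr_ge_zero[of 2 "m + \<alpha>"], of "t powr (- m)"] m_pos \<alpha>_pos by simp
      finally show ?thesis by (simp add: c_def 0)
    next
      case (Suc k)
      have "\<not> norm (x - y) < 2 ^ k * t" using not_less_Least[of k "\<lambda>i. norm (x - y) < 2 ^ i * t"] Suc i_def by simp
      then have k: "2 ^ k * t \<le> t + norm (x - y)" using t by simp
      have "poisson m \<alpha> t x y \<le> t powr \<alpha> / (2 ^ k * t) powr (m + \<alpha>)"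
        unfolding poisson_def using k t m_pos \<alpha>_pos add_pos_nonneg[OF t norm_ge_zero[of "x - y"]]
        by (intro divide_left_mono powr_mono2) (auto intro!: mult_pos_pos add_pos_nonneg)
      also have "\<dots> = (t powr \<alpha> / t powr (m + \<alpha>)) / (2 ^ k) powr (m + \<alpha>)"
        using t by (simp add: powr_mult)
      also have "t powr \<alpha> / t powr (m + \<alpha>) = t powr (- m)" using t by (simp add: powr_diff[symmetric])
      also have "(2 ^ k :: real) powr (m + \<alpha>) = 2 powr (real k * (m + \<alpha>))"
        by (simp add: powr_realpow[symmetric] powr_powr)
      finally show ?thesis by (simp add: c_def Suc powr_minus_divide)
    qed
    then have "ennreal (poisson m \<alpha> t x y) \<le> ennreal (c i) * indicator (ball x (2 ^ i * t)) y"
      using i by (simp add: ennreal_leI dist_norm)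
    also have "\<dots> \<le> (\<Sum>i. ennreal (c i) * indicator (ball x (2 ^ i * t)) y)"
    proof -
      define F where "F k = ennreal (c k) * indicator (ball x (2 ^ k * t)) y" for k
      have "sum F {i} \<le> suminf F" by (rule sum_le_suminf) auto
      then have "F i \<le> suminf F" by simp
      then show ?thesis unfolding F_def .
    qed
    finally show ?thesis .
  qed
  have "(\<integral>\<^sup>+y. ennreal (poisson m \<alpha> t x y) \<partial>\<mu>)
      \<le> (\<integral>\<^sup>+y. (\<Sum>i. ennreal (c i) * indicator (ball x (2 ^ i * t)) y) \<partial>\<mu>)"
    by (rule nn_integral_mono[OF pt])
  also have "\<dots> = (\<Sum>i. ennreal (c i) * emeasure \<mu> (ball x (2 ^ i * t)))"
    by (subst nn_integral_suminf) (auto simp: nn_integral_cmult_indicator)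
  also have "\<dots> \<le> (\<Sum>i. ennreal (C\<^sub>\<mu> * 2 powr (m + \<alpha>) * (2 powr (- \<alpha>)) ^ i))"
  proof (rule suminf_le)
    fix i
    have e: "c i * (C\<^sub>\<mu> * (2 ^ i * t) powr m) = C\<^sub>\<mu> * 2 powr (m + \<alpha>) * (2 powr (- \<alpha>)) ^ i"
    proof -
      have 1: "t powr (- m) * t powr m = 1" using t by (simp add: powr_add[symmetric])
      have 2: "2 powr ((1 - real i) * (m + \<alpha>)) * (2 ^ i) powr m = 2 powr (m + \<alpha>) * (2 powr (- \<alpha>)) ^ i"
      proof -
        have "(2 :: real) ^ i = 2 powr real i" by (simp add: powr_realpow)
        moreover have "(2 powr (- \<alpha>)) ^ i = 2 powr (- \<alpha> * real i)" by (simp add: powr_power mult.commute)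
        moreover have "(1 - real i) * (m + \<alpha>) + real i * m = m + \<alpha> + - \<alpha> * real i" by (simp add: algebra_simps)
        ultimately show ?thesis by (simp only: powr_powr powr_add[symmetric])
      qed
      have "c i * (C\<^sub>\<mu> * (2 ^ i * t) powr m)
          = (t powr (- m) * t powr m) * (C\<^sub>\<mu> * (2 powr ((1 - real i) * (m + \<alpha>)) * (2 ^ i) powr m))"
        unfolding c_def powr_mult by (simp only: ac_simps)
      then show ?thesis unfolding 1 2 by (simp add: mult.assoc)
    qed
    have "ennreal (c i) * emeasure \<mu> (ball x (2 ^ i * t)) \<le> ennreal (c i) * ennreal (C\<^sub>\<mu> * (2 ^ i * t) powr m)"
      using t by (intro mult_left_mono power) auto
    also have "\<dots> = ennreal (c i * (C\<^sub>\<mu> * (2 ^ i * t) powr m))"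
      using C_nonneg c0 by (simp add: ennreal_mult)
    finally show "ennreal (c i) * emeasure \<mu> (ball x (2 ^ i * t)) \<le> ennreal (C\<^sub>\<mu> * 2 powr (m + \<alpha>) * (2 powr (- \<alpha>)) ^ i)"
      unfolding e .
  qed auto
  also have "\<dots> = ennreal C\<^sub>P"
  proof (rule suminf_ennreal_eq)
    have "(\<lambda>i. (2 powr (- \<alpha>)) ^ i) sums (1 / (1 - 2 powr (- \<alpha>)))"
      using two_powr_minus by (intro geometric_sums) simp
    from sums_mult[OF this, of "C\<^sub>\<mu> * 2 powr (m + \<alpha>)"]
    show "(\<lambda>i. C\<^sub>\<mu> * 2 powr (m + \<alpha>) * (2 powr (- \<alpha>)) ^ i) sums C\<^sub>P" by (simp add: C\<^sub>P_def)
  qed (use C_nonneg in auto)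
  finally show ?thesis .
qed

text \<open>Schur's test: Cauchy-Schwarz for the measure \<open>poisson m \<alpha> t x y d\<mu>(y)\<close>, whose mass is at most \<open>C\<^sub>P\<close>,
  followed by Tonelli's theorem and the symmetry of the kernel.\<close>

lemma schur:
  fixes h :: "real ^ 'n \<Rightarrow> ennreal"
  assumes [measurable]: "h \<in> borel_measurable \<mu>" and t: "0 < t"
  shows "(\<integral>\<^sup>+x. (\<integral>\<^sup>+y. ennreal (poisson m \<alpha> t x y) * h y \<partial>\<mu>)\<^sup>2 \<partial>\<mu>) \<le> ennreal (C\<^sub>P\<^sup>2) * (\<integral>\<^sup>+y. (h y)\<^sup>2 \<partial>\<mu>)"
proof -
  let ?P = "\<lambda>x y. ennreal (poisson m \<alpha> t x y)"
  have cs: "(\<integral>\<^sup>+y. ?P x y * h y \<partial>\<mu>)\<^sup>2 \<le> ennreal C\<^sub>P * (\<integral>\<^sup>+y. ?P x y * (h y)\<^sup>2 \<partial>\<mu>)" for x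
  proof -
    let ?r = "\<lambda>y. ennreal (sqrt (poisson m \<alpha> t x y))"
    have rr: "?r y * ?r y = ?P x y" for y by (simp flip: ennreal_mult)
    have "(\<integral>\<^sup>+y. ?P x y * h y \<partial>\<mu>)\<^sup>2 = (\<integral>\<^sup>+y. ?r y * (?r y * h y) \<partial>\<mu>)\<^sup>2"
      by (simp add: mult.assoc[symmetric] rr)
    also have "\<dots> \<le> (\<integral>\<^sup>+y. (?r y)\<^sup>2 \<partial>\<mu>) * (\<integral>\<^sup>+y. (?r y * h y)\<^sup>2 \<partial>\<mu>)"
      by (rule Cauchy_Schwarz_nn_integral) auto
    also have "\<dots> = (\<integral>\<^sup>+y. ?P x y \<partial>\<mu>) * (\<integral>\<^sup>+y. ?P x y * (h y)\<^sup>2 \<partial>\<mu>)"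
    proof -
      have "(?r y * h y)\<^sup>2 = (?r y * ?r y) * (h y)\<^sup>2" for y by (simp add: power2_eq_square ac_simps)
      then show ?thesis by (simp only: power2_eq_square[of "?r _"] rr)
    qed
    also have "\<dots> \<le> ennreal C\<^sub>P * (\<integral>\<^sup>+y. ?P x y * (h y)\<^sup>2 \<partial>\<mu>)"
      by (rule mult_right_mono[OF nn_integral_poisson_le[OF t]]) simp
    finally show ?thesis .
  qed
  have "(\<integral>\<^sup>+x. (\<integral>\<^sup>+y. ?P x y * h y \<partial>\<mu>)\<^sup>2 \<partial>\<mu>) \<le> (\<integral>\<^sup>+x. ennreal C\<^sub>P * (\<integral>\<^sup>+y. ?P x y * (h y)\<^sup>2 \<partial>\<mu>) \<partial>\<mu>)"
    by (rule nn_integral_mono[OF cs])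
  also have "\<dots> = ennreal C\<^sub>P * (\<integral>\<^sup>+x. \<integral>\<^sup>+y. ?P x y * (h y)\<^sup>2 \<partial>\<mu> \<partial>\<mu>)"
    by (rule nn_integral_cmult) measurable
  also have "(\<integral>\<^sup>+x. \<integral>\<^sup>+y. ?P x y * (h y)\<^sup>2 \<partial>\<mu> \<partial>\<mu>) = (\<integral>\<^sup>+y. \<integral>\<^sup>+x. ?P x y * (h y)\<^sup>2 \<partial>\<mu> \<partial>\<mu>)"
    by (rule self_pair.Fubini') measurable
  also have "\<dots> = (\<integral>\<^sup>+y. (\<integral>\<^sup>+x. ?P y x \<partial>\<mu>) * (h y)\<^sup>2 \<partial>\<mu>)"
    by (subst nn_integral_multc[symmetric]) (auto simp: poisson_commute)
  also have "\<dots> \<le> (\<integral>\<^sup>+y. ennreal C\<^sub>P * (h y)\<^sup>2 \<partial>\<mu>)"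
    by (intro nn_integral_mono mult_right_mono nn_integral_poisson_le t) simp
  also have "\<dots> = ennreal C\<^sub>P * (\<integral>\<^sup>+y. (h y)\<^sup>2 \<partial>\<mu>)" by (rule nn_integral_cmult) measurable
  also have "ennreal C\<^sub>P * (ennreal C\<^sub>P * (\<integral>\<^sup>+y. (h y)\<^sup>2 \<partial>\<mu>)) = ennreal (C\<^sub>P\<^sup>2) * (\<integral>\<^sup>+y. (h y)\<^sup>2 \<partial>\<mu>)"
    using C\<^sub>P_nonneg by (simp add: power2_eq_square ennreal_mult mult.assoc)
  finally show ?thesis by (simp add: mult_left_mono)
qed

text \<open>Bounds the diameter of a cube of side one.\<close>

definition diam_const :: real where "diam_const = real CARD('n)"

definition C\<^sub>R :: real where
  "C\<^sub>R = C\<^sub>c * diam_const powr \<alpha> + C\<^sub>s * (1 + (1 + diam_const) powr (m + \<alpha>)) * (2 * diam_const) powr \<alpha>"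

lemma diam_const_ge_1: "1 \<le> diam_const"
  by (simp add: diam_const_def Suc_leI)

lemma C\<^sub>R_nonneg: "0 \<le> C\<^sub>R"
  using C_nonneg by (simp add: C\<^sub>R_def)

text \<open>The continuity assumption covers \<open>|y - z| < t/2\<close>. For larger \<open>|y - z|\<close> the sizes \<open>l\<close> and \<open>t\<close> are
  comparable, and the size bound alone suffices, since \<open>poisson m \<alpha> t x z\<close> and \<open>poisson m \<alpha> t x y\<close> are
  then comparable, too.\<close>

lemma kernel_difference:
  assumes l: "0 < l" "l \<le> t" and yz: "norm (y - z) \<le> diam_const * l"
  shows "norm (s t x y - s t x z) \<le> C\<^sub>R * (l / t) powr \<alpha> * poisson m \<alpha> t x y"
proof -
  let ?D = diam_const and ?P = "poisson m \<alpha> t x y"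
  have t: "0 < t" using l by simp
  have D: "1 \<le> ?D" by (rule diam_const_ge_1)
  have Pt: "?P = t powr \<alpha> / (t + norm (x - y)) powr (m + \<alpha>)" by (simp add: poisson_def)
  show ?thesis
  proof (cases "norm (y - z) < t / 2")
    case True
    have "norm (s t x y - s t x z) \<le> C\<^sub>c * (norm (y - z) powr \<alpha> / (t + norm (x - y)) powr (m + \<alpha>))"
      by (rule continuity[OF t True])
    also have "\<dots> \<le> C\<^sub>c * ((?D * l) powr \<alpha> / (t + norm (x - y)) powr (m + \<alpha>))"
      using C_nonneg yz \<alpha>_pos by (intro mult_left_mono divide_right_mono powr_mono2) auto
    also have "\<dots> = C\<^sub>c * ?D powr \<alpha> * (l / t) powr \<alpha> * ?P"
      using D l t by (simp add: Pt powr_mult powr_divide)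
    also have "\<dots> \<le> C\<^sub>R * (l / t) powr \<alpha> * ?P"
      using C_nonneg by (intro mult_right_mono) (auto simp: C\<^sub>R_def)
    finally show ?thesis .
  next
    case False
    then have "t / 2 \<le> ?D * l" using yz by simp
    then have "1 \<le> 2 * ?D * (l / t)" using t by (simp add: field_simps)
    then have "1 powr \<alpha> \<le> (2 * ?D * (l / t)) powr \<alpha>" using \<alpha>_pos by (intro powr_mono2) auto
    then have one: "1 \<le> (2 * ?D) powr \<alpha> * (l / t) powr \<alpha>" by (subst (asm) powr_mult) (use D l t in auto)
    have "norm (x - y) \<le> norm (x - z) + norm (y - z)" by norm
    also have "norm (y - z) \<le> ?D * t" using yz l D by (meson mult_left_mono order.trans zero_le_one)
    finally have "t + norm (x - y) \<le> (1 + ?D) * (t + norm (x - z))"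
      using mult_nonneg_nonneg[OF order.trans[OF zero_le_one D] norm_ge_zero[of "x - z"]]
      by (simp add: algebra_simps)
    then have "(t + norm (x - y)) powr (m + \<alpha>) \<le> ((1 + ?D) * (t + norm (x - z))) powr (m + \<alpha>)"
      using t m_pos \<alpha>_pos by (intro powr_mono2) auto
    also have "\<dots> = (1 + ?D) powr (m + \<alpha>) * (t + norm (x - z)) powr (m + \<alpha>)"
      using D t by (simp add: powr_mult)
    finally have pw: "(t + norm (x - y)) powr (m + \<alpha>) \<le> (1 + ?D) powr (m + \<alpha>) * (t + norm (x - z)) powr (m + \<alpha>)" .
    have Pz: "poisson m \<alpha> t x z \<le> (1 + ?D) powr (m + \<alpha>) * ?P"
    proof -
      have "0 < (t + norm (x - y)) powr (m + \<alpha>)" "0 < (t + norm (x - z)) powr (m + \<alpha>)"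
        using add_pos_nonneg[OF t norm_ge_zero[of "x - y"]] add_pos_nonneg[OF t norm_ge_zero[of "x - z"]] by auto
      with pw
      have "1 / (t + norm (x - z)) powr (m + \<alpha>) \<le> (1 + ?D) powr (m + \<alpha>) / (t + norm (x - y)) powr (m + \<alpha>)"
        by (simp add: pos_divide_le_eq pos_le_divide_eq)
      from mult_left_mono[OF this, of "t powr \<alpha>"] show ?thesis by (simp add: poisson_def mult.commute)
    qed
    have "norm (s t x y - s t x z) \<le> norm (s t x y) + norm (s t x z)" by norm
    also have "\<dots> \<le> C\<^sub>s * ?P + C\<^sub>s * ((1 + ?D) powr (m + \<alpha>) * ?P)"
      using C_nonneg by (intro add_mono size[OF t] order.trans[OF size[OF t]] mult_left_mono[OF Pz])
    also have "\<dots> = C\<^sub>s * (1 + (1 + ?D) powr (m + \<alpha>)) * ?P * 1" by (simp add: algebra_simps)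
    also have "\<dots> \<le> C\<^sub>s * (1 + (1 + ?D) powr (m + \<alpha>)) * ?P * ((2 * ?D) powr \<alpha> * (l / t) powr \<alpha>)"
      using C_nonneg by (intro mult_left_mono one) auto
    also have "\<dots> = C\<^sub>s * (1 + (1 + ?D) powr (m + \<alpha>)) * (2 * ?D) powr \<alpha> * ((l / t) powr \<alpha> * ?P)"
      by (simp add: ac_simps)
    also have "\<dots> \<le> C\<^sub>R * ((l / t) powr \<alpha> * ?P)"
      using C_nonneg by (intro mult_right_mono) (auto simp: C\<^sub>R_def)
    finally show ?thesis by (simp add: mult.assoc)
  qed
qed

text \<open>The kernels are extended by zero to \<open>t \<le> 0\<close>, where the given function is arbitrary.\<close>

lemma measurable_kernel_ext:
  "(\<lambda>(t, x, y). if 0 < t then s t x y else 0) \<in> borel_measurable (borel \<Otimes>\<^sub>M borel \<Otimes>\<^sub>M borel)"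
proof -
  have "(\<lambda>p. indicat_real ({0<..} \<times> UNIV) p *\<^sub>R (case p of (t, x, y) \<Rightarrow> s t x y)) \<in> borel_measurable borel"
    using measurable_s unfolding kernel_measurable_def
    by (subst (asm) borel_measurable_restrict_space_iff) (auto simp: borel_Times)
  also have "(\<lambda>p. indicat_real ({0<..} \<times> UNIV) p *\<^sub>R (case p of (t, x, y) \<Rightarrow> s t x y))
      = (\<lambda>(t, x, y). if 0 < t then s t x y else 0)"
    by (auto simp: fun_eq_iff indicator_def)
  finally show ?thesis by (simp add: borel_prod)
qed

lemma kernel_ext_measurable [measurable (raw)]:
  assumes [measurable]: "f \<in> borel_measurable M" "g \<in> borel_measurable M" "h \<in> borel_measurable M"
  shows "(\<lambda>x. if 0 < f x then s (f x) (g x) (h x) else 0) \<in> borel_measurable M"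
  using measurable_compose[OF _ measurable_kernel_ext, of "\<lambda>x. (f x, g x, h x)" M] by simp

lemma kernel_measurable [measurable]: "0 < t \<Longrightarrow> s t x \<in> borel_measurable \<mu>"
proof -
  assume t: "0 < t"
  have "(\<lambda>y. if 0 < t then s t x y else 0) \<in> borel_measurable \<mu>" by measurable
  with t show ?thesis by simp
qed

lemma theta_measurable [measurable (raw)]:
  assumes [measurable]: "g \<in> borel_measurable \<mu>" "f \<in> borel_measurable M" "h \<in> borel_measurable M"
  shows "(\<lambda>p. if 0 < h p then theta \<mu> s (h p) g (f p) else 0) \<in> borel_measurable M"
proof -
  have "(\<lambda>p. LINT y|\<mu>. (if 0 < h p then s (h p) (f p) y else 0) * g y) \<in> borel_measurable M" by measurable
  also have "(\<lambda>p. LINT y|\<mu>. (if 0 < h p then s (h p) (f p) y else 0) * g y)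
      = (\<lambda>p. if 0 < h p then theta \<mu> s (h p) g (f p) else 0)"
    by (auto simp: theta_def fun_eq_iff)
  finally show ?thesis .
qed

lemma nn_integral_kernel_le:
  fixes g :: "real ^ 'n \<Rightarrow> complex"
  assumes t: "0 < t" and [measurable]: "h \<in> borel_measurable \<mu>" and g: "\<And>y. ennreal (norm (g y)) \<le> h y"
  shows "(\<integral>\<^sup>+y. ennreal (norm (s t x y * g y)) \<partial>\<mu>) \<le> ennreal C\<^sub>s * (\<integral>\<^sup>+y. ennreal (poisson m \<alpha> t x y) * h y \<partial>\<mu>)"
proof -
  have "ennreal (norm (s t x y * g y)) \<le> ennreal C\<^sub>s * (ennreal (poisson m \<alpha> t x y) * h y)" for y
  proof -
    have "ennreal (norm (s t x y * g y)) = ennreal (norm (s t x y)) * ennreal (norm (g y))"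
      by (simp add: norm_mult ennreal_mult)
    also have "\<dots> \<le> ennreal (C\<^sub>s * poisson m \<alpha> t x y) * h y"
      by (intro mult_mono g ennreal_leI size[OF t]) auto
    finally show ?thesis using C_nonneg by (simp add: ennreal_mult mult.assoc)
  qed
  then have "(\<integral>\<^sup>+y. ennreal (norm (s t x y * g y)) \<partial>\<mu>)
      \<le> (\<integral>\<^sup>+y. ennreal C\<^sub>s * (ennreal (poisson m \<alpha> t x y) * h y) \<partial>\<mu>)"
    by (rule nn_integral_mono)
  also have "\<dots> = ennreal C\<^sub>s * (\<integral>\<^sup>+y. ennreal (poisson m \<alpha> t x y) * h y \<partial>\<mu>)"
    by (rule nn_integral_cmult) measurable
  finally show ?thesis .
qed

lemma nn_integral_kernel_bounded:
  fixes g :: "real ^ 'n \<Rightarrow> complex"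
  assumes t: "0 < t" and g: "\<And>y. norm (g y) \<le> B"
  shows "(\<integral>\<^sup>+y. ennreal (norm (s t x y * g y)) \<partial>\<mu>) \<le> ennreal (C\<^sub>s * C\<^sub>P * B)"
proof -
  have B: "0 \<le> B" using g[of 0] norm_ge_zero order.trans by blast
  have "(\<integral>\<^sup>+y. ennreal (norm (s t x y * g y)) \<partial>\<mu>)
      \<le> ennreal C\<^sub>s * (\<integral>\<^sup>+y. ennreal (poisson m \<alpha> t x y) * ennreal B \<partial>\<mu>)"
    by (rule nn_integral_kernel_le[OF t]) (auto intro: ennreal_leI g)
  also have "\<dots> = ennreal C\<^sub>s * ((\<integral>\<^sup>+y. ennreal (poisson m \<alpha> t x y) \<partial>\<mu>) * ennreal B)"
    by (subst nn_integral_multc) auto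
  also have "\<dots> \<le> ennreal C\<^sub>s * (ennreal C\<^sub>P * ennreal B)"
    by (intro mult_left_mono mult_right_mono nn_integral_poisson_le t) auto
  also have "\<dots> = ennreal (C\<^sub>s * C\<^sub>P * B)"
    using C_nonneg C\<^sub>P_nonneg B by (simp add: ennreal_mult mult.assoc)
  finally show ?thesis .
qed

lemma integrable_kernel_bounded:
  fixes g :: "real ^ 'n \<Rightarrow> complex"
  assumes t: "0 < t" and [measurable]: "g \<in> borel_measurable \<mu>" and g: "\<And>y. norm (g y) \<le> B"
  shows "integrable \<mu> (\<lambda>y. s t x y * g y)"
  unfolding integrable_iff_bounded
proof
  have [measurable]: "s t x \<in> borel_measurable \<mu>" by (rule kernel_measurable[OF t])
  show "(\<lambda>y. s t x y * g y) \<in> borel_measurable \<mu>" by measurable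
  show "(\<integral>\<^sup>+y. ennreal (norm (s t x y * g y)) \<partial>\<mu>) < \<infinity>"
    using nn_integral_kernel_bounded[OF t g] by (rule le_less_trans) simp
qed

text \<open>If the integrand is not integrable, the Bochner integral on the left is \<open>0\<close>.\<close>

lemma norm_theta_le_nn_integral:
  "ennreal (norm (theta \<mu> s t g x)) \<le> (\<integral>\<^sup>+y. ennreal (norm (s t x y * g y)) \<partial>\<mu>)"
proof (cases "integrable \<mu> (\<lambda>y. s t x y * g y)")
  case True
  then show ?thesis unfolding theta_def by (rule integral_norm_bound_ennreal)
next
  case False
  then show ?thesis by (simp add: theta_def not_integrable_integral_eq)
qed

lemma norm_theta_bounded:
  fixes g :: "real ^ 'n \<Rightarrow> complex"
  assumes t: "0 < t" and g: "\<And>y. norm (g y) \<le> B"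
  shows "norm (theta \<mu> s t g x) \<le> C\<^sub>s * C\<^sub>P * B"
proof -
  have B: "0 \<le> B" using g[of 0] norm_ge_zero order.trans by blast
  have "ennreal (norm (theta \<mu> s t g x)) \<le> ennreal (C\<^sub>s * C\<^sub>P * B)"
    by (rule order.trans[OF norm_theta_le_nn_integral nn_integral_kernel_bounded[OF t g]])
  then show ?thesis using C_nonneg C\<^sub>P_nonneg B by (subst (asm) ennreal_le_iff) auto
qed

text \<open>From \<open>|g| \<le> 1 + |g|\<^sup>2\<close>: the kernel has finite mass and is bounded.\<close>

lemma nn_integral_poisson_square_finite:
  fixes g :: "real ^ 'n \<Rightarrow> complex"
  assumes t: "0 < t" and [measurable]: "g \<in> borel_measurable \<mu>" and sq: "L2_square \<mu> g < \<infinity>"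
  shows "(\<integral>\<^sup>+y. ennreal (poisson m \<alpha> t x y) * ennreal (norm (g y)) \<partial>\<mu>) < \<infinity>"
proof -
  let ?P = "poisson m \<alpha> t x" and ?T = "t powr (- m)"
  have le: "ennreal (norm (g y)) \<le> 1 + ennreal ((norm (g y))\<^sup>2)" for y
  proof -
    have "0 \<le> (norm (g y) - 1)\<^sup>2" by simp
    then have "2 * norm (g y) \<le> (norm (g y))\<^sup>2 + 1" by (simp add: power2_diff)
    then have "norm (g y) \<le> 1 + (norm (g y))\<^sup>2" using norm_ge_zero[of "g y"] by linarith
    then have "ennreal (norm (g y)) \<le> ennreal (1 + (norm (g y))\<^sup>2)" by (rule ennreal_leI)
    then show ?thesis by simp
  qed
  have "(\<integral>\<^sup>+y. ennreal (?P y) * ennreal (norm (g y)) \<partial>\<mu>) \<le> (\<integral>\<^sup>+y. ennreal (?P y) + ennreal ?T * ennreal ((norm (g y))\<^sup>2) \<partial>\<mu>)"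
  proof (rule nn_integral_mono)
    fix y
    have "ennreal (?P y) * ennreal (norm (g y)) \<le> ennreal (?P y) * (1 + ennreal ((norm (g y))\<^sup>2))"
      by (rule mult_left_mono[OF le]) simp
    also have "\<dots> = ennreal (?P y) + ennreal (?P y) * ennreal ((norm (g y))\<^sup>2)"
      by (simp add: distrib_left)
    also have "\<dots> \<le> ennreal (?P y) + ennreal ?T * ennreal ((norm (g y))\<^sup>2)"
      by (intro add_left_mono mult_right_mono ennreal_leI poisson_le_powr t m_pos \<alpha>_pos) simp
    finally show "ennreal (?P y) * ennreal (norm (g y)) \<le> ennreal (?P y) + ennreal ?T * ennreal ((norm (g y))\<^sup>2)" .
  qed
  also have "\<dots> = (\<integral>\<^sup>+y. ennreal (?P y) \<partial>\<mu>) + ennreal ?T * L2_square \<mu> g"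
    by (simp add: nn_integral_add nn_integral_cmult)
  also have "\<dots> < \<infinity>"
  proof -
    have "(\<integral>\<^sup>+y. ennreal (?P y) \<partial>\<mu>) < \<top>" using nn_integral_poisson_le[OF t, of x] by (rule le_less_trans) simp
    then show ?thesis using sq by (simp add: ennreal_mult_less_top)
  qed
  finally show ?thesis .
qed

lemma integrable_kernel_square:
  fixes g :: "real ^ 'n \<Rightarrow> complex"
  assumes t: "0 < t" and [measurable]: "g \<in> borel_measurable \<mu>" and sq: "L2_square \<mu> g < \<infinity>"
  shows "integrable \<mu> (\<lambda>y. s t x y * g y)"
  unfolding integrable_iff_bounded
proof
  have [measurable]: "s t x \<in> borel_measurable \<mu>" by (rule kernel_measurable[OF t])
  show "(\<lambda>y. s t x y * g y) \<in> borel_measurable \<mu>" by measurable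
  have "(\<integral>\<^sup>+y. ennreal (norm (s t x y * g y)) \<partial>\<mu>)
      \<le> ennreal C\<^sub>s * (\<integral>\<^sup>+y. ennreal (poisson m \<alpha> t x y) * ennreal (norm (g y)) \<partial>\<mu>)"
    by (rule nn_integral_kernel_le[OF t]) auto
  also have "\<dots> < \<infinity>"
    using nn_integral_poisson_square_finite[OF t _ sq] by (simp add: ennreal_mult_less_top)
  finally show "(\<integral>\<^sup>+y. ennreal (norm (s t x y * g y)) \<partial>\<mu>) < \<infinity>" .
qed

end

section \<open>Shifted dyadic grids\<close>

definition side :: "real \<Rightarrow> nat \<Rightarrow> real" where
  "side H j = H / 2 ^ j"

text \<open>The grid of level \<open>j\<close>, translated by \<open>\<tau>\<close> in every coordinate. A one-parameter family of shifts suffices, as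
  goodness is a condition on each coordinate separately.\<close>

definition grid_index :: "real \<Rightarrow> real \<Rightarrow> nat \<Rightarrow> real ^ 'n \<Rightarrow> 'n \<Rightarrow> int" where
  "grid_index \<tau> H j x = (\<lambda>e. \<lfloor>(x $ e - \<tau>) / side H j\<rfloor>)"

definition grid_center :: "real \<Rightarrow> real \<Rightarrow> nat \<Rightarrow> ('n \<Rightarrow> int) \<Rightarrow> real ^ 'n" where
  "grid_center \<tau> H j z = (\<chi> e. \<tau> + (real_of_int (z e) + 1 / 2) * side H j)"

lemma side_pos: "0 < H \<Longrightarrow> 0 < side H j" by (simp add: side_def)

lemma side_Suc: "side H j = 2 * side H (Suc j)" by (simp add: side_def)

lemma side_add: "side H (j + p) = side H j / 2 ^ p" by (simp add: side_def power_add)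

lemma mem_cube: "y \<in> cube c l \<longleftrightarrow> (\<forall>e. \<bar>y $ e - c $ e\<bar> \<le> l / 2)"
proof -
  have "c $ e - l / 2 \<le> y $ e \<and> y $ e \<le> c $ e + l / 2 \<longleftrightarrow> \<bar>y $ e - c $ e\<bar> \<le> l / 2" for e
    by linarith
  then show ?thesis by (simp only: cube_def mem_box_cart vec_lambda_beta)
qed

lemma mem_grid_cube:
  "y \<in> cube (grid_center \<tau> H j z) l \<longleftrightarrow> (\<forall>e. \<bar>y $ e - \<tau> - (real_of_int (z e) + 1 / 2) * side H j\<bar> \<le> l / 2)"
  by (simp add: mem_cube grid_center_def algebra_simps)

lemma grid_index_eq_iff:
  assumes "0 < H"
  shows "grid_index \<tau> H j x = z \<longleftrightarrow>
    (\<forall>e. real_of_int (z e) * side H j \<le> x $ e - \<tau> \<and> x $ e - \<tau> < (real_of_int (z e) + 1) * side H j)"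
proof -
  have "\<lfloor>u / side H j\<rfloor> = k \<longleftrightarrow> real_of_int k * side H j \<le> u \<and> u < (real_of_int k + 1) * side H j" for u k
    using side_pos[OF assms, of j] by (simp add: floor_eq_iff pos_le_divide_eq pos_divide_less_eq)
  then show ?thesis by (auto simp: grid_index_def fun_eq_iff)
qed

lemma grid_cell_subset_cube:
  assumes "0 < H" "grid_index \<tau> H j x = z"
  shows "x \<in> cube (grid_center \<tau> H j z) (side H j)"
  using assms(2) unfolding grid_index_eq_iff[OF assms(1)] mem_grid_cube
  by (auto simp: abs_le_iff algebra_simps) (smt (verit) field_sum_of_halves)+

lemma grid_index_component_dist:
  assumes "0 < H" "grid_index \<tau> H j x = grid_index \<tau> H j y"
  shows "\<bar>x $ e - y $ e\<bar> < side H j"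
proof -
  have "real_of_int (grid_index \<tau> H j y e) * side H j \<le> x $ e - \<tau>"
    "x $ e - \<tau> < (real_of_int (grid_index \<tau> H j y e) + 1) * side H j"
    using assms(2) grid_index_eq_iff[OF assms(1), of \<tau> j x "grid_index \<tau> H j y"] by auto
  moreover have "real_of_int (grid_index \<tau> H j y e) * side H j \<le> y $ e - \<tau>"
    "y $ e - \<tau> < (real_of_int (grid_index \<tau> H j y e) + 1) * side H j"
    using grid_index_eq_iff[OF assms(1), of \<tau> j y "grid_index \<tau> H j y"] by auto
  ultimately show ?thesis by (simp add: abs_less_iff algebra_simps)
qed

lemma norm_le_card_component:
  fixes x :: "real ^ 'n"
  assumes "\<And>e. \<bar>x $ e\<bar> \<le> r"
  shows "norm x \<le> real CARD('n) * r"
proof -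
  have "norm x \<le> (\<Sum>e\<in>UNIV. \<bar>x $ e\<bar>)" by (rule norm_le_l1_cart)
  also have "\<dots> \<le> (\<Sum>e\<in>(UNIV :: 'n set). r)" by (rule sum_mono) (rule assms)
  finally show ?thesis by simp
qed

lemma grid_index_nested:
  fixes x y :: "real ^ 'n"
  assumes "0 < H" "grid_index \<tau> H (Suc j) x = grid_index \<tau> H (Suc j) y"
  shows "grid_index \<tau> H j x = grid_index \<tau> H j y"
proof
  fix e
  have half: "\<lfloor>u / 2\<rfloor> = \<lfloor>u\<rfloor> div 2" for u :: real
    using floor_divide_real_eq_div[of 2 u] by simp
  have "(x $ e - \<tau>) / side H j = (x $ e - \<tau>) / side H (Suc j) / 2" for x :: "real ^ 'n"
    by (simp add: side_Suc[of H j])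
  then have "grid_index \<tau> H j x e = grid_index \<tau> H (Suc j) x e div 2" for x :: "real ^ 'n"
    by (simp only: grid_index_def half)
  with assms(2) show "grid_index \<tau> H j x e = grid_index \<tau> H j y e" by metis
qed

text \<open>All hyperplanes of the levels up to \<open>k\<close> are at a distance from \<open>x\<close> that is not too small relative to the
  side of their level, with a condition that relaxes geometrically towards the coarse levels.\<close>

definition good_point :: "real \<Rightarrow> real \<Rightarrow> real \<Rightarrow> real \<Rightarrow> nat \<Rightarrow> real ^ 'n \<Rightarrow> bool" where
  "good_point c r \<tau> H k x \<longleftrightarrow>
    (\<forall>i\<le>k. \<forall>e. \<forall>z::int. c * r ^ (k - i) * side H i \<le> \<bar>x $ e - \<tau> - real_of_int z * side H i\<bar>)"

context kernel_family begin

abbreviation \<rho> :: real where "\<rho> \<equiv> good_ratio m \<alpha>"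

text \<open>The numerical factor is chosen in view of \<open>bad_shifts_small\<close>: the bad shifts of each coordinate and level
  have measure at most \<open>8 c\<^sub>0 \<rho> ^ (k - i) H\<close>, and these bounds must sum to at most \<open>H / 2\<close>.\<close>

definition c\<^sub>0 :: real where "c\<^sub>0 = (1 - \<rho>) / (20 * real CARD('n))"

lemma \<rho>: "0 < \<rho>" "\<rho> < 1" "1 / 2 \<le> \<rho>"
  using good_ratio_pos good_ratio_less_1[OF m_pos \<alpha>_pos] good_ratio_ge_half[OF m_pos \<alpha>_pos] by auto

lemma c\<^sub>0: "0 < c\<^sub>0" "c\<^sub>0 \<le> 1"
proof -
  have "1 \<le> real CARD('n)" by (simp add: Suc_leI)
  then have "1 - \<rho> \<le> 20 * real CARD('n)" "0 < 20 * real CARD('n)" using \<rho> by linarith+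
  then show "0 < c\<^sub>0" "c\<^sub>0 \<le> 1" using \<rho> by (auto simp: c\<^sub>0_def divide_le_eq_1)
qed

end

locale dyadic_grid = kernel_family +
  fixes \<tau> H :: real
  assumes H_pos: "0 < H"
begin

lemma grid_class_measurable: "{x. grid_index \<tau> H j x = z} \<in> sets \<mu>"
  unfolding grid_index_eq_iff[OF H_pos] sets_\<mu>
  by measurable

lemma grid_partition: "nested_partition \<mu> (grid_index \<tau> H)"
proof
  show "space \<mu> = UNIV" by simp
next
  fix j
  show "grid_index \<tau> H j \<in> measurable \<mu> (count_space UNIV)"
    by (subst measurable_count_space_eq_countable)
       (use grid_class_measurable[of j] in \<open>auto simp: vimage_def\<close>)
next
  fix j and x y :: "real ^ 'a"
  show "grid_index \<tau> H (Suc j) x = grid_index \<tau> H (Suc j) y \<Longrightarrow> grid_index \<tau> H j x = grid_index \<tau> H j y"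
    by (rule grid_index_nested[OF H_pos])
next
  fix j and z :: "'a \<Rightarrow> int"
  have "bounded {y. grid_index \<tau> H j y = z}"
    by (rule bounded_subset[of "cube (grid_center \<tau> H j z) (side H j)"])
       (auto simp: cube_def intro: grid_cell_subset_cube[OF H_pos, unfolded cube_def])
  then show "emeasure \<mu> {y. grid_index \<tau> H j y = z} < \<infinity>" by (rule emeasure_bounded_finite)
qed

sublocale nested_partition \<mu> "grid_index \<tau> H" by (rule grid_partition)

lemma dist_in_cell:
  assumes "y \<in> cell j x" "y' \<in> cell j x"
  shows "norm (y - y') \<le> diam_const * side H j"
  unfolding diam_const_def
  by (rule norm_le_card_component)
     (use grid_index_component_dist[OF H_pos, of \<tau> j y y'] assms in \<open>simp add: in_cell_iff less_imp_le\<close>)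

lemma infdist_complement_le: "infdist x (- cell j x) \<le> side H j" and complement_nonempty: "- cell j x \<noteq> {}"
proof -
  obtain e :: 'a where True by blast
  define y where "y = x + side H j *\<^sub>R axis e 1"
  have "\<bar>y $ e - x $ e\<bar> = side H j" using side_pos[OF H_pos, of j] by (simp add: y_def)
  then have y: "y \<in> - cell j x"
    using grid_index_component_dist[OF H_pos, of \<tau> j y x e] by (auto simp: in_cell_iff)
  have "dist x y = side H j" using side_pos[OF H_pos, of j] by (simp add: y_def dist_norm norm_Basis)
  with y show "infdist x (- cell j x) \<le> side H j" by (metis infdist_le)
  from y show "- cell j x \<noteq> {}" by blast
qed

lemma infdist_complement_lipschitz: "\<bar>infdist x (- cell j u) - infdist y (- cell j u)\<bar> \<le> norm (x - y)"
  using infdist_triangle[of x "- cell j u" y] infdist_triangle[of y "- cell j u" x]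
  by (simp add: dist_norm norm_minus_commute)

definition good :: "nat \<Rightarrow> real ^ 'a \<Rightarrow> bool" where
  "good k x \<longleftrightarrow> good_point c\<^sub>0 \<rho> \<tau> H k x"

lemma good_measurable [measurable]: "Measurable.pred \<mu> (good k)"
  unfolding good_def good_point_def by measurable

text \<open>If \<open>y\<close> lies outside the cell, a hyperplane of the grid separates \<open>x\<close> and \<open>y\<close> in some coordinate.\<close>

lemma good_far_from_complement:
  assumes good: "good k x" and "i \<le> k" and y: "y \<notin> cell i x"
  shows "c\<^sub>0 * \<rho> ^ (k - i) * side H i \<le> norm (x - y)"
proof -
  have gi: "c\<^sub>0 * \<rho> ^ (k - i) * side H i \<le> \<bar>x $ e - \<tau> - real_of_int z * side H i\<bar>" for e z
    using good \<open>i \<le> k\<close> by (simp add: good_def good_point_def)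
  define zx zy where "zx = grid_index \<tau> H i x" and "zy = grid_index \<tau> H i y"
  from y have "zx \<noteq> zy" by (simp add: in_cell_iff zx_def zy_def)
  then obtain e where e: "zx e \<noteq> zy e" by (auto simp: fun_eq_iff)
  let ?l = "side H i"
  have l: "0 < ?l" by (rule side_pos[OF H_pos])
  have X: "real_of_int (zx e) * ?l \<le> x $ e - \<tau>" "x $ e - \<tau> < (real_of_int (zx e) + 1) * ?l"
    using grid_index_eq_iff[OF H_pos, of \<tau> i x zx] by (auto simp: zx_def)
  have Y: "real_of_int (zy e) * ?l \<le> y $ e - \<tau>" "y $ e - \<tau> < (real_of_int (zy e) + 1) * ?l"
    using grid_index_eq_iff[OF H_pos, of \<tau> i y zy] by (auto simp: zy_def)
  have "c\<^sub>0 * \<rho> ^ (k - i) * ?l \<le> \<bar>x $ e - y $ e\<bar>"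
  proof (cases "zx e < zy e")
    case True
    then have "real_of_int (zx e) + 1 \<le> real_of_int (zy e)" by linarith
    then have "(real_of_int (zx e) + 1) * ?l \<le> real_of_int (zy e) * ?l" using l by (intro mult_right_mono) auto
    then show ?thesis using gi[of e "zy e"] X Y by linarith
  next
    case False
    then have "real_of_int (zy e) + 1 \<le> real_of_int (zx e)" using e by linarith
    then have "(real_of_int (zy e) + 1) * ?l \<le> real_of_int (zx e) * ?l" using l by (intro mult_right_mono) auto
    then show ?thesis using gi[of e "zx e"] X Y by linarith
  qed
  also have "\<dots> \<le> norm (x - y)" using component_le_norm_cart[of "x - y" e] by simp
  finally show ?thesis .
qed

lemma good_infdist:
  assumes "good k x" "j \<le> k"
  shows "c\<^sub>0 * \<rho> ^ (k - j) * side H j \<le> infdist x (- cell j x)"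
  using good_far_from_complement[OF assms] complement_nonempty[of j x]
  by (simp add: infdist_def) (auto intro!: cINF_greatest simp: dist_norm)

end

section \<open>Whitney cubes and the testing condition\<close>

text \<open>In each coordinate, at most four grid intervals have a closed triple that contains a given number.\<close>

lemma card_grid_neighbours:
  fixes y :: "real ^ 'n"
  assumes H: "0 < H"
  shows "finite {z. y \<in> cube (grid_center \<tau> H j z) (3 * side H j)}"
    and "card {z. y \<in> cube (grid_center \<tau> H j z) (3 * side H j)} \<le> 4 ^ CARD('n)"
proof -
  let ?l = "side H j"
  have l: "0 < ?l" by (rule side_pos[OF H])
  let ?B = "\<lambda>e. {\<lfloor>(y $ e - \<tau>) / ?l\<rfloor> - 2 .. \<lfloor>(y $ e - \<tau>) / ?l\<rfloor> + 1}"
  have sub: "{z. y \<in> cube (grid_center \<tau> H j z) (3 * ?l)} \<subseteq> PiE UNIV ?B"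
  proof
    fix z assume "z \<in> {z. y \<in> cube (grid_center \<tau> H j z) (3 * ?l)}"
    then have z: "\<bar>y $ e - \<tau> - (real_of_int (z e) + 1 / 2) * ?l\<bar> \<le> 3 * ?l / 2" for e
      by (simp add: mem_grid_cube)
    have "z e \<in> ?B e" for e
    proof -
      define u where "u = (y $ e - \<tau>) / ?l"
      have "y $ e - \<tau> = u * ?l" using l by (simp add: u_def)
      then have "\<bar>(u - (real_of_int (z e) + 1 / 2)) * ?l\<bar> \<le> (3 / 2) * ?l"
        using z[of e] by (simp add: left_diff_distrib)
      then have "\<bar>u - (real_of_int (z e) + 1 / 2)\<bar> \<le> 3 / 2" using l by (simp add: abs_mult)
      then show ?thesis unfolding u_def[symmetric] by (simp; linarith)
    qed
    then show "z \<in> PiE UNIV ?B" by (simp add: PiE_iff extensional_def)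
  qed
  have fin: "finite (PiE UNIV ?B)" by (rule finite_PiE) auto
  show "finite {z. y \<in> cube (grid_center \<tau> H j z) (3 * ?l)}" by (rule finite_subset[OF sub fin])
  have "card {z. y \<in> cube (grid_center \<tau> H j z) (3 * ?l)} \<le> card (PiE UNIV ?B)" by (rule card_mono[OF fin sub])
  also have "\<dots> = (\<Prod>e\<in>(UNIV :: 'n set). card (?B e))" by (rule card_PiE) simp
  also have "\<dots> = 4 ^ CARD('n)" by simp
  finally show "card {z. y \<in> cube (grid_center \<tau> H j z) (3 * ?l)} \<le> 4 ^ CARD('n)" .
qed

context kernel_family begin

text \<open>The integrand of the square function with respect to \<open>d\<mu> dt\<close>.\<close>

definition square_density :: "(real ^ 'n \<Rightarrow> complex) \<Rightarrow> real ^ 'n \<Rightarrow> real \<Rightarrow> ennreal" where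
  "square_density g x t = (if 0 < t then ennreal ((norm (theta \<mu> s t g x))\<^sup>2 / t) else 0)"

lemma square_density_measurable [measurable (raw)]:
  assumes [measurable]: "g \<in> borel_measurable \<mu>" "f \<in> borel_measurable M" "h \<in> borel_measurable M"
  shows "(\<lambda>p. square_density g (f p) (h p)) \<in> borel_measurable M"
proof -
  have "(\<lambda>p. if 0 < h p then ennreal ((norm (if 0 < h p then theta \<mu> s (h p) g (f p) else 0))\<^sup>2 / h p) else 0)
      \<in> borel_measurable M" by measurable
  also have "(\<lambda>p. if 0 < h p then ennreal ((norm (if 0 < h p then theta \<mu> s (h p) g (f p) else 0))\<^sup>2 / h p) else 0)
      = (\<lambda>p. square_density g (f p) (h p))" by (auto simp: square_density_def)
  finally show ?thesis .
qed

text \<open>Removes the restriction of the testing condition to \<open>t < l\<close>: in the range from \<open>l\<close> to \<open>T l\<close> the bound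
  for \<open>|\<theta>\<^sub>t g|\<close> is enough.\<close>

lemma square_density_bounded_tail:
  assumes g: "\<And>y. norm (g y) \<le> K" and l: "0 < l" and T: "1 \<le> T"
  shows "(\<integral>\<^sup>+t\<in>{l..<T * l}. square_density g x t \<partial>lborel) \<le> ennreal ((C\<^sub>s * C\<^sub>P * K)\<^sup>2 * T)"
proof -
  let ?B = "(C\<^sub>s * C\<^sub>P * K)\<^sup>2"
  have "(\<integral>\<^sup>+t\<in>{l..<T * l}. square_density g x t \<partial>lborel) \<le> (\<integral>\<^sup>+t\<in>{l..<T * l}. ennreal (?B / l) \<partial>lborel)"
  proof (rule nn_integral_mono)
    fix t
    have "square_density g x t \<le> ennreal (?B / l)" if t: "l \<le> t"
    proof -
      have t0: "0 < t" using l t by simp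
      have "(norm (theta \<mu> s t g x))\<^sup>2 \<le> ?B"
        by (rule power_mono[OF norm_theta_bounded[OF t0 g]]) simp
      then have "(norm (theta \<mu> s t g x))\<^sup>2 / t \<le> ?B / l"
        by (rule frac_le[rotated]) (use l t in auto)
      then show ?thesis using t0 by (simp add: square_density_def ennreal_leI)
    qed
    then show "square_density g x t * indicator {l..<T * l} t \<le> ennreal (?B / l) * indicator {l..<T * l} t"
      by (auto simp: indicator_def)
  qed
  also have "\<dots> = ennreal (?B / l) * ennreal (T * l - l)"
    using l T by (simp add: nn_integral_cmult_indicator)
  also have "\<dots> = ennreal (?B / l * (T * l - l))"
    using l mult_right_mono[OF T, of l] by (intro ennreal_mult[symmetric]) auto
  also have "?B / l * (T * l - l) = ?B * (T - 1)" using l by (simp add: field_simps)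
  also have "ennreal \<dots> \<le> ennreal (?B * T)" by (intro ennreal_leI mult_left_mono) auto
  finally show ?thesis .
qed

end

context dyadic_grid begin

text \<open>The part of the square function of \<open>g\<close> at scale \<open>k\<close>, restricted to the good points.\<close>

definition good_part :: "(real ^ 'a \<Rightarrow> complex) \<Rightarrow> nat \<Rightarrow> real ^ 'a \<Rightarrow> ennreal" where
  "good_part g k x = (if good k x then \<integral>\<^sup>+t\<in>{side H k..<2 * side H k}. square_density g x t \<partial>lborel else 0)"

lemma good_part_measurable [measurable]:
  assumes [measurable]: "g \<in> borel_measurable \<mu>"
  shows "good_part g k \<in> borel_measurable \<mu>"
  unfolding good_part_def by measurable

definition T\<^sub>W :: real where "T\<^sub>W = 2 * 2 ^ (8 * CARD('a)) / c\<^sub>0"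

text \<open>If a point at distance at most \<open>2\<^bsup>-p\<^esup> side H j\<close> from the complement of its cell is good at level \<open>k\<close>, then \<open>t\<close> is
  at most a constant times this distance. The constant is absorbed in \<open>T\<^sub>W\<close>; the side length is that of
  \<open>8 CARD('a)\<close> further levels down, which is the size of the Whitney cubes below.\<close>

lemma sum_good_part_le:
  fixes x :: "real ^ 'a"
  assumes x: "infdist x (- cell j x) \<le> side H j / 2 ^ p" and g: "g \<in> borel_measurable \<mu>"
  shows "(\<Sum>k\<in>{j..<N}. good_part g k x)
    \<le> (\<integral>\<^sup>+t\<in>{0<..<T\<^sub>W * side H (j + p + 8 * CARD('a))}. square_density g x t \<partial>lborel)"
proof -
  note [measurable] = g
  let ?U = "T\<^sub>W * side H (j + p + 8 * CARD('a))"
  have U: "?U = 2 * (side H j / 2 ^ p) / c\<^sub>0"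
    by (simp add: T\<^sub>W_def side_def power_add)
  have J: "{side H k..<2 * side H k} \<subseteq> {0<..<?U}" if "good k x" "j \<le> k" for k
  proof -
    have far: "c\<^sub>0 * \<rho> ^ (k - j) * side H j \<le> infdist x (- cell j x)"
      by (rule good_infdist[OF that])
    have "(1 / 2) ^ (k - j) \<le> \<rho> ^ (k - j)" by (rule power_mono[OF \<rho>(3)]) simp
    then have "c\<^sub>0 * (1 / 2) ^ (k - j) * side H j \<le> c\<^sub>0 * \<rho> ^ (k - j) * side H j"
      using c\<^sub>0 side_pos[OF H_pos, of j] by (intro mult_left_mono mult_right_mono) auto
    also have "\<dots> \<le> side H j / 2 ^ p" using far x by linarith
    finally have "c\<^sub>0 * side H k \<le> side H j / 2 ^ p"
      using side_add[of H j "k - j"] \<open>j \<le> k\<close> by (simp add: power_one_over mult.assoc)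
    then have "2 * side H k \<le> ?U" unfolding U using c\<^sub>0 by (simp add: field_simps)
    then show ?thesis using side_pos[OF H_pos, of k] by auto
  qed
  have dis: "{side H k..<2 * side H k} \<inter> {side H k'..<2 * side H k'} = {}" if "k < k'" for k k'
  proof -
    have "Suc k \<le> k'" using that by simp
    have "side H k' \<le> side H (Suc k)"
      using \<open>Suc k \<le> k'\<close> H_pos unfolding side_def by (intro divide_left_mono power_increasing) auto
    then show ?thesis using side_Suc[of H k] by auto
  qed
  have one: "good_part g k x \<le> (\<integral>\<^sup>+t. square_density g x t * indicator ({side H k..<2 * side H k} \<inter> {0<..<?U}) t \<partial>lborel)"
    if "k \<in> {j..<N}" for k
  proof (cases "good k x")
    case True
    then show ?thesis using J[of k] that by (simp add: good_part_def Int_absorb2)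
  qed (simp add: good_part_def)
  have "(\<Sum>k\<in>{j..<N}. good_part g k x)
      \<le> (\<Sum>k\<in>{j..<N}. \<integral>\<^sup>+t. square_density g x t * indicator ({side H k..<2 * side H k} \<inter> {0<..<?U}) t \<partial>lborel)"
    by (rule sum_mono[OF one])
  also have "\<dots> = (\<integral>\<^sup>+t. (\<Sum>k\<in>{j..<N}. square_density g x t * indicator ({side H k..<2 * side H k} \<inter> {0<..<?U}) t) \<partial>lborel)"
    by (rule nn_integral_sum[symmetric]) measurable
  also have "\<dots> \<le> (\<integral>\<^sup>+t\<in>{0<..<?U}. square_density g x t \<partial>lborel)"
  proof (rule nn_integral_mono)
    fix t
    have "(\<Sum>k\<in>{j..<N}. indicator ({side H k..<2 * side H k} \<inter> {0<..<?U}) t :: ennreal)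
        = indicator (\<Union>k\<in>{j..<N}. {side H k..<2 * side H k} \<inter> {0<..<?U}) t"
    proof (rule indicator_UN_disjoint[symmetric])
      show "disjoint_family_on (\<lambda>k. {side H k..<2 * side H k} \<inter> {0<..<?U}) {j..<N}"
        unfolding disjoint_family_on_def
      proof (intro ballI impI)
        fix k k' :: nat assume "k \<noteq> k'"
        then have "{side H k..<2 * side H k} \<inter> {side H k'..<2 * side H k'} = {}"
          using dis[of k k'] dis[of k' k] by (cases "k < k'") auto
        then show "({side H k..<2 * side H k} \<inter> {0<..<?U}) \<inter> ({side H k'..<2 * side H k'} \<inter> {0<..<?U}) = {}" by blast
      qed
    qed simp
    also have "\<dots> \<le> indicator {0<..<?U} t" by (auto simp: indicator_def)
    finally show "(\<Sum>k\<in>{j..<N}. square_density g x t * indicator ({side H k..<2 * side H k} \<inter> {0<..<?U}) t)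
        \<le> square_density g x t * indicator {0<..<?U} t"
      unfolding sum_distrib_left[symmetric] by (rule mult_left_mono) simp
  qed
  finally show ?thesis .
qed


text \<open>\<open>I\<close> consists of the Whitney cubes of the cell: the layer number \<open>p\<close> says that the distance to the complement
  lies between \<open>2\<^bsup>-p-1\<^esup>\<close> and \<open>2\<^bsup>-p\<^esup>\<close> times the side, and the label \<open>z\<close> names a cube of a much smaller
  side. The triple of such a cube meets only the neighbouring layers, so a point \<open>y\<close> lies in the triples of
  cubes from at most three layers, and in each layer from at most \<open>4 ^ CARD('a)\<close> cubes. Going down
  \<open>8 CARD('a)\<close> levels makes the cubes small enough because \<open>8 n \<le> 2\<^bsup>8 n\<^esup>\<close>.\<close>

lemma whitney_count:
  fixes y u :: "real ^ 'a" and j :: nat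
  defines "I \<equiv> {(p, z). \<exists>x\<in>cell j u. side H j / 2 ^ Suc p < infdist x (- cell j u) \<and> infdist x (- cell j u) \<le> side H j / 2 ^ p
      \<and> grid_index \<tau> H (j + p + 8 * CARD('a)) x = z}"
    and "S \<equiv> \<lambda>(p, z). cube (grid_center \<tau> H (j + p + 8 * CARD('a)) z) (3 * side H (j + p + 8 * CARD('a)))"
  shows "(\<integral>\<^sup>+q. indicator I q * indicator (S q) y \<partial>count_space UNIV) \<le> ennreal (3 * 4 ^ CARD('a)) * indicator (cell j u) y"
proof -
  let ?n = "8 * CARD('a)" and ?L = "side H j" and ?d = "\<lambda>y. infdist y (- cell j u)"
  have L: "0 < ?L" by (rule side_pos[OF H_pos])
  define A where "A = {q \<in> I. y \<in> S q}"
  \<comment> \<open>The dilated cube of a pair in \<open>I\<close> is so small that it stays in the neighbouring layers.\<close>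
  have layer: "?L / 2 ^ (p + 2) < ?d y" "?d y \<le> 2 * (?L / 2 ^ p)" if "(p, z) \<in> A" for p z
  proof -
    from that obtain x where x: "?L / 2 ^ Suc p < ?d x" "?d x \<le> ?L / 2 ^ p" "grid_index \<tau> H (j + p + ?n) x = z"
      and y: "y \<in> cube (grid_center \<tau> H (j + p + ?n) z) (3 * side H (j + p + ?n))"
      by (auto simp: A_def I_def S_def)
    let ?l = "side H (j + p + ?n)"
    have "\<bar>(y - x) $ e\<bar> \<le> 2 * ?l" for e
    proof -
      have "\<bar>y $ e - \<tau> - (real_of_int (z e) + 1 / 2) * ?l\<bar> \<le> 3 * ?l / 2" using y by (simp add: mem_grid_cube)
      moreover have "\<bar>x $ e - \<tau> - (real_of_int (z e) + 1 / 2) * ?l\<bar> \<le> ?l / 2"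
        using grid_cell_subset_cube[OF H_pos x(3)] by (simp add: mem_grid_cube)
      ultimately show ?thesis unfolding vector_minus_component by linarith
    qed
    then have "norm (y - x) \<le> real CARD('a) * (2 * ?l)" by (rule norm_le_card_component)
    also have "\<dots> \<le> ?L / 2 ^ (p + 2)"
    proof -
      have "real (8 * CARD('a)) \<le> 2 ^ ?n" by (rule of_nat_less_two_power[THEN less_imp_le])
      then have "8 * real CARD('a) * ?L \<le> 2 ^ ?n * ?L" using L by (intro mult_right_mono) auto
      then show ?thesis unfolding side_add by (simp add: field_simps power_add)
    qed
    finally have "\<bar>?d y - ?d x\<bar> \<le> ?L / 2 ^ (p + 2)"
      using infdist_complement_lipschitz[of y j u x] by linarith
    moreover have "?L / 2 ^ Suc p = 2 * (?L / 2 ^ (p + 2))" "?L / 2 ^ p = 4 * (?L / 2 ^ (p + 2))" by (auto simp: field_simps)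
    ultimately show "?L / 2 ^ (p + 2) < ?d y" "?d y \<le> 2 * (?L / 2 ^ p)"
      using x(1,2) divide_pos_pos[OF L, of "2 ^ (p + 2)"] by linarith+
  qed
  show ?thesis
  proof (cases "A = {}")
    case True
    have z: "indicator I q * indicator (S q) y = (0 :: ennreal)" for q
    proof -
      have "q \<notin> A" using True by simp
      then show ?thesis unfolding A_def by (simp add: indicator_def)
    qed
    show ?thesis unfolding z by simp
  next
    case False
    define p0 where "p0 = (LEAST p. \<exists>z. (p, z) \<in> A)"
    have "\<exists>p z. (p, z) \<in> A" using False by auto
    then have "\<exists>z. (p0, z) \<in> A" unfolding p0_def by (rule LeastI_ex)
    then obtain z0 where z0: "(p0, z0) \<in> A" ..
    have p0: "p0 \<le> p" if "(p, z) \<in> A" for p z unfolding p0_def by (rule Least_le) (use that in blast)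
    have p2: "p \<le> p0 + 2" if "(p, z) \<in> A" for p z
    proof (rule ccontr)
      assume "\<not> p \<le> p0 + 2"
      then have "p0 + 3 \<le> p" by simp
      then have "2 * (?L / 2 ^ p) \<le> 2 * (?L / 2 ^ (p0 + 3))"
        using L by (intro mult_left_mono divide_left_mono power_increasing) auto
      also have "\<dots> = ?L / 2 ^ (p0 + 2)" by (simp add: field_simps power_add)
      also have "\<dots> < ?d y" by (rule layer(1)[OF z0])
      finally show False using layer(2)[OF that] by simp
    qed
    define B where "B p = {z. y \<in> cube (grid_center \<tau> H (j + p + ?n) z) (3 * side H (j + p + ?n))}" for p
    have sub: "A \<subseteq> Sigma {p0..p0 + 2} B" using p0 p2 by (auto simp: A_def S_def B_def)
    have fin: "finite (Sigma {p0..p0 + 2} B)"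
      unfolding B_def by (intro finite_SigmaI card_grid_neighbours(1)[OF H_pos]) simp
    have "card A \<le> card (Sigma {p0..p0 + 2} B)" by (rule card_mono[OF fin sub])
    also have "\<dots> = (\<Sum>p\<in>{p0..p0 + 2}. card (B p))"
      by (rule card_SigmaI) (auto simp: B_def card_grid_neighbours(1)[OF H_pos])
    also have "\<dots> \<le> (\<Sum>p\<in>{p0..p0 + 2}. 4 ^ CARD('a))"
      unfolding B_def by (rule sum_mono) (rule card_grid_neighbours(2)[OF H_pos])
    also have "\<dots> = 3 * 4 ^ CARD('a)" by simp
    finally have card: "card A \<le> 3 * 4 ^ CARD('a)" .
    have yQ: "y \<in> cell j u"
    proof (rule ccontr)
      assume "y \<notin> cell j u"
      then have "?d y = 0" by simp
      with layer(1)[OF z0] divide_pos_pos[OF L, of "2 ^ (p0 + 2)"] show False by simp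
    qed
    have "(\<integral>\<^sup>+q. indicator I q * indicator (S q) y \<partial>count_space UNIV) = (\<integral>\<^sup>+q. indicator A q \<partial>count_space UNIV)"
      by (rule nn_integral_cong) (auto simp: A_def indicator_def)
    also have "\<dots> = ennreal (real (card A))"
      using finite_subset[OF sub fin] by (simp add: emeasure_count_space_finite ennreal_of_nat_eq_real_of_nat)
    also have "\<dots> \<le> ennreal (3 * 4 ^ CARD('a))"
      using of_nat_mono[OF card, where 'a = real] by (intro ennreal_leI) simp
    finally show ?thesis using yQ by simp
  qed
qed

definition whitney_const :: "real \<Rightarrow> real \<Rightarrow> real" where
  "whitney_const K C = 3 * 4 ^ CARD('a) * (C + (C\<^sub>s * C\<^sub>P * K)\<^sup>2 * T\<^sub>W)"

lemma T\<^sub>W_ge_1: "1 \<le> T\<^sub>W"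
proof -
  have "1 \<le> 2 * 2 ^ (8 * CARD('a)) / (1 :: real)" by (simp add: one_le_power order.trans[of 1 "2 ^ (8 * CARD('a))"])
  also have "\<dots> \<le> 2 * 2 ^ (8 * CARD('a)) / c\<^sub>0" using c\<^sub>0 by (intro divide_left_mono) auto
  finally show ?thesis by (simp add: T\<^sub>W_def)
qed

text \<open>Cover the good points of the cell by Whitney cubes. Over each of them the testing condition bounds the box up to
  the side of the cube, and \<open>square_density_bounded_tail\<close> the rest. The resulting sum of the measures of the
  triples is at most a multiple of the measure of the cell by \<open>whitney_count\<close>.\<close>

lemma whitney_packing:
  fixes u :: "real ^ 'a" and g :: "real ^ 'a \<Rightarrow> complex"
  assumes g [measurable]: "g \<in> borel_measurable \<mu>" and gK: "\<And>y. norm (g y) \<le> K" and C: "0 \<le> C"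
    and test: "\<And>c l. 0 < l \<Longrightarrow> (\<integral>\<^sup>+x\<in>cube c l. (\<integral>\<^sup>+t\<in>{0<..<l}. square_density g x t \<partial>lborel) \<partial>\<mu>) \<le> ennreal C * emeasure \<mu> (cube c (3 * l))"
  shows "(\<integral>\<^sup>+x\<in>cell j u. (\<Sum>k\<in>{j..<N}. good_part g k x) \<partial>\<mu>) \<le> ennreal (whitney_const K C) * emeasure \<mu> (cell j u)"
proof -
  let ?n = "8 * CARD('a)" and ?L = "side H j" and ?d = "\<lambda>y. infdist y (- cell j u)"
  define B where "B = (C\<^sub>s * C\<^sub>P * K)\<^sup>2 * T\<^sub>W"
  have B: "0 \<le> B" using T\<^sub>W_ge_1 by (simp add: B_def)
  define I where "I = {(p, z). \<exists>x\<in>cell j u. ?L / 2 ^ Suc p < ?d x \<and> ?d x \<le> ?L / 2 ^ p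
      \<and> grid_index \<tau> H (j + p + ?n) x = z}"
  define Q1 :: "nat \<times> ('a \<Rightarrow> int) \<Rightarrow> (real ^ 'a) set" where "Q1 = (\<lambda>(p, z). cube (grid_center \<tau> H (j + p + ?n) z) (side H (j + p + ?n)))"
  define S :: "nat \<times> ('a \<Rightarrow> int) \<Rightarrow> (real ^ 'a) set" where "S = (\<lambda>(p, z). cube (grid_center \<tau> H (j + p + ?n) z) (3 * side H (j + p + ?n)))"
  define \<Phi> where "\<Phi> q x = (\<integral>\<^sup>+t\<in>{0<..<T\<^sub>W * side H (j + fst q + ?n)}. square_density g x t \<partial>lborel)"
    for q :: "nat \<times> ('a \<Rightarrow> int)" and x
  have [measurable]: "\<Phi> q \<in> borel_measurable \<mu>" for q unfolding \<Phi>_def by measurable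
  have Qm [measurable]: "Q1 q \<in> sets \<mu>" "S q \<in> sets \<mu>" for q
    by (auto simp: Q1_def S_def cube_def split: prod.splits)
  have pt: "(\<Sum>k\<in>{j..<N}. good_part g k x) * indicator (cell j u) x
      \<le> (\<integral>\<^sup>+q. indicator I q * (indicator (Q1 q) x * \<Phi> q x) \<partial>count_space UNIV)" for x
  proof (cases "x \<in> cell j u \<and> (\<exists>k\<in>{j..<N}. good k x)")
    case True
    then have cx: "cell j x = cell j u" using cell_eq[of j x u] by (simp add: in_cell_iff)
    from True obtain k where k: "j \<le> k" "good k x" by auto
    have "0 < c\<^sub>0 * \<rho> ^ (k - j) * ?L" using c\<^sub>0 \<rho> side_pos[OF H_pos, of j] by simp
    then have d0: "0 < ?d x" using good_infdist[OF k(2,1)] unfolding cx by linarith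
    have L: "0 < ?L" by (rule side_pos[OF H_pos])
    obtain n where n: "?L / ?d x < 2 ^ n" using real_arch_pow[of 2 "?L / ?d x"] by auto
    define p where "p = (LEAST n. ?L / ?d x < 2 ^ Suc n)"
    have "(2 :: real) ^ n \<le> 2 ^ Suc n" by simp
    with n have "?L / ?d x < 2 ^ Suc n" by (rule less_le_trans)
    then have p: "?L / ?d x < 2 ^ Suc p" unfolding p_def by (rule LeastI)
    then have p1: "?L / 2 ^ Suc p < ?d x" using d0 by (simp add: field_simps)
    have p2: "?d x \<le> ?L / 2 ^ p"
    proof (cases p)
      case 0
      then show ?thesis using infdist_complement_le[of x j] cx by simp
    next
      case (Suc p')
      then have "\<not> ?L / ?d x < 2 ^ Suc p'" using not_less_Least[of p' "\<lambda>n. ?L / ?d x < 2 ^ Suc n"] p_def by simp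
      then show ?thesis using d0 Suc by (simp add: field_simps)
    qed
    define q where "q = (p, grid_index \<tau> H (j + p + ?n) x)"
    have qI: "q \<in> I" using True p1 p2 by (auto simp: q_def I_def)
    have qx: "x \<in> Q1 q" by (simp add: q_def Q1_def grid_cell_subset_cube[OF H_pos])
    have "(\<Sum>k\<in>{j..<N}. good_part g k x) \<le> \<Phi> q x"
      unfolding \<Phi>_def q_def fst_conv by (rule sum_good_part_le[OF _ g]) (use p2 cx in simp)
    also have "\<Phi> q x = (\<integral>\<^sup>+q'. \<Phi> q x * indicator {q} q' \<partial>count_space UNIV)"
      by (subst nn_integral_cmult_indicator) auto
    also have "\<dots> \<le> (\<integral>\<^sup>+q. indicator I q * (indicator (Q1 q) x * \<Phi> q x) \<partial>count_space UNIV)"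
      by (rule nn_integral_mono) (use qI qx in \<open>auto simp: indicator_def\<close>)
    finally show ?thesis using True by simp
  next
    case False
    then have z: "(\<Sum>k\<in>{j..<N}. good_part g k x) * indicator (cell j u) x = 0"
      by (auto simp: good_part_def indicator_def)
    show ?thesis unfolding z by simp
  qed
  have each: "(\<integral>\<^sup>+x\<in>Q1 q. \<Phi> q x \<partial>\<mu>) \<le> ennreal (C + B) * emeasure \<mu> (S q)" for q
  proof -
    obtain p z where q: "q = (p, z)" by (cases q)
    let ?l = "side H (j + p + ?n)" and ?c = "grid_center \<tau> H (j + p + ?n) z"
    have l: "0 < ?l" by (rule side_pos[OF H_pos])
    have split: "\<Phi> q x \<le> (\<integral>\<^sup>+t\<in>{0<..<?l}. square_density g x t \<partial>lborel) + ennreal B" for x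
    proof -
      have "\<Phi> q x \<le> (\<integral>\<^sup>+t. square_density g x t * indicator {0<..<?l} t + square_density g x t * indicator {?l..<T\<^sub>W * ?l} t \<partial>lborel)"
        unfolding \<Phi>_def q fst_conv by (rule nn_integral_mono) (auto simp: indicator_def)
      also have "\<dots> = (\<integral>\<^sup>+t\<in>{0<..<?l}. square_density g x t \<partial>lborel) + (\<integral>\<^sup>+t\<in>{?l..<T\<^sub>W * ?l}. square_density g x t \<partial>lborel)"
        by (rule nn_integral_add) measurable
      also have "\<dots> \<le> (\<integral>\<^sup>+t\<in>{0<..<?l}. square_density g x t \<partial>lborel) + ennreal B"
        unfolding B_def by (rule add_left_mono[OF square_density_bounded_tail[OF gK l T\<^sub>W_ge_1]])
      finally show ?thesis .
    qed
    have "(\<integral>\<^sup>+x\<in>Q1 q. \<Phi> q x \<partial>\<mu>) \<le> (\<integral>\<^sup>+x\<in>Q1 q. ((\<integral>\<^sup>+t\<in>{0<..<?l}. square_density g x t \<partial>lborel) + ennreal B) \<partial>\<mu>)"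
      by (intro nn_integral_mono mult_right_mono split) simp
    also have "\<dots> = (\<integral>\<^sup>+x\<in>Q1 q. (\<integral>\<^sup>+t\<in>{0<..<?l}. square_density g x t \<partial>lborel) \<partial>\<mu>) + (\<integral>\<^sup>+x\<in>Q1 q. ennreal B \<partial>\<mu>)"
      by (simp add: distrib_right nn_integral_add)
    also have "\<dots> = (\<integral>\<^sup>+x\<in>Q1 q. (\<integral>\<^sup>+t\<in>{0<..<?l}. square_density g x t \<partial>lborel) \<partial>\<mu>) + ennreal B * emeasure \<mu> (Q1 q)"
      by (subst nn_integral_cmult_indicator[OF Qm(1)]) (rule refl)
    also have "\<dots> \<le> ennreal C * emeasure \<mu> (S q) + ennreal B * emeasure \<mu> (S q)"
    proof (intro add_mono mult_left_mono emeasure_mono)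
      show "(\<integral>\<^sup>+x\<in>Q1 q. (\<integral>\<^sup>+t\<in>{0<..<?l}. square_density g x t \<partial>lborel) \<partial>\<mu>) \<le> ennreal C * emeasure \<mu> (S q)"
        using test[OF l, of ?c] by (simp add: Q1_def S_def q)
      show "Q1 q \<subseteq> S q"
      proof
        fix x assume x: "x \<in> Q1 q"
        have "\<bar>x $ e - ?c $ e\<bar> \<le> 3 * ?l / 2" for e
        proof -
          have "\<bar>x $ e - ?c $ e\<bar> \<le> ?l / 2" using x by (simp add: Q1_def q mem_cube)
          then show ?thesis using l by linarith
        qed
        then show "x \<in> S q" by (simp add: S_def q mem_cube)
      qed
    qed (use Qm(2) in auto)
    also have "\<dots> = ennreal (C + B) * emeasure \<mu> (S q)" using C B by (simp add: distrib_right)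
    finally show ?thesis .
  qed
  have "(\<integral>\<^sup>+x\<in>cell j u. (\<Sum>k\<in>{j..<N}. good_part g k x) \<partial>\<mu>)
      \<le> (\<integral>\<^sup>+x. \<integral>\<^sup>+q. indicator I q * (indicator (Q1 q) x * \<Phi> q x) \<partial>count_space UNIV \<partial>\<mu>)"
    by (rule nn_integral_mono[OF pt])
  also have "\<dots> = (\<integral>\<^sup>+q. \<integral>\<^sup>+x. indicator I q * (indicator (Q1 q) x * \<Phi> q x) \<partial>\<mu> \<partial>count_space UNIV)"
    by (rule nn_integral_count_space_nn_integral) auto
  also have "\<dots> \<le> (\<integral>\<^sup>+q. ennreal (C + B) * (indicator I q * emeasure \<mu> (S q)) \<partial>count_space UNIV)"
  proof (rule nn_integral_mono)
    fix q
    have "(\<integral>\<^sup>+x. indicator I q * (indicator (Q1 q) x * \<Phi> q x) \<partial>\<mu>) = indicator I q * (\<integral>\<^sup>+x\<in>Q1 q. \<Phi> q x \<partial>\<mu>)"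
      by (subst nn_integral_cmult) (auto simp: mult.commute)
    also have "\<dots> \<le> indicator I q * (ennreal (C + B) * emeasure \<mu> (S q))" by (rule mult_left_mono[OF each]) simp
    finally show "(\<integral>\<^sup>+x. indicator I q * (indicator (Q1 q) x * \<Phi> q x) \<partial>\<mu>) \<le> ennreal (C + B) * (indicator I q * emeasure \<mu> (S q))"
      by (simp add: mult.left_commute)
  qed
  also have "\<dots> = ennreal (C + B) * (\<integral>\<^sup>+q. \<integral>\<^sup>+y. indicator I q * indicator (S q) y \<partial>\<mu> \<partial>count_space UNIV)"
    unfolding nn_integral_cmult_indicator[OF Qm(2)] by (rule nn_integral_cmult) simp
  finally have le: "(\<integral>\<^sup>+x\<in>cell j u. (\<Sum>k\<in>{j..<N}. good_part g k x) \<partial>\<mu>)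
      \<le> ennreal (C + B) * (\<integral>\<^sup>+q. \<integral>\<^sup>+y. indicator I q * indicator (S q) y \<partial>\<mu> \<partial>count_space UNIV)" .
  have "(\<integral>\<^sup>+q. \<integral>\<^sup>+y. indicator I q * indicator (S q) y \<partial>\<mu> \<partial>count_space UNIV)
      = (\<integral>\<^sup>+y. \<integral>\<^sup>+q. indicator I q * indicator (S q) y \<partial>count_space UNIV \<partial>\<mu>)"
    by (rule nn_integral_count_space_nn_integral[symmetric]) auto
  also have "\<dots> \<le> (\<integral>\<^sup>+y. ennreal (3 * 4 ^ CARD('a)) * indicator (cell j u) y \<partial>\<mu>)"
    unfolding I_def S_def by (rule nn_integral_mono[OF whitney_count])
  also have "\<dots> = ennreal (3 * 4 ^ CARD('a)) * emeasure \<mu> (cell j u)"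
    by (rule nn_integral_cmult_indicator) measurable
  finally have "(\<integral>\<^sup>+q. \<integral>\<^sup>+y. indicator I q * indicator (S q) y \<partial>\<mu> \<partial>count_space UNIV)
      \<le> ennreal (3 * 4 ^ CARD('a)) * emeasure \<mu> (cell j u)" .
  then have "ennreal (C + B) * (\<integral>\<^sup>+q. \<integral>\<^sup>+y. indicator I q * indicator (S q) y \<partial>\<mu> \<partial>count_space UNIV)
      \<le> ennreal (C + B) * (ennreal (3 * 4 ^ CARD('a)) * emeasure \<mu> (cell j u))"
    by (rule mult_left_mono) simp
  also have "\<dots> = ennreal (whitney_const K C) * emeasure \<mu> (cell j u)"
  proof -
    have "ennreal (whitney_const K C) = ennreal (3 * 4 ^ CARD('a)) * ennreal (C + B)"
      unfolding whitney_const_def B_def[symmetric] by (rule ennreal_mult) (use B C in auto)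
    then show ?thesis by (simp only: mult.assoc mult.left_commute)
  qed
  finally show ?thesis using le by (rule order.trans[rotated])
qed

end

section \<open>Fine and coarse scales\<close>

lemma ennreal_square_sum_le: "(a + b)\<^sup>2 \<le> 2 * a\<^sup>2 + 2 * (b::ennreal)\<^sup>2"
proof (cases a; cases b)
  fix r q assume "a = ennreal r" "b = ennreal q" and nn: "0 \<le> r" "0 \<le> q"
  have "0 \<le> (r - q)\<^sup>2" by simp
  then have "(r + q)\<^sup>2 \<le> 2 * r\<^sup>2 + 2 * q\<^sup>2" by (simp add: power2_sum power2_diff)
  then have "ennreal ((r + q)\<^sup>2) \<le> ennreal (2 * r\<^sup>2 + 2 * q\<^sup>2)" by (rule ennreal_leI)
  moreover have "(a + b)\<^sup>2 = ennreal ((r + q)\<^sup>2)"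
    using nn by (simp add: \<open>a = ennreal r\<close> \<open>b = ennreal q\<close> ennreal_power flip: ennreal_plus)
  moreover have "2 * a\<^sup>2 + 2 * b\<^sup>2 = ennreal (2 * r\<^sup>2 + 2 * q\<^sup>2)"
    using nn by (simp add: \<open>a = ennreal r\<close> \<open>b = ennreal q\<close> ennreal_power ennreal_mult)
  ultimately show ?thesis by simp
qed (auto simp: power2_eq_square ennreal_top_mult ennreal_mult_top)

text \<open>Cauchy-Schwarz for the discrete measure with weights \<open>w\<close>.\<close>

lemma ennreal_weighted_square_sum_le:
  fixes w V :: "nat \<Rightarrow> ennreal"
  shows "(\<Sum>i\<in>{..n}. w i * V i)\<^sup>2 \<le> (\<Sum>i\<in>{..n}. w i) * (\<Sum>i\<in>{..n}. w i * (V i)\<^sup>2)"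
proof -
  define M where "M = density (count_space {..n}) w"
  have int: "(\<integral>\<^sup>+i. h i \<partial>M) = (\<Sum>i\<in>{..n}. w i * h i)" for h
    unfolding M_def by (subst nn_integral_density) (auto simp: nn_integral_count_space_finite)
  have "(\<integral>\<^sup>+i. 1 * V i \<partial>M)\<^sup>2 \<le> (\<integral>\<^sup>+i. 1\<^sup>2 \<partial>M) * (\<integral>\<^sup>+i. (V i)\<^sup>2 \<partial>M)"
    by (rule Cauchy_Schwarz_nn_integral) (auto simp: M_def)
  then show ?thesis unfolding int by simp
qed

lemma sum_power_abs_diff_le:
  fixes r :: real
  assumes r: "0 \<le> r" "r < 1"
  shows "(\<Sum>i\<in>{..n}. r ^ ((k - i) + (i - k))) \<le> 2 / (1 - r)"
proof -
  have geo: "(\<Sum>i\<in>A. r ^ f i) \<le> 1 / (1 - r)" if "finite A" "inj_on f A" for f and A :: "nat set"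
  proof -
    have "(\<Sum>i\<in>A. r ^ f i) = (\<Sum>j\<in>f ` A. r ^ j)" by (simp add: sum.reindex[OF that(2)])
    also have "\<dots> \<le> (\<Sum>j. r ^ j)" by (rule sum_le_suminf) (use that r in auto)
    also have "\<dots> = 1 / (1 - r)" by (rule suminf_geometric) (use r in simp)
    finally show ?thesis .
  qed
  have "(\<Sum>i\<in>{..n}. r ^ ((k - i) + (i - k)))
      = (\<Sum>i\<in>{..n} \<inter> {..k}. r ^ ((k - i) + (i - k))) + (\<Sum>i\<in>{..n} - {..k}. r ^ ((k - i) + (i - k)))"
    by (rule sum.Int_Diff) simp
  also have "\<dots> = (\<Sum>i\<in>{..n} \<inter> {..k}. r ^ (k - i)) + (\<Sum>i\<in>{..n} - {..k}. r ^ (i - k))"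
    by (intro arg_cong2[where f = "(+)"] sum.cong) auto
  also have "\<dots> \<le> 1 / (1 - r) + 1 / (1 - r)"
    by (intro add_mono geo) (auto simp: inj_on_def)
  finally show ?thesis by simp
qed

text \<open>A grid together with an accretive system that satisfies the testing condition.\<close>

locale local_Tb_grid =
  dyadic_grid \<mu> m \<alpha> s C\<^sub>\<mu> C\<^sub>s C\<^sub>c \<tau> H + accretive_system \<mu> "grid_index \<tau> H" b K \<delta>
  for \<mu> :: "(real ^ 'n) measure" and m \<alpha> s C\<^sub>\<mu> C\<^sub>s C\<^sub>c \<tau> H b K \<delta> +
  fixes C\<^sub>t :: real
  assumes C\<^sub>t_nonneg: "0 \<le> C\<^sub>t"
    and testing: "\<And>j z c l. 0 < l \<Longrightarrow>
      (\<integral>\<^sup>+x\<in>cube c l. (\<integral>\<^sup>+t\<in>{0<..<l}. square_density (b j z) x t \<partial>lborel) \<partial>\<mu>)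
        \<le> ennreal C\<^sub>t * emeasure \<mu> (cube c (3 * l))"
begin

text \<open>Subtract from the kernel its value at one point of each cell of level \<open>j\<close>; the product of the frozen kernel
  and \<open>h\<close> has integral zero. What is left is the oscillation of the kernel on cells of side at most \<open>t\<close>.\<close>

lemma theta_cell_mean_zero:
  fixes h :: "real ^ 'n \<Rightarrow> complex"
  assumes t: "side H j \<le> t" and h [measurable]: "h \<in> borel_measurable \<mu>"
    and sq: "L2_square \<mu> h < \<infinity>"
    and zero: "\<And>u. (LINT y:cell j u|\<mu>. h y) = 0"
  shows "ennreal (norm (theta \<mu> s t h x))
    \<le> ennreal (C\<^sub>R * (side H j / t) powr \<alpha>) * (\<integral>\<^sup>+y. ennreal (poisson m \<alpha> t x y) * ennreal (norm (h y)) \<partial>\<mu>)"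
proof -
  let ?l = "side H j" and ?P = "poisson m \<alpha> t x"
  have l: "0 < ?l" by (rule side_pos[OF H_pos])
  then have t0: "0 < t" using t by simp
  define R where "R = C\<^sub>R * (?l / t) powr \<alpha>"
  have R: "0 \<le> R" using C\<^sub>R_nonneg by (simp add: R_def)
  have [measurable]: "s t x \<in> borel_measurable \<mu>" by (rule kernel_measurable[OF t0])
  \<comment> \<open>The kernel frozen on each cell.\<close>
  define rep where "rep y = (SOME u. grid_index \<tau> H j u = grid_index \<tau> H j y)" for y :: "real ^ 'n"
  have rep: "rep y \<in> cell j y" for y
    unfolding rep_def in_cell_iff by (rule someI[of _ y]) simp
  define s' where "s' y = s t x (rep y)" for y
  have s'_cell: "s' y = s' u" if "y \<in> cell j u" for y u
    using that by (simp add: s'_def rep_def in_cell_iff)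
  have [measurable]: "s' \<in> borel_measurable \<mu>"
    by (rule cell_constant_measurable[of j]) (auto intro: s'_cell simp: in_cell_iff)
  have diff: "norm (s t x y - s' y) \<le> R * ?P y" for y
    unfolding s'_def R_def by (rule kernel_difference[OF l t dist_in_cell[of _ j y]]) (auto intro: rep)
  have pt: "ennreal (norm ((s t x y - s' y) * h y)) \<le> ennreal R * (ennreal (?P y) * ennreal (norm (h y)))" for y
  proof -
    have "norm ((s t x y - s' y) * h y) \<le> R * ?P y * norm (h y)"
      using mult_right_mono[OF diff norm_ge_zero] by (simp add: norm_mult)
    then have "ennreal (norm ((s t x y - s' y) * h y)) \<le> ennreal (R * ?P y * norm (h y))" by (rule ennreal_leI)
    then show ?thesis using R by (simp add: ennreal_mult mult.assoc)
  qed
  have bound: "(\<integral>\<^sup>+y. ennreal (norm ((s t x y - s' y) * h y)) \<partial>\<mu>)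
      \<le> ennreal R * (\<integral>\<^sup>+y. ennreal (?P y) * ennreal (norm (h y)) \<partial>\<mu>)"
  proof -
    have "(\<integral>\<^sup>+y. ennreal (norm ((s t x y - s' y) * h y)) \<partial>\<mu>)
        \<le> (\<integral>\<^sup>+y. ennreal R * (ennreal (?P y) * ennreal (norm (h y))) \<partial>\<mu>)" by (rule nn_integral_mono[OF pt])
    also have "\<dots> = ennreal R * (\<integral>\<^sup>+y. ennreal (?P y) * ennreal (norm (h y)) \<partial>\<mu>)"
      by (rule nn_integral_cmult) measurable
    finally show ?thesis .
  qed
  have i1: "integrable \<mu> (\<lambda>y. s t x y * h y)" by (rule integrable_kernel_square[OF t0 h sq])
  have i2: "integrable \<mu> (\<lambda>y. (s t x y - s' y) * h y)"
    unfolding integrable_iff_bounded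
  proof
    show "(\<integral>\<^sup>+y. ennreal (norm ((s t x y - s' y) * h y)) \<partial>\<mu>) < \<infinity>"
    proof (rule le_less_trans[OF bound])
      show "ennreal R * (\<integral>\<^sup>+y. ennreal (?P y) * ennreal (norm (h y)) \<partial>\<mu>) < \<infinity>"
        using nn_integral_poisson_square_finite[OF t0 h sq, of x] by (simp add: ennreal_mult_less_top)
    qed
  qed measurable
  have i3: "integrable \<mu> (\<lambda>y. s' y * h y)"
    using Bochner_Integration.integrable_diff[OF i1 i2] by (simp add: left_diff_distrib)
  have "(LINT y|\<mu>. s' y * h y) = 0"
  proof (rule integral_eq_0_cells[OF i3, of j])
    fix u
    have "(LINT y:cell j u|\<mu>. s' y * h y) = (LINT y:cell j u|\<mu>. s' u * h y)"
      by (rule set_lebesgue_integral_cong[OF cell_measurable]) (auto dest: s'_cell)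
    then show "(LINT y:cell j u|\<mu>. s' y * h y) = 0" by (simp add: zero)
  qed
  then have "theta \<mu> s t h x = (LINT y|\<mu>. (s t x y - s' y) * h y)"
    using Bochner_Integration.integral_diff[OF i1 i3] by (simp add: theta_def left_diff_distrib)
  then have "ennreal (norm (theta \<mu> s t h x)) \<le> (\<integral>\<^sup>+y. ennreal (norm ((s t x y - s' y) * h y)) \<partial>\<mu>)"
    using integral_norm_bound_ennreal[OF i2] by simp
  also note bound
  finally show ?thesis unfolding R_def .
qed

definition decay :: real where "decay = 2 powr (- \<alpha> / 2)"

lemma decay: "0 < decay" "decay < 1"
  using \<alpha>_pos by (auto simp: decay_def powr_less_one)

text \<open>The adapted expectations of the levels up to \<open>N\<close>, followed by \<open>f\<close> itself as level \<open>Suc N\<close>. Thus \<open>f\<close> is a finite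
  telescoping sum of the differences, without a passage to the limit in \<open>N\<close>.\<close>

definition level :: "nat \<Rightarrow> (real ^ 'n \<Rightarrow> complex) \<Rightarrow> nat \<Rightarrow> real ^ 'n \<Rightarrow> complex" where
  "level N f i = (if i \<le> N then adapted f i else f)"

text \<open>The size of the difference that leads to level \<open>i\<close>, up to the factor \<open>K\<close>.\<close>

definition D :: "nat \<Rightarrow> (real ^ 'n \<Rightarrow> complex) \<Rightarrow> nat \<Rightarrow> real ^ 'n \<Rightarrow> real" where
  "D N f i y = (if i \<le> N then jump f i y else norm (f y - adapted f N y))"

lemma D_nonneg: "0 \<le> D N f i y"
  by (simp add: D_def jump_nonneg)

lemma level_measurable [measurable]: "f \<in> borel_measurable \<mu> \<Longrightarrow> level N f i \<in> borel_measurable \<mu>"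
  by (simp add: level_def)

lemma D_measurable [measurable]: "f \<in> borel_measurable \<mu> \<Longrightarrow> D N f i \<in> borel_measurable \<mu>"
  unfolding D_def by (cases "i \<le> N") simp_all

lemma adapted_jump: "norm (adapted f (Suc i) y - adapted f i y) \<le> K * jump f (Suc i) y"
  using jump_extension[of f i y y] by (simp add: adapted_def)

lemma level_diff_bound:
  assumes "i \<le> N"
  shows "norm (level N f (Suc i) y - level N f i y) \<le> K * D N f (Suc i) y"
proof (cases "Suc i \<le> N")
  case True
  then show ?thesis using adapted_jump by (simp add: level_def D_def)
next
  case False
  then have "i = N" using assms by simp
  then show ?thesis
    using mult_right_mono[OF K_ge_1 norm_ge_zero[of "f y - adapted f N y"]] by (simp add: level_def D_def)
qed

lemma adapted_square_finite:
  assumes f: "f \<in> borel_measurable \<mu>" and sq: "L2_square \<mu> f < \<infinity>"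
  shows "L2_square \<mu> (adapted f i) < \<infinity>"
proof -
  note [measurable] = f
  define B where "B = K * (2 / \<delta>)"
  have "L2_square \<mu> (adapted f i) \<le> (\<integral>\<^sup>+x. ennreal (B\<^sup>2) * ennreal ((norm (avg i f x))\<^sup>2) \<partial>\<mu>)"
  proof (rule nn_integral_mono)
    fix x
    have "(norm (adapted f i x))\<^sup>2 \<le> (B * norm (avg i f x))\<^sup>2"
      unfolding B_def by (rule power_mono[OF adapted_bound]) simp
    then show "ennreal ((norm (adapted f i x))\<^sup>2) \<le> ennreal (B\<^sup>2) * ennreal ((norm (avg i f x))\<^sup>2)"
      by (simp add: power_mult_distrib ennreal_mult[symmetric] ennreal_leI)
  qed
  also have "\<dots> = ennreal (B\<^sup>2) * L2_square \<mu> (avg i f)" by (simp add: nn_integral_cmult)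
  also have "\<dots> \<le> ennreal (B\<^sup>2) * L2_square \<mu> f"
    by (rule mult_left_mono[OF nn_integral_avg_square_le'[OF locally_integrableI_square[OF f sq]]]) simp
  also have "\<dots> < \<infinity>" using sq by (simp add: ennreal_mult_less_top)
  finally show ?thesis .
qed

lemma square_finite_diff:
  fixes u v :: "real ^ 'n \<Rightarrow> complex"
  assumes [measurable]: "u \<in> borel_measurable \<mu>" "v \<in> borel_measurable \<mu>"
    and "L2_square \<mu> u < \<infinity>" "L2_square \<mu> v < \<infinity>"
  shows "(\<integral>\<^sup>+x. ennreal ((norm (u x - v x))\<^sup>2) \<partial>\<mu>) < \<infinity>"
proof -
  have "(\<integral>\<^sup>+x. ennreal ((norm (u x - v x))\<^sup>2) \<partial>\<mu>)
      \<le> (\<integral>\<^sup>+x. 2 * ennreal ((norm (u x))\<^sup>2) + 2 * ennreal ((norm (v x))\<^sup>2) \<partial>\<mu>)"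
  proof (rule nn_integral_mono)
    fix x
    have "ennreal ((norm (u x - v x))\<^sup>2) = (ennreal (norm (u x - v x)))\<^sup>2" by (simp add: ennreal_power)
    also have "\<dots> \<le> (ennreal (norm (u x)) + ennreal (norm (v x)))\<^sup>2"
      by (rule power_mono) (auto simp: ennreal_plus[symmetric] simp del: ennreal_plus intro!: ennreal_leI norm_triangle_ineq4)
    also note ennreal_square_sum_le
    finally show "ennreal ((norm (u x - v x))\<^sup>2) \<le> 2 * ennreal ((norm (u x))\<^sup>2) + 2 * ennreal ((norm (v x))\<^sup>2)"
      by (simp add: ennreal_power)
  qed
  also have "\<dots> = 2 * L2_square \<mu> u + 2 * L2_square \<mu> v"
    by (simp add: nn_integral_add nn_integral_cmult)
  also have "\<dots> < \<infinity>" using assms(3,4) by (simp add: ennreal_mult_less_top)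
  finally show ?thesis .
qed

lemma level_square_finite:
  assumes "f \<in> borel_measurable \<mu>" "L2_square \<mu> f < \<infinity>"
  shows "L2_square \<mu> (level N f i) < \<infinity>"
proof (cases "i \<le> N")
  case True
  then have "level N f i = adapted f i" by (simp add: level_def fun_eq_iff)
  then show ?thesis using adapted_square_finite[OF assms, of i] by (simp only:)
next
  case False
  then have "level N f i = f" by (simp add: level_def fun_eq_iff)
  then show ?thesis using assms(2) by (simp only:)
qed

lemma level_diff_mean_zero:
  assumes f: "locally_integrable f" and i: "i \<le> N"
  shows "(LINT y:cell i u|\<mu>. level N f (Suc i) y - level N f i y) = 0"
proof (cases "Suc i \<le> N")
  case True
  then have "level N f (Suc i) = adapted f (Suc i)" "level N f i = adapted f i" by (simp_all add: level_def fun_eq_iff)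
  then show ?thesis using set_integral_adapted_diff[OF f, of i u] by (simp only:)
next
  case False
  then have "i = N" using i by simp
  have "(LINT y:cell N u|\<mu>. f y - adapted f N y) = (LINT y:cell N u|\<mu>. f y) - (LINT y:cell N u|\<mu>. adapted f N y)"
    by (rule set_integral_diff(2)[OF locally_integrable_on_cell[OF f] locally_integrable_on_cell[OF locally_integrable_adapted[OF f]]])
  also have "\<dots> = 0" by (simp only: set_integral_adapted[OF f] diff_self)
  finally show ?thesis using \<open>i = N\<close> by (simp add: level_def)
qed

text \<open>A difference of level \<open>i\<close> enters the estimate at level \<open>k\<close> through its average at the coarser of both
  scales.\<close>

definition PD :: "nat \<Rightarrow> (real ^ 'n \<Rightarrow> complex) \<Rightarrow> nat \<Rightarrow> nat \<Rightarrow> real ^ 'n \<Rightarrow> ennreal" where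
  "PD N f k i x = (\<integral>\<^sup>+y. ennreal (poisson m \<alpha> (side H (min i k)) x y) * ennreal (D N f i y) \<partial>\<mu>)"

lemma PD_measurable [measurable]:
  assumes [measurable]: "f \<in> borel_measurable \<mu>"
  shows "PD N f k i \<in> borel_measurable \<mu>"
proof -
  have [measurable]: "D N f i \<in> borel_measurable \<mu>" by (rule D_measurable[OF assms])
  show ?thesis unfolding PD_def by measurable
qed

text \<open>The difference has mean zero on the cells of level \<open>i\<close>, whose side is \<open>2\<^bsup>-(i-k)\<^esup>\<close> times that of level \<open>k\<close>.
  The factor \<open>decay\<close> uses only half of the resulting gain.\<close>

lemma fine_scale_bound:
  assumes f [measurable]: "f \<in> borel_measurable \<mu>" and sq: "L2_square \<mu> f < \<infinity>"
    and ki: "k \<le> i" "i \<le> N" and t: "side H k \<le> t" "t \<le> 2 * side H k"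
  shows "ennreal (norm (theta \<mu> s t (\<lambda>y. level N f (Suc i) y - level N f i y) x))
    \<le> ennreal (C\<^sub>R * (2 powr \<alpha>)\<^sup>2 * K) * (ennreal (decay ^ (Suc i - k)) * PD N f k (Suc i) x)"
proof -
  define h where "h = (\<lambda>y. level N f (Suc i) y - level N f i y)"
  have [measurable]: "h \<in> borel_measurable \<mu>" unfolding h_def by measurable
  have sk: "0 < side H k" by (rule side_pos[OF H_pos])
  have sik: "side H i = side H k / 2 ^ (i - k)" using side_add[of H k "i - k"] ki by simp
  have "side H k / 2 ^ (i - k) \<le> side H k / 1" using sk by (intro divide_left_mono) (auto simp: one_le_power)
  then have it: "side H i \<le> t" using t sik by simp
  have t0: "0 < t" using t sk by simp
  have ratio: "(side H i / t) powr \<alpha> \<le> 2 powr \<alpha> * decay ^ (Suc i - k)"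
  proof -
    have d2: "decay * decay = 2 powr (- \<alpha>)" by (simp add: decay_def powr_add[symmetric])
    have "(side H i / t) powr \<alpha> \<le> (side H i / side H k) powr \<alpha>"
      using t sk side_pos[OF H_pos, of i] \<alpha>_pos by (intro powr_mono2 divide_left_mono) auto
    also have "side H i / side H k = 1 / 2 ^ (i - k)" using sk by (simp add: sik)
    also have "(1 / 2 ^ (i - k)) powr \<alpha> = (2 powr (- \<alpha>)) ^ (i - k)"
    proof -
      have "(2 ^ (i - k) :: real) powr \<alpha> = (2 powr \<alpha>) ^ (i - k)"
        by (simp add: powr_power powr_powr mult.commute flip: powr_realpow)
      then show ?thesis by (simp add: powr_divide powr_minus_divide power_one_over)
    qed
    also have "\<dots> = decay ^ (i - k) * decay ^ (i - k)" by (simp add: d2[symmetric] power_mult_distrib)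
    also have "\<dots> \<le> decay ^ (i - k) * 1"
      using decay by (intro mult_left_mono power_le_one) auto
    also have "\<dots> \<le> decay ^ (i - k) * (2 powr \<alpha> * decay)"
    proof (rule mult_left_mono)
      have "1 \<le> 2 powr (\<alpha> / 2)" using \<alpha>_pos by (simp add: ge_one_powr_ge_zero)
      also have "\<dots> = 2 powr \<alpha> * decay" by (simp add: decay_def powr_add[symmetric])
      finally show "1 \<le> 2 powr \<alpha> * decay" .
    qed (use decay in simp)
    also have "\<dots> = 2 powr \<alpha> * decay ^ (Suc i - k)" using ki by (simp add: Suc_diff_le)
    finally show ?thesis .
  qed
  have "ennreal (norm (theta \<mu> s t h x))
      \<le> ennreal (C\<^sub>R * (side H i / t) powr \<alpha>) * (\<integral>\<^sup>+y. ennreal (poisson m \<alpha> t x y) * ennreal (norm (h y)) \<partial>\<mu>)"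
  proof (rule theta_cell_mean_zero[OF it])
    show "L2_square \<mu> h < \<infinity>"
      unfolding h_def by (rule square_finite_diff) (auto intro: level_square_finite[OF f sq, unfolded infinity_ennreal_def])
    show "(LINT y:cell i u|\<mu>. h y) = 0" for u
      unfolding h_def by (rule level_diff_mean_zero[OF locally_integrableI_square[OF f sq] ki(2)])
  qed measurable
  also have "\<dots> \<le> ennreal (C\<^sub>R * (2 powr \<alpha> * decay ^ (Suc i - k)))
      * (\<integral>\<^sup>+y. ennreal (2 powr \<alpha> * K) * (ennreal (poisson m \<alpha> (side H k) x y) * ennreal (D N f (Suc i) y)) \<partial>\<mu>)"
  proof (rule mult_mono)
    show "ennreal (C\<^sub>R * (side H i / t) powr \<alpha>) \<le> ennreal (C\<^sub>R * (2 powr \<alpha> * decay ^ (Suc i - k)))"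
      by (intro ennreal_leI mult_left_mono ratio C\<^sub>R_nonneg)
    show "(\<integral>\<^sup>+y. ennreal (poisson m \<alpha> t x y) * ennreal (norm (h y)) \<partial>\<mu>)
        \<le> (\<integral>\<^sup>+y. ennreal (2 powr \<alpha> * K) * (ennreal (poisson m \<alpha> (side H k) x y) * ennreal (D N f (Suc i) y)) \<partial>\<mu>)"
    proof (rule nn_integral_mono)
      fix y
      have "poisson m \<alpha> t x y * norm (h y) \<le> (2 powr \<alpha> * poisson m \<alpha> (side H k) x y) * (K * D N f (Suc i) y)"
        unfolding h_def by (intro mult_mono poisson_comparable_scale sk t m_pos \<alpha>_pos level_diff_bound ki) auto
      then have "ennreal (poisson m \<alpha> t x y * norm (h y))
          \<le> ennreal ((2 powr \<alpha> * K) * (poisson m \<alpha> (side H k) x y * D N f (Suc i) y))"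
        by (intro ennreal_leI) (simp add: ac_simps)
      then show "ennreal (poisson m \<alpha> t x y) * ennreal (norm (h y))
          \<le> ennreal (2 powr \<alpha> * K) * (ennreal (poisson m \<alpha> (side H k) x y) * ennreal (D N f (Suc i) y))"
        using K_ge_1 by (simp add: ennreal_mult[symmetric] D_nonneg)
    qed
  qed auto
  also have "\<dots> = ennreal (C\<^sub>R * (2 powr \<alpha> * decay ^ (Suc i - k))) * (ennreal (2 powr \<alpha> * K) * PD N f k (Suc i) x)"
    using ki by (subst nn_integral_cmult) (auto simp: PD_def min_def)
  also have "\<dots> = ennreal (C\<^sub>R * (2 powr \<alpha>)\<^sup>2 * K) * (ennreal (decay ^ (Suc i - k)) * PD N f k (Suc i) x)"
  proof -
    have "ennreal (C\<^sub>R * (2 powr \<alpha> * decay ^ (Suc i - k))) * ennreal (2 powr \<alpha> * K)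
        = ennreal (C\<^sub>R * (2 powr \<alpha>)\<^sup>2 * K) * ennreal (decay ^ (Suc i - k))"
      using C\<^sub>R_nonneg K_ge_1 decay
      by (simp add: ennreal_mult[symmetric] power2_eq_square ac_simps)
    then show ?thesis by (simp only: mult.assoc[symmetric])
  qed
  finally show ?thesis unfolding h_def .
qed

definition C\<^sub>G :: real where "C\<^sub>G = 2 powr \<alpha> * (2 / c\<^sub>0) powr (m + \<alpha>)"

text \<open>Both \<open>level N f k\<close> and its extension \<open>coef f k x * G k x\<close> from \<open>x\<close> are written as telescoping sums over the
  levels \<open>i \<le> k\<close>. The terms of level \<open>i\<close> agree on the cell of level \<open>i\<close> around \<open>x\<close>. Outside this cell they are
  bounded by the jumps at \<open>y\<close> and at \<open>x\<close>, and the good point \<open>x\<close> is far away.\<close>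

lemma coarse_scale_bound:
  assumes f [measurable]: "f \<in> borel_measurable \<mu>"
    and good: "good k x" and kN: "k \<le> N" and t: "side H k \<le> t" "t \<le> 2 * side H k"
  shows "ennreal (norm (theta \<mu> s t (\<lambda>y. level N f k y - coef f k x * G k x y) x))
    \<le> ennreal (C\<^sub>s * K * C\<^sub>G) * (\<Sum>i\<in>{..k}. ennreal (decay ^ (k - i)) * (PD N f k i x + ennreal (C\<^sub>P * D N f i x)))"
proof -
  have t0: "0 < t" using t side_pos[OF H_pos, of k] by simp
  have nonneg: "0 \<le> C\<^sub>G" "0 \<le> K" using K_ge_1 by (auto simp: C\<^sub>G_def)
  \<comment> \<open>The difference of two consecutive adapted expectations, and of their extensions from \<open>x\<close>.\<close>
  define loc where "loc i y = (if i = 0 then adapted f 0 y else adapted f i y - adapted f (i - 1) y)" for i y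
  define ext where "ext i y = (if i = 0 then coef f 0 x * G 0 x y
      else coef f i x * G i x y - coef f (i - 1) x * G (i - 1) x y)" for i y
  have sum_loc: "(\<Sum>i\<in>{..k}. loc i y) = adapted f k y" for y k
    by (induction k) (auto simp: loc_def)
  have sum_ext: "(\<Sum>i\<in>{..k}. ext i y) = coef f k x * G k x y" for y k
    by (induction k) (auto simp: ext_def)
  have D: "D N f i y = jump f i y" if "i \<le> k" for i y using that kN by (simp add: D_def)
  have agree: "loc i y = ext i y" if "y \<in> cell i x" for i y
  proof (cases i)
    case 0
    then show ?thesis using that adapted_on_cell[of y 0 x f] by (simp add: loc_def ext_def)
  next
    case (Suc i')
    have "y \<in> cell i' x" using that cell_mono[of i' i x] Suc by auto
    then show ?thesis using Suc that adapted_on_cell[of y i x f] adapted_on_cell[of y i' x f] by (simp add: loc_def ext_def)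
  qed
  have bound_loc: "norm (loc i y) \<le> K * jump f i y" for i y
    using adapted_jump[of f "i - 1" y] jump_extension_0[of f y y]
    by (cases i) (auto simp: loc_def adapted_def simp del: jump.simps)
  have bound_ext: "norm (ext i y) \<le> K * jump f i x" for i y
    using jump_extension[of f "i - 1" x y] jump_extension_0[of f x y]
    by (cases i) (auto simp: ext_def simp del: jump.simps)
  have each: "ennreal (norm (s t x y * (loc i y - ext i y)))
      \<le> ennreal (C\<^sub>s * K * C\<^sub>G) * (ennreal (decay ^ (k - i)) * (ennreal (poisson m \<alpha> (side H i) x y) * (ennreal (D N f i y) + ennreal (D N f i x))))"
    if i: "i \<in> {..k}" for i y
  proof (cases "y \<in> cell i x")
    case True
    then show ?thesis by (simp add: agree)
  next
    case False
    have ik: "i \<le> k" using i by simp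
    have sk: "side H k = side H i / 2 ^ (k - i)" using side_add[of H i "k - i"] ik by simp
    have "poisson m \<alpha> t x y \<le> 2 powr \<alpha> * (2 / c\<^sub>0) powr (m + \<alpha>) * (2 powr (- \<alpha> / 2)) ^ (k - i) * poisson m \<alpha> (side H i) x y"
    proof (rule poisson_off_diagonal)
      show "c\<^sub>0 * \<rho> ^ (k - i) * side H i \<le> norm (x - y)" by (rule good_far_from_complement[OF good ik False])
    qed (use side_pos[OF H_pos, of i] m_pos \<alpha>_pos c\<^sub>0 t sk in auto)
    then have P: "poisson m \<alpha> t x y \<le> C\<^sub>G * decay ^ (k - i) * poisson m \<alpha> (side H i) x y"
      by (simp add: C\<^sub>G_def decay_def)
    have "norm (s t x y * (loc i y - ext i y)) \<le> (C\<^sub>s * (C\<^sub>G * decay ^ (k - i) * poisson m \<alpha> (side H i) x y)) * (K * jump f i y + K * jump f i x)"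
      unfolding norm_mult
    proof (rule mult_mono)
      show "norm (s t x y) \<le> C\<^sub>s * (C\<^sub>G * decay ^ (k - i) * poisson m \<alpha> (side H i) x y)"
        using size[OF t0, of x y] mult_left_mono[OF P C_nonneg(2)] by (rule order.trans)
      show "norm (loc i y - ext i y) \<le> K * jump f i y + K * jump f i x"
        by (rule order.trans[OF norm_triangle_ineq4 add_mono[OF bound_loc bound_ext]])
      show "0 \<le> C\<^sub>s * (C\<^sub>G * decay ^ (k - i) * poisson m \<alpha> (side H i) x y)"
        using C_nonneg nonneg decay by simp
    qed simp
    also have "\<dots> = (C\<^sub>s * K * C\<^sub>G) * (decay ^ (k - i) * (poisson m \<alpha> (side H i) x y * (D N f i y + D N f i x)))"
      by (simp add: D[OF ik] algebra_simps)
    finally have "ennreal (norm (s t x y * (loc i y - ext i y)))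
        \<le> ennreal ((C\<^sub>s * K * C\<^sub>G) * (decay ^ (k - i) * (poisson m \<alpha> (side H i) x y * (D N f i y + D N f i x))))"
      by (rule ennreal_leI)
    also have "\<dots> = ennreal (C\<^sub>s * K * C\<^sub>G) * (ennreal (decay ^ (k - i)) * (ennreal (poisson m \<alpha> (side H i) x y) * (ennreal (D N f i y) + ennreal (D N f i x))))"
      using C_nonneg nonneg decay D_nonneg by (simp add: ennreal_mult ennreal_plus[symmetric] del: ennreal_plus)
    finally show ?thesis .
  qed
  have "ennreal (norm (theta \<mu> s t (\<lambda>y. level N f k y - coef f k x * G k x y) x))
      \<le> (\<integral>\<^sup>+y. ennreal (norm (s t x y * (level N f k y - coef f k x * G k x y))) \<partial>\<mu>)"
    by (rule norm_theta_le_nn_integral)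
  also have "\<dots> \<le> (\<integral>\<^sup>+y. (\<Sum>i\<in>{..k}. ennreal (C\<^sub>s * K * C\<^sub>G) * (ennreal (decay ^ (k - i)) *
      (ennreal (poisson m \<alpha> (side H i) x y) * (ennreal (D N f i y) + ennreal (D N f i x))))) \<partial>\<mu>)"
  proof (rule nn_integral_mono)
    fix y
    have "s t x y * (level N f k y - coef f k x * G k x y) = (\<Sum>i\<in>{..k}. s t x y * (loc i y - ext i y))"
      using kN by (simp add: level_def sum_loc sum_ext sum_subtractf flip: sum_distrib_left)
    then have "ennreal (norm (s t x y * (level N f k y - coef f k x * G k x y)))
        \<le> ennreal (\<Sum>i\<in>{..k}. norm (s t x y * (loc i y - ext i y)))"
      by (intro ennreal_leI) (simp only: norm_sum)
    also have "\<dots> = (\<Sum>i\<in>{..k}. ennreal (norm (s t x y * (loc i y - ext i y))))"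
      by (rule sum_ennreal[symmetric]) simp
    also have "\<dots> \<le> (\<Sum>i\<in>{..k}. ennreal (C\<^sub>s * K * C\<^sub>G) * (ennreal (decay ^ (k - i)) *
        (ennreal (poisson m \<alpha> (side H i) x y) * (ennreal (D N f i y) + ennreal (D N f i x)))))"
      by (rule sum_mono[OF each])
    finally show "ennreal (norm (s t x y * (level N f k y - coef f k x * G k x y)))
        \<le> (\<Sum>i\<in>{..k}. ennreal (C\<^sub>s * K * C\<^sub>G) * (ennreal (decay ^ (k - i)) *
        (ennreal (poisson m \<alpha> (side H i) x y) * (ennreal (D N f i y) + ennreal (D N f i x)))))" .
  qed
  also have "\<dots> = (\<Sum>i\<in>{..k}. ennreal (C\<^sub>s * K * C\<^sub>G) * (ennreal (decay ^ (k - i)) *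
      (\<integral>\<^sup>+y. ennreal (poisson m \<alpha> (side H i) x y) * (ennreal (D N f i y) + ennreal (D N f i x)) \<partial>\<mu>)))"
    by (simp add: nn_integral_sum nn_integral_cmult)
  also have "\<dots> \<le> (\<Sum>i\<in>{..k}. ennreal (C\<^sub>s * K * C\<^sub>G) * (ennreal (decay ^ (k - i)) * (PD N f k i x + ennreal (C\<^sub>P * D N f i x))))"
  proof (intro sum_mono mult_left_mono)
    fix i assume "i \<in> {..k}"
    then have "min i k = i" by simp
    have "(\<integral>\<^sup>+y. ennreal (poisson m \<alpha> (side H i) x y) * (ennreal (D N f i y) + ennreal (D N f i x)) \<partial>\<mu>)
        = PD N f k i x + (\<integral>\<^sup>+y. ennreal (poisson m \<alpha> (side H i) x y) \<partial>\<mu>) * ennreal (D N f i x)"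
      unfolding PD_def \<open>min i k = i\<close> by (simp add: distrib_left nn_integral_add nn_integral_multc)
    also have "\<dots> \<le> PD N f k i x + ennreal C\<^sub>P * ennreal (D N f i x)"
      by (intro add_left_mono mult_right_mono nn_integral_poisson_le side_pos[OF H_pos]) simp
    finally show "(\<integral>\<^sup>+y. ennreal (poisson m \<alpha> (side H i) x y) * (ennreal (D N f i y) + ennreal (D N f i x)) \<partial>\<mu>)
        \<le> PD N f k i x + ennreal (C\<^sub>P * D N f i x)"
      using C\<^sub>P_nonneg by (simp add: ennreal_mult D_nonneg)
  qed auto
  also have "\<dots> = ennreal (C\<^sub>s * K * C\<^sub>G) * (\<Sum>i\<in>{..k}. ennreal (decay ^ (k - i)) * (PD N f k i x + ennreal (C\<^sub>P * D N f i x)))"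
    by (rule sum_distrib_left[symmetric])
  finally show ?thesis .
qed

end

section \<open>The square function at good points\<close>

context local_Tb_grid begin

text \<open>The total error at level \<open>k\<close>. With truncated subtraction, \<open>(k - i) + (i - k)\<close> is the distance of the levels
  \<open>i\<close> and \<open>k\<close>.\<close>

definition tail :: "nat \<Rightarrow> (real ^ 'n \<Rightarrow> complex) \<Rightarrow> nat \<Rightarrow> real ^ 'n \<Rightarrow> ennreal" where
  "tail N f k x = (\<Sum>i\<in>{..Suc N}. ennreal (decay ^ ((k - i) + (i - k))) * (PD N f k i x + ennreal (D N f i x)))"

definition C\<^sub>U :: real where
  "C\<^sub>U = C\<^sub>R * (2 powr \<alpha>)\<^sup>2 * K + C\<^sub>s * K * C\<^sub>G * (1 + C\<^sub>P)"

lemma C\<^sub>G_nonneg: "0 \<le> C\<^sub>G" by (simp add: C\<^sub>G_def)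

lemma C\<^sub>U_nonneg: "0 \<le> C\<^sub>U"
  using C\<^sub>R_nonneg C_nonneg C\<^sub>G_nonneg C\<^sub>P_nonneg K_ge_1 by (simp add: C\<^sub>U_def)

lemma tail_measurable [measurable]:
  assumes [measurable]: "f \<in> borel_measurable \<mu>"
  shows "tail N f k \<in> borel_measurable \<mu>"
proof -
  have [measurable]: "D N f i \<in> borel_measurable \<mu>" for i by (rule D_measurable[OF assms])
  show ?thesis unfolding tail_def by measurable
qed

text \<open>Write \<open>f\<close> as \<open>coef f k x * G k x\<close>, plus the coarse error, plus the fine differences.\<close>

lemma theta_paraproduct_bound:
  assumes f: "f \<in> borel_measurable \<mu>" and sq: "L2_square \<mu> f < \<infinity>"
    and good: "good k x" and kN: "k \<le> N" and t: "side H k \<le> t" "t \<le> 2 * side H k"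
  shows "ennreal (norm (theta \<mu> s t f x))
    \<le> ennreal (norm (coef f k x) * norm (theta \<mu> s t (G k x) x)) + ennreal C\<^sub>U * tail N f k x"
proof -
  have t0: "0 < t" using t side_pos[OF H_pos, of k] by simp
  let ?\<Phi> = "\<lambda>y. coef f k x * G k x y" and ?L = "level N f"
  define E where "E i = ennreal (decay ^ ((k - i) + (i - k))) * (PD N f k i x + ennreal (D N f i x))" for i
  have iL: "integrable \<mu> (\<lambda>y. s t x y * ?L i y)" for i
    by (rule integrable_kernel_square[OF t0 level_measurable[OF f] level_square_finite[OF f sq]])
  have i\<Phi>: "integrable \<mu> (\<lambda>y. s t x y * ?\<Phi> y)"
  proof (rule integrable_kernel_bounded[OF t0])
    show "norm (?\<Phi> y) \<le> norm (coef f k x) * K" for y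
      unfolding norm_mult by (rule mult_left_mono[OF G_bound]) simp
  qed measurable
  have th_diff: "theta \<mu> s t (\<lambda>y. u y - v y) x = theta \<mu> s t u x - theta \<mu> s t v x"
    if "integrable \<mu> (\<lambda>y. s t x y * u y)" "integrable \<mu> (\<lambda>y. s t x y * v y)" for u v
    using Bochner_Integration.integral_diff[OF that] by (simp add: theta_def right_diff_distrib)
  have "theta \<mu> s t f x = theta \<mu> s t (?L (Suc N)) x" by (simp add: level_def)
  also have "\<dots> = theta \<mu> s t (?L k) x + (\<Sum>i = k..N. theta \<mu> s t (?L (Suc i)) x - theta \<mu> s t (?L i) x)"
    using sum_Suc_diff[of k N "\<lambda>i. theta \<mu> s t (?L i) x"] kN by simp
  also have "(\<Sum>i = k..N. theta \<mu> s t (?L (Suc i)) x - theta \<mu> s t (?L i) x)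
      = (\<Sum>i = k..N. theta \<mu> s t (\<lambda>y. ?L (Suc i) y - ?L i y) x)"
    by (intro sum.cong refl th_diff[symmetric] iL)
  also have "theta \<mu> s t (?L k) x = theta \<mu> s t ?\<Phi> x + theta \<mu> s t (\<lambda>y. ?L k y - ?\<Phi> y) x"
    using th_diff[OF iL i\<Phi>, of k] by simp
  also have "theta \<mu> s t ?\<Phi> x = coef f k x * theta \<mu> s t (G k x) x"
    unfolding theta_def mult.left_commute[of "s t x _" "coef f k x"] by (rule integral_mult_right_zero)
  finally have dec: "theta \<mu> s t f x = coef f k x * theta \<mu> s t (G k x) x + theta \<mu> s t (\<lambda>y. ?L k y - ?\<Phi> y) x
      + (\<Sum>i = k..N. theta \<mu> s t (\<lambda>y. ?L (Suc i) y - ?L i y) x)" .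
  have "norm (theta \<mu> s t f x) \<le> norm (coef f k x) * norm (theta \<mu> s t (G k x) x)
      + norm (theta \<mu> s t (\<lambda>y. ?L k y - ?\<Phi> y) x) + (\<Sum>i = k..N. norm (theta \<mu> s t (\<lambda>y. ?L (Suc i) y - ?L i y) x))"
    unfolding dec norm_mult[symmetric]
    by (intro order.trans[OF norm_triangle_ineq] add_mono norm_triangle_ineq norm_sum)
  then have "ennreal (norm (theta \<mu> s t f x)) \<le> ennreal (norm (coef f k x) * norm (theta \<mu> s t (G k x) x)
      + norm (theta \<mu> s t (\<lambda>y. ?L k y - ?\<Phi> y) x) + (\<Sum>i = k..N. norm (theta \<mu> s t (\<lambda>y. ?L (Suc i) y - ?L i y) x)))"
    by (rule ennreal_leI)
  also have "\<dots> = ennreal (norm (coef f k x) * norm (theta \<mu> s t (G k x) x))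
      + (ennreal (norm (theta \<mu> s t (\<lambda>y. ?L k y - ?\<Phi> y) x)) + (\<Sum>i = k..N. ennreal (norm (theta \<mu> s t (\<lambda>y. ?L (Suc i) y - ?L i y) x))))"
    by (simp add: sum_ennreal sum_nonneg add.assoc)
  also have "\<dots> \<le> ennreal (norm (coef f k x) * norm (theta \<mu> s t (G k x) x))
      + (ennreal (C\<^sub>s * K * C\<^sub>G * (1 + C\<^sub>P)) * tail N f k x + ennreal (C\<^sub>R * (2 powr \<alpha>)\<^sup>2 * K) * tail N f k x)"
  proof (intro add_left_mono add_mono)
    have "ennreal (norm (theta \<mu> s t (\<lambda>y. ?L k y - ?\<Phi> y) x))
        \<le> ennreal (C\<^sub>s * K * C\<^sub>G) * (\<Sum>i\<in>{..k}. ennreal (decay ^ (k - i)) * (PD N f k i x + ennreal (C\<^sub>P * D N f i x)))"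
      by (rule coarse_scale_bound[OF f good kN t])
    also have "\<dots> \<le> ennreal (C\<^sub>s * K * C\<^sub>G) * (\<Sum>i\<in>{..k}. ennreal (1 + C\<^sub>P) * E i)"
    proof (intro mult_left_mono sum_mono)
      fix i assume i: "i \<in> {..k}"
      have "PD N f k i x + ennreal (C\<^sub>P * D N f i x) \<le> ennreal (1 + C\<^sub>P) * (PD N f k i x + ennreal (D N f i x))"
      proof -
        have "PD N f k i x + ennreal (C\<^sub>P * D N f i x) = 1 * PD N f k i x + ennreal C\<^sub>P * ennreal (D N f i x)"
          using C\<^sub>P_nonneg by (simp add: ennreal_mult D_nonneg)
        also have "\<dots> \<le> ennreal (1 + C\<^sub>P) * PD N f k i x + ennreal (1 + C\<^sub>P) * ennreal (D N f i x)"
          by (intro add_mono mult_right_mono) (use C\<^sub>P_nonneg in \<open>auto simp flip: ennreal_1 intro!: ennreal_leI\<close>)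
        finally show ?thesis by (simp only: distrib_left)
      qed
      then have "ennreal (decay ^ (k - i)) * (PD N f k i x + ennreal (C\<^sub>P * D N f i x))
          \<le> ennreal (decay ^ (k - i)) * (ennreal (1 + C\<^sub>P) * (PD N f k i x + ennreal (D N f i x)))"
        by (rule mult_left_mono) simp
      also have "\<dots> = ennreal (1 + C\<^sub>P) * E i" using i by (simp add: E_def mult.left_commute)
      finally show "ennreal (decay ^ (k - i)) * (PD N f k i x + ennreal (C\<^sub>P * D N f i x)) \<le> ennreal (1 + C\<^sub>P) * E i" .
    qed simp
    also have "\<dots> = ennreal (C\<^sub>s * K * C\<^sub>G * (1 + C\<^sub>P)) * (\<Sum>i\<in>{..k}. E i)"
    proof -
      have "ennreal (C\<^sub>s * K * C\<^sub>G * (1 + C\<^sub>P)) = ennreal (C\<^sub>s * K * C\<^sub>G) * ennreal (1 + C\<^sub>P)"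
        by (rule ennreal_mult) (use C_nonneg C\<^sub>G_nonneg K_ge_1 C\<^sub>P_nonneg in auto)
      then show ?thesis by (simp only: sum_distrib_left[symmetric] mult.assoc)
    qed
    also have "\<dots> \<le> ennreal (C\<^sub>s * K * C\<^sub>G * (1 + C\<^sub>P)) * tail N f k x"
      unfolding tail_def E_def by (intro mult_left_mono sum_mono2) (use kN in auto)
    finally show "ennreal (norm (theta \<mu> s t (\<lambda>y. ?L k y - ?\<Phi> y) x)) \<le> ennreal (C\<^sub>s * K * C\<^sub>G * (1 + C\<^sub>P)) * tail N f k x" .
    have "(\<Sum>i = k..N. ennreal (norm (theta \<mu> s t (\<lambda>y. ?L (Suc i) y - ?L i y) x)))
        \<le> (\<Sum>i = k..N. ennreal (C\<^sub>R * (2 powr \<alpha>)\<^sup>2 * K) * E (Suc i))"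
    proof (rule sum_mono)
      fix i assume i: "i \<in> {k..N}"
      have "ennreal (norm (theta \<mu> s t (\<lambda>y. ?L (Suc i) y - ?L i y) x))
          \<le> ennreal (C\<^sub>R * (2 powr \<alpha>)\<^sup>2 * K) * (ennreal (decay ^ (Suc i - k)) * PD N f k (Suc i) x)"
        by (rule fine_scale_bound[OF f sq _ _ t]) (use i in auto)
      also have "\<dots> \<le> ennreal (C\<^sub>R * (2 powr \<alpha>)\<^sup>2 * K) * E (Suc i)"
        unfolding E_def using i by (intro mult_left_mono mult_mono) auto
      finally show "ennreal (norm (theta \<mu> s t (\<lambda>y. ?L (Suc i) y - ?L i y) x)) \<le> ennreal (C\<^sub>R * (2 powr \<alpha>)\<^sup>2 * K) * E (Suc i)" .
    qed
    also have "\<dots> = ennreal (C\<^sub>R * (2 powr \<alpha>)\<^sup>2 * K) * (\<Sum>i = Suc k..Suc N. E i)"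
      by (simp only: sum.shift_bounds_cl_Suc_ivl sum_distrib_left)
    also have "\<dots> \<le> ennreal (C\<^sub>R * (2 powr \<alpha>)\<^sup>2 * K) * tail N f k x"
      unfolding tail_def E_def by (intro mult_left_mono sum_mono2) auto
    finally show "(\<Sum>i = k..N. ennreal (norm (theta \<mu> s t (\<lambda>y. ?L (Suc i) y - ?L i y) x)))
        \<le> ennreal (C\<^sub>R * (2 powr \<alpha>)\<^sup>2 * K) * tail N f k x" .
  qed
  also have "ennreal (C\<^sub>s * K * C\<^sub>G * (1 + C\<^sub>P)) * tail N f k x + ennreal (C\<^sub>R * (2 powr \<alpha>)\<^sup>2 * K) * tail N f k x
      = ennreal C\<^sub>U * tail N f k x"
  proof -
    have "ennreal C\<^sub>U = ennreal (C\<^sub>R * (2 powr \<alpha>)\<^sup>2 * K) + ennreal (C\<^sub>s * K * C\<^sub>G * (1 + C\<^sub>P))"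
      unfolding C\<^sub>U_def by (rule ennreal_plus) (use C\<^sub>R_nonneg C_nonneg C\<^sub>G_nonneg K_ge_1 C\<^sub>P_nonneg in auto)
    then show ?thesis by (simp only: distrib_right add.commute)
  qed
  finally show ?thesis .
qed

text \<open>Twice the sum of the geometric series of ratio \<open>decay\<close>.\<close>

definition W :: real where "W = 2 / (1 - decay)"

lemma W_nonneg: "0 \<le> W" using decay by (simp add: W_def)

lemma sum_decay_le: "(\<Sum>i\<in>{..n}. ennreal (decay ^ ((k - i) + (i - k)))) \<le> ennreal W"
proof -
  have "(\<Sum>i\<in>{..n}. ennreal (decay ^ ((k - i) + (i - k)))) = ennreal (\<Sum>i\<in>{..n}. decay ^ ((k - i) + (i - k)))"
    by (rule sum_ennreal) (use decay in simp)
  also have "\<dots> \<le> ennreal W"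
    unfolding W_def by (intro ennreal_leI sum_power_abs_diff_le) (use decay in auto)
  finally show ?thesis .
qed

text \<open>By Cauchy-Schwarz with the weights \<open>decay ^ |k - i|\<close>, whose sums over \<open>i\<close> and over \<open>k\<close> are at most \<open>W\<close>,
  everything reduces to the norms of the functions \<open>D N f i\<close>, and Schur's test handles the averages.\<close>

lemma sum_tail_square_le:
  assumes f: "f \<in> borel_measurable \<mu>" and sq: "L2_square \<mu> f < \<infinity>"
  shows "(\<Sum>k<N. \<integral>\<^sup>+x. (tail N f k x)\<^sup>2 \<partial>\<mu>)
    \<le> ennreal (W\<^sup>2 * (2 * C\<^sub>P\<^sup>2 + 2) * square_const) * L2_square \<mu> f"
proof -
  note [measurable] = f D_measurable[OF f]
  define c where "c k i = ennreal (decay ^ ((k - i) + (i - k)))" for k i :: nat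
  define V where "V k i x = PD N f k i x + ennreal (D N f i x)" for k i x
  have [measurable]: "V k i \<in> borel_measurable \<mu>" for k i unfolding V_def by measurable
  define d where "d i = (\<integral>\<^sup>+x. ennreal ((D N f i x)\<^sup>2) \<partial>\<mu>)" for i
  have V: "(\<integral>\<^sup>+x. (V k i x)\<^sup>2 \<partial>\<mu>) \<le> ennreal (2 * C\<^sub>P\<^sup>2 + 2) * d i" for k i
  proof -
    have e: "(ennreal (D N f i x))\<^sup>2 = ennreal ((D N f i x)\<^sup>2)" for x by (simp add: ennreal_power D_nonneg)
    have "(\<integral>\<^sup>+x. (V k i x)\<^sup>2 \<partial>\<mu>) \<le> (\<integral>\<^sup>+x. 2 * (PD N f k i x)\<^sup>2 + 2 * ennreal ((D N f i x)\<^sup>2) \<partial>\<mu>)"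
      unfolding V_def e[symmetric] by (intro nn_integral_mono ennreal_square_sum_le)
    also have "\<dots> = 2 * (\<integral>\<^sup>+x. (PD N f k i x)\<^sup>2 \<partial>\<mu>) + 2 * d i"
      by (simp add: nn_integral_add nn_integral_cmult d_def)
    also have "\<dots> \<le> 2 * (ennreal (C\<^sub>P\<^sup>2) * d i) + 2 * d i"
      unfolding PD_def d_def e[symmetric]
      by (intro add_right_mono mult_left_mono schur side_pos[OF H_pos]) auto
    also have "\<dots> = ennreal (2 * C\<^sub>P\<^sup>2 + 2) * d i" by (simp add: ennreal_mult distrib_right mult.assoc)
    finally show ?thesis .
  qed
  have one: "(\<integral>\<^sup>+x. (tail N f k x)\<^sup>2 \<partial>\<mu>) \<le> ennreal (W * (2 * C\<^sub>P\<^sup>2 + 2)) * (\<Sum>i\<in>{..Suc N}. c k i * d i)" for k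
  proof -
    have "(\<integral>\<^sup>+x. (tail N f k x)\<^sup>2 \<partial>\<mu>) \<le> (\<integral>\<^sup>+x. ennreal W * (\<Sum>i\<in>{..Suc N}. c k i * (V k i x)\<^sup>2) \<partial>\<mu>)"
    proof (rule nn_integral_mono)
      fix x
      have "(tail N f k x)\<^sup>2 \<le> (\<Sum>i\<in>{..Suc N}. c k i) * (\<Sum>i\<in>{..Suc N}. c k i * (V k i x)\<^sup>2)"
        unfolding tail_def c_def V_def by (rule ennreal_weighted_square_sum_le)
      also have "\<dots> \<le> ennreal W * (\<Sum>i\<in>{..Suc N}. c k i * (V k i x)\<^sup>2)"
        unfolding c_def by (rule mult_right_mono[OF sum_decay_le]) simp
      finally show "(tail N f k x)\<^sup>2 \<le> ennreal W * (\<Sum>i\<in>{..Suc N}. c k i * (V k i x)\<^sup>2)" .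
    qed
    also have "\<dots> = ennreal W * (\<Sum>i\<in>{..Suc N}. c k i * (\<integral>\<^sup>+x. (V k i x)\<^sup>2 \<partial>\<mu>))"
      by (simp add: nn_integral_cmult nn_integral_sum del: sum.atMost_Suc)
    also have "\<dots> \<le> ennreal W * (\<Sum>i\<in>{..Suc N}. c k i * (ennreal (2 * C\<^sub>P\<^sup>2 + 2) * d i))"
      by (intro mult_left_mono sum_mono V) auto
    also have "\<dots> = ennreal W * (ennreal (2 * C\<^sub>P\<^sup>2 + 2) * (\<Sum>i\<in>{..Suc N}. c k i * d i))"
      by (simp only: mult.left_commute[of "c k _"] sum_distrib_left[symmetric])
    also have "\<dots> = ennreal (W * (2 * C\<^sub>P\<^sup>2 + 2)) * (\<Sum>i\<in>{..Suc N}. c k i * d i)"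
    proof -
      have "ennreal (W * (2 * C\<^sub>P\<^sup>2 + 2)) = ennreal W * ennreal (2 * C\<^sub>P\<^sup>2 + 2)"
        by (rule ennreal_mult) (use W_nonneg in auto)
      then show ?thesis by (simp only: mult.assoc)
    qed
    finally show ?thesis .
  qed
  have sum_d: "(\<Sum>i\<in>{..Suc N}. d i) \<le> ennreal square_const * L2_square \<mu> f"
  proof -
    have "(\<Sum>i\<in>{..N}. d i) = (\<Sum>i\<in>{..N}. \<integral>\<^sup>+x. ennreal ((jump f i x)\<^sup>2) \<partial>\<mu>)"
      by (rule sum.cong) (auto simp: d_def D_def)
    moreover have "d (Suc N) = (\<integral>\<^sup>+x. ennreal ((norm (f x - adapted f N x))\<^sup>2) \<partial>\<mu>)" by (simp add: d_def D_def)
    ultimately show ?thesis using adapted_square_function[OF f sq, of N] by simp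
  qed
  have "(\<Sum>k<N. \<integral>\<^sup>+x. (tail N f k x)\<^sup>2 \<partial>\<mu>) \<le> (\<Sum>k<N. ennreal (W * (2 * C\<^sub>P\<^sup>2 + 2)) * (\<Sum>i\<in>{..Suc N}. c k i * d i))"
    by (rule sum_mono[OF one])
  also have "\<dots> = ennreal (W * (2 * C\<^sub>P\<^sup>2 + 2)) * (\<Sum>i\<in>{..Suc N}. (\<Sum>k<N. c k i) * d i)"
    unfolding sum_distrib_left[symmetric] sum_distrib_right by (subst sum.swap) (rule refl)
  also have "\<dots> \<le> ennreal (W * (2 * C\<^sub>P\<^sup>2 + 2)) * (\<Sum>i\<in>{..Suc N}. ennreal W * d i)"
  proof (intro mult_left_mono sum_mono mult_right_mono)
    fix i
    have "(\<Sum>k<N. c k i) \<le> (\<Sum>k\<in>{..N}. c k i)" by (rule sum_mono2) auto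
    also have "\<dots> = (\<Sum>k\<in>{..N}. ennreal (decay ^ ((i - k) + (k - i))))" by (simp add: c_def add.commute)
    also have "\<dots> \<le> ennreal W" by (rule sum_decay_le)
    finally show "(\<Sum>k<N. c k i) \<le> ennreal W" .
  qed auto
  also have "\<dots> \<le> ennreal (W * (2 * C\<^sub>P\<^sup>2 + 2)) * (ennreal W * (ennreal square_const * L2_square \<mu> f))"
    unfolding sum_distrib_left[symmetric] by (intro mult_left_mono sum_d) auto
  also have "\<dots> = ennreal (W\<^sup>2 * (2 * C\<^sub>P\<^sup>2 + 2) * square_const) * L2_square \<mu> f"
  proof -
    have sc: "0 \<le> square_const"
      using K_ge_1 \<delta>_pos by (auto simp: square_const_def jump_const_def packing_const_def)
    have "W\<^sup>2 * (2 * C\<^sub>P\<^sup>2 + 2) * square_const = (W * (2 * C\<^sub>P\<^sup>2 + 2)) * (W * square_const)"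
      by (simp add: power2_eq_square)
    also have "ennreal \<dots> = ennreal (W * (2 * C\<^sub>P\<^sup>2 + 2)) * ennreal (W * square_const)"
      by (rule ennreal_mult) (use W_nonneg sc in auto)
    also have "ennreal (W * square_const) = ennreal W * ennreal square_const"
      by (rule ennreal_mult) (use W_nonneg sc in auto)
    finally show ?thesis by (simp only: mult.assoc)
  qed
  finally show ?thesis .
qed

text \<open>The bound for \<open>|\<theta>\<^sub>t f|\<close>, squared and integrated over one dyadic range of \<open>t\<close>. On it \<open>1/t\<close> is at most
  \<open>1 / side H k\<close>, so that its integral is at most one.\<close>

lemma good_part_bound:
  assumes f: "f \<in> borel_measurable \<mu>" and sq: "L2_square \<mu> f < \<infinity>" and kN: "k \<le> N"
  shows "good_part f k x \<le> ennreal (2 * (2 / \<delta>)\<^sup>2) * (good_part (G k x) k x * ennreal ((avg k (\<lambda>y. norm (f y)) x)\<^sup>2))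
    + ennreal (2 * C\<^sub>U\<^sup>2) * (tail N f k x)\<^sup>2"
proof (cases "good k x")
  case True
  note [measurable] = f
  let ?J = "{side H k..<2 * side H k}" and ?g = "G k x"
  have sk: "0 < side H k" by (rule side_pos[OF H_pos])
  define A where "A = norm (coef f k x)"
  have A: "A\<^sup>2 \<le> (2 / \<delta>)\<^sup>2 * (avg k (\<lambda>y. norm (f y)) x)\<^sup>2"
  proof -
    have "A \<le> 2 / \<delta> * norm (avg k f x)" unfolding A_def by (rule coef_bound)
    also have "\<dots> \<le> 2 / \<delta> * avg k (\<lambda>y. norm (f y)) x"
      using \<delta>_pos by (intro mult_left_mono norm_avg_le locally_integrableI_square[OF f sq]) auto
    finally have "A\<^sup>2 \<le> (2 / \<delta> * avg k (\<lambda>y. norm (f y)) x)\<^sup>2" by (rule power_mono) (simp add: A_def)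
    then show ?thesis by (simp only: power_mult_distrib)
  qed
  have pt: "square_density f x t \<le> ennreal (2 * A\<^sup>2) * square_density ?g x t + ennreal (2 * C\<^sub>U\<^sup>2) * (tail N f k x)\<^sup>2 * ennreal (1 / side H k)"
    if t: "t \<in> ?J" for t
  proof -
    have t0: "0 < t" using t sk by auto
    let ?th = "norm (theta \<mu> s t f x)" and ?tg = "norm (theta \<mu> s t ?g x)"
    have "(ennreal ?th)\<^sup>2 \<le> (ennreal (A * ?tg) + ennreal C\<^sub>U * tail N f k x)\<^sup>2"
      unfolding A_def by (rule power_mono[OF theta_paraproduct_bound[OF f sq True kN]]) (use t in auto)
    also have "\<dots> \<le> 2 * (ennreal (A * ?tg))\<^sup>2 + 2 * (ennreal C\<^sub>U * tail N f k x)\<^sup>2" by (rule ennreal_square_sum_le)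
    also have "2 * (ennreal C\<^sub>U * tail N f k x)\<^sup>2 = ennreal (2 * C\<^sub>U\<^sup>2) * (tail N f k x)\<^sup>2"
      using C\<^sub>U_nonneg by (simp add: power_mult_distrib ennreal_power ennreal_mult mult.assoc)
    also have "2 * (ennreal (A * ?tg))\<^sup>2 = ennreal (2 * A\<^sup>2 * ?tg\<^sup>2)"
      by (simp add: A_def power_mult_distrib ennreal_power ennreal_mult mult.assoc)
    finally have sqr: "ennreal (?th\<^sup>2) \<le> ennreal (2 * A\<^sup>2 * ?tg\<^sup>2) + ennreal (2 * C\<^sub>U\<^sup>2) * (tail N f k x)\<^sup>2"
      by (simp add: ennreal_power)
    have "square_density f x t = ennreal (?th\<^sup>2) * ennreal (1 / t)"
      using t0 by (simp add: square_density_def ennreal_mult[symmetric])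
    also have "\<dots> \<le> (ennreal (2 * A\<^sup>2 * ?tg\<^sup>2) + ennreal (2 * C\<^sub>U\<^sup>2) * (tail N f k x)\<^sup>2) * ennreal (1 / t)"
      by (rule mult_right_mono[OF sqr]) simp
    also have "\<dots> = ennreal (2 * A\<^sup>2 * ?tg\<^sup>2) * ennreal (1 / t) + ennreal (2 * C\<^sub>U\<^sup>2) * (tail N f k x)\<^sup>2 * ennreal (1 / t)"
      by (rule distrib_right)
    also have "ennreal (2 * A\<^sup>2 * ?tg\<^sup>2) * ennreal (1 / t) = ennreal (2 * A\<^sup>2) * square_density ?g x t"
      using t0 by (simp add: square_density_def ennreal_mult[symmetric])
    also have "ennreal (2 * A\<^sup>2) * square_density ?g x t + ennreal (2 * C\<^sub>U\<^sup>2) * (tail N f k x)\<^sup>2 * ennreal (1 / t)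
        \<le> ennreal (2 * A\<^sup>2) * square_density ?g x t + ennreal (2 * C\<^sub>U\<^sup>2) * (tail N f k x)\<^sup>2 * ennreal (1 / side H k)"
      using t sk by (intro add_left_mono mult_left_mono ennreal_leI divide_left_mono) auto
    finally show ?thesis .
  qed
  have "good_part f k x = (\<integral>\<^sup>+t\<in>?J. square_density f x t \<partial>lborel)" using True by (simp add: good_part_def)
  also have "\<dots> \<le> (\<integral>\<^sup>+t. ennreal (2 * A\<^sup>2) * (square_density ?g x t * indicator ?J t)
      + (ennreal (2 * C\<^sub>U\<^sup>2) * (tail N f k x)\<^sup>2 * ennreal (1 / side H k)) * indicator ?J t \<partial>lborel)"
  proof (rule nn_integral_mono)
    fix t
    show "square_density f x t * indicator ?J t \<le> ennreal (2 * A\<^sup>2) * (square_density ?g x t * indicator ?J t)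
      + (ennreal (2 * C\<^sub>U\<^sup>2) * (tail N f k x)\<^sup>2 * ennreal (1 / side H k)) * indicator ?J t"
      using pt[of t] by (cases "t \<in> ?J") auto
  qed
  also have "\<dots> = ennreal (2 * A\<^sup>2) * (\<integral>\<^sup>+t\<in>?J. square_density ?g x t \<partial>lborel)
      + (ennreal (2 * C\<^sub>U\<^sup>2) * (tail N f k x)\<^sup>2 * ennreal (1 / side H k)) * emeasure lborel ?J"
    by (subst nn_integral_add, measurable, subst nn_integral_cmult, measurable, subst nn_integral_cmult_indicator) auto
  also have "\<dots> = ennreal (2 * A\<^sup>2) * good_part ?g k x + ennreal (2 * C\<^sub>U\<^sup>2) * (tail N f k x)\<^sup>2"
  proof -
    have "ennreal (1 / side H k) * emeasure lborel ?J = 1"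
      using sk by (simp add: ennreal_mult[symmetric])
    then show ?thesis using True by (simp add: good_part_def mult.assoc)
  qed
  also have "\<dots> \<le> ennreal (2 * ((2 / \<delta>)\<^sup>2 * (avg k (\<lambda>y. norm (f y)) x)\<^sup>2)) * good_part ?g k x + ennreal (2 * C\<^sub>U\<^sup>2) * (tail N f k x)\<^sup>2"
    by (intro add_right_mono mult_right_mono ennreal_leI mult_left_mono A) auto
  also have "ennreal (2 * ((2 / \<delta>)\<^sup>2 * (avg k (\<lambda>y. norm (f y)) x)\<^sup>2)) = ennreal (2 * (2 / \<delta>)\<^sup>2) * ennreal ((avg k (\<lambda>y. norm (f y)) x)\<^sup>2)"
    by (subst ennreal_mult[symmetric]) (auto simp: mult.assoc)
  finally show ?thesis by (simp only: mult.assoc mult.commute[of "good_part (G k x) k x"])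
qed (simp add: good_part_def)

text \<open>The summand one makes the constant positive, as the embedding theorem requires.\<close>

definition para_const :: real where
  "para_const = (whitney_const K C\<^sub>t + 1) * (1 + packing_const)"

definition grid_const :: real where
  "grid_const = 2 * (2 / \<delta>)\<^sup>2 * (4 * para_const) + 2 * C\<^sub>U\<^sup>2 * (W\<^sup>2 * (2 * C\<^sub>P\<^sup>2 + 2) * square_const)"

lemma whitney_const_nonneg: "0 \<le> whitney_const K C\<^sub>t"
  using C\<^sub>t_nonneg T\<^sub>W_ge_1 by (simp add: whitney_const_def)

text \<open>For a single test function this is \<open>whitney_packing\<close>; the stopping structure allows the test function to vary.\<close>

lemma good_part_paraproduct_packing:
  assumes "j \<le> N"
  shows "(\<integral>\<^sup>+y\<in>cell j x. (\<Sum>k\<in>{j..<N}. good_part (G k y) k y) \<partial>\<mu>) \<le> ennreal para_const * emeasure \<mu> (cell j x)"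
  unfolding G_def para_const_def
proof (rule paraproduct_packing[where p = "\<lambda>k l z. good_part (b l z) k"])
  fix l z j x
  have "(\<integral>\<^sup>+y\<in>cell j x. (\<Sum>k\<in>{j..<N}. good_part (b l z) k y) \<partial>\<mu>) \<le> ennreal (whitney_const K C\<^sub>t) * emeasure \<mu> (cell j x)"
    by (rule whitney_packing[OF b_measurable b_bound C\<^sub>t_nonneg testing])
  also have "\<dots> \<le> ennreal (whitney_const K C\<^sub>t + 1) * emeasure \<mu> (cell j x)"
    by (intro mult_right_mono ennreal_leI) auto
  finally show "(\<integral>\<^sup>+y\<in>cell j x. (\<Sum>k\<in>{j..<N}. good_part (b l z) k y) \<partial>\<mu>)
      \<le> ennreal (whitney_const K C\<^sub>t + 1) * emeasure \<mu> (cell j x)" .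
qed (use assms whitney_const_nonneg in auto)

theorem good_square_function_bound:
  assumes f: "f \<in> borel_measurable \<mu>" and sq: "L2_square \<mu> f < \<infinity>"
  shows "(\<Sum>k<N. \<integral>\<^sup>+x. good_part f k x \<partial>\<mu>) \<le> ennreal grid_const * L2_square \<mu> f"
proof -
  let ?F = "\<integral>\<^sup>+x. ennreal ((norm (f x))\<^sup>2) \<partial>\<mu>" and ?u = "\<lambda>k x. ennreal ((avg k (\<lambda>y. norm (f y)) x)\<^sup>2)"
  note [measurable] = f
  have fl: "locally_integrable f" by (rule locally_integrableI_square[OF f sq])
  have [measurable]: "(\<lambda>x. good_part (G k x) k x) \<in> borel_measurable \<mu>" for k
    unfolding G_def by (rule stopped_measurable) measurable
  have pk: "0 < packing_const" using K_ge_1 \<delta>_pos by (auto simp: packing_const_def add_nonneg_pos)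
  have pc: "0 < para_const"
    unfolding para_const_def using whitney_const_nonneg pk by (intro mult_pos_pos) auto
  have sc: "0 \<le> square_const"
    using K_ge_1 \<delta>_pos by (auto simp: square_const_def jump_const_def packing_const_def)
  have "(\<Sum>k<N. \<integral>\<^sup>+x. good_part f k x \<partial>\<mu>) \<le> (\<Sum>k<N. \<integral>\<^sup>+x. ennreal (2 * (2 / \<delta>)\<^sup>2) * (good_part (G k x) k x * ?u k x)
    + ennreal (2 * C\<^sub>U\<^sup>2) * (tail N f k x)\<^sup>2 \<partial>\<mu>)"
    by (intro sum_mono nn_integral_mono good_part_bound f sq) auto
  also have "\<dots> = ennreal (2 * (2 / \<delta>)\<^sup>2) * (\<integral>\<^sup>+x. (\<Sum>k<N. good_part (G k x) k x * ?u k x) \<partial>\<mu>)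
      + ennreal (2 * C\<^sub>U\<^sup>2) * (\<Sum>k<N. \<integral>\<^sup>+x. (tail N f k x)\<^sup>2 \<partial>\<mu>)"
    by (simp add: nn_integral_add nn_integral_cmult nn_integral_sum sum.distrib flip: sum_distrib_left)
  also have "\<dots> \<le> ennreal (2 * (2 / \<delta>)\<^sup>2) * (ennreal (4 * para_const) * ?F)
      + ennreal (2 * C\<^sub>U\<^sup>2) * (ennreal (W\<^sup>2 * (2 * C\<^sub>P\<^sup>2 + 2) * square_const) * ?F)"
  proof (intro add_mono mult_left_mono sum_tail_square_le f sq)
    have "(\<integral>\<^sup>+x. (\<Sum>k<N. good_part (G k x) k x * ?u k x) \<partial>\<mu>) \<le> ennreal (4 * para_const) * L2_square \<mu> f"
      by (rule carleson_embedding[OF locally_integrable_norm[OF fl] _ _ pc good_part_paraproduct_packing]) auto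
    then show "(\<integral>\<^sup>+x. (\<Sum>k<N. good_part (G k x) k x * ?u k x) \<partial>\<mu>) \<le> ennreal (4 * para_const) * ?F" .
  qed auto
  also have "\<dots> = ennreal grid_const * ?F"
  proof -
    have "ennreal grid_const = ennreal (2 * (2 / \<delta>)\<^sup>2 * (4 * para_const)) + ennreal (2 * C\<^sub>U\<^sup>2 * (W\<^sup>2 * (2 * C\<^sub>P\<^sup>2 + 2) * square_const))"
      unfolding grid_const_def by (rule ennreal_plus) (use pc sc in auto)
    also have "ennreal (2 * (2 / \<delta>)\<^sup>2 * (4 * para_const)) = ennreal (2 * (2 / \<delta>)\<^sup>2) * ennreal (4 * para_const)"
      by (rule ennreal_mult) (use pc in auto)
    also have "ennreal (2 * C\<^sub>U\<^sup>2 * (W\<^sup>2 * (2 * C\<^sub>P\<^sup>2 + 2) * square_const))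
        = ennreal (2 * C\<^sub>U\<^sup>2) * ennreal (W\<^sup>2 * (2 * C\<^sub>P\<^sup>2 + 2) * square_const)"
      by (rule ennreal_mult) (use sc in auto)
    finally show ?thesis by (simp only: distrib_right mult.assoc)
  qed
  finally show ?thesis .
qed

end

section \<open>Averaging over the shifts\<close>

context kernel_family begin

text \<open>For fixed coordinate and level \<open>i\<close> the bad shifts lie in intervals of length \<open>2 c\<^sub>0 \<rho> ^ (k - i) side H i\<close> around
  the points \<open>x $ e - z * side H i\<close>, and at most \<open>2 ^ i + 3\<close> of these points matter for \<open>0 \<le> \<tau> \<le> H\<close>.\<close>

lemma bad_shifts_small:
  fixes x :: "real ^ 'n"
  assumes H: "0 < H"
  shows "emeasure lborel {\<tau> \<in> {0..H}. \<not> good_point c\<^sub>0 \<rho> \<tau> H k x} \<le> ennreal (H / 2)"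
proof -
  define r where "r i = c\<^sub>0 * \<rho> ^ (k - i) * side H i" for i
  define Z where "Z i e = {\<lfloor>x $ e / side H i\<rfloor> - 2 ^ i - 1 .. \<lfloor>x $ e / side H i\<rfloor> + 1}" for i e
  define B where "B i e z = {x $ e - real_of_int z * side H i - r i <..< x $ e - real_of_int z * side H i + r i}" for i e z
  have s: "0 < side H i" for i by (rule side_pos[OF H])
  have r: "0 < r i" "r i \<le> side H i" for i
  proof -
    have "c\<^sub>0 * \<rho> ^ (k - i) \<le> 1" using c\<^sub>0 \<rho> by (intro mult_le_one power_le_one) auto
    then show "r i \<le> side H i" using s[of i] by (simp add: r_def mult_le_cancel_right1)
    show "0 < r i" using c\<^sub>0 \<rho> s[of i] by (simp add: r_def)
  qed
  have sub: "{\<tau> \<in> {0..H}. \<not> good_point c\<^sub>0 \<rho> \<tau> H k x} \<subseteq> (\<Union>i\<in>{..k}. \<Union>e\<in>UNIV. \<Union>z\<in>Z i e. B i e z)"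
  proof
    fix \<tau> assume "\<tau> \<in> {\<tau> \<in> {0..H}. \<not> good_point c\<^sub>0 \<rho> \<tau> H k x}"
    then obtain i e z where \<tau>: "0 \<le> \<tau>" "\<tau> \<le> H" and i: "i \<le> k"
      and bad: "\<bar>x $ e - \<tau> - real_of_int z * side H i\<bar> < r i"
      by (auto simp: good_point_def r_def not_le)
    have "real_of_int z * side H i < x $ e + side H i" using bad r[of i] \<tau> by linarith
    then have "real_of_int z < x $ e / side H i + 1" using s[of i] by (simp add: field_simps)
    then have 1: "z \<le> \<lfloor>x $ e / side H i\<rfloor> + 1" by linarith
    have Hs: "H = 2 ^ i * side H i" by (simp add: side_def)
    have "x $ e - H - side H i < real_of_int z * side H i" using bad r[of i] \<tau> by linarith
    then have "x $ e - (2 ^ i + 1) * side H i < real_of_int z * side H i"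
      by (subst (asm) Hs) (simp add: algebra_simps)
    then have "x $ e / side H i - (2 ^ i + 1) < real_of_int z" using s[of i] by (simp add: field_simps)
    then have "real_of_int \<lfloor>x $ e / side H i\<rfloor> - (2 ^ i + 1) < real_of_int z"
      by (rule le_less_trans[rotated]) simp
    then have "real_of_int (\<lfloor>x $ e / side H i\<rfloor> - 2 ^ i - 1) < real_of_int z" by simp
    then have 2: "\<lfloor>x $ e / side H i\<rfloor> - 2 ^ i - 1 \<le> z" by (simp only: of_int_less_iff)
    have "\<tau> \<in> B i e z" using bad unfolding B_def by (simp add: abs_less_iff)
    moreover have "z \<in> Z i e" unfolding Z_def using 1 2 by simp
    ultimately show "\<tau> \<in> (\<Union>i\<in>{..k}. \<Union>e\<in>UNIV. \<Union>z\<in>Z i e. B i e z)"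
      using i by blast
  qed
  have B: "emeasure lborel (B i e z) = ennreal (2 * r i)" for i e z
    unfolding B_def using r(1)[of i] by (subst emeasure_lborel_Ioo) auto
  have Bm: "B i e z \<in> sets lborel" for i e z unfolding B_def by simp
  have card: "real (card (Z i e)) \<le> 4 * 2 ^ i" for i e
  proof -
    have "real (card (Z i e)) = 2 ^ i + 3" unfolding Z_def by (simp add: nat_add_distrib nat_power_eq)
    also have "\<dots> \<le> 4 * 2 ^ i" using one_le_power[of "2 :: real" i] by simp
    finally show ?thesis .
  qed
  have fin: "finite (Z i e)" for i e by (simp add: Z_def)
  have "emeasure lborel {\<tau> \<in> {0..H}. \<not> good_point c\<^sub>0 \<rho> \<tau> H k x}
      \<le> emeasure lborel (\<Union>i\<in>{..k}. \<Union>e\<in>UNIV. \<Union>z\<in>Z i e. B i e z)"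
    by (rule emeasure_mono[OF sub]) (use Bm fin in \<open>auto intro!: sets.finite_UN\<close>)
  also have "\<dots> \<le> (\<Sum>i\<in>{..k}. emeasure lborel (\<Union>e\<in>UNIV. \<Union>z\<in>Z i e. B i e z))"
    by (rule emeasure_subadditive_finite) (use Bm fin in \<open>auto intro!: sets.finite_UN\<close>)
  also have "\<dots> \<le> (\<Sum>i\<in>{..k}. \<Sum>e\<in>UNIV. emeasure lborel (\<Union>z\<in>Z i e. B i e z))"
    by (intro sum_mono emeasure_subadditive_finite) (use Bm fin in \<open>auto intro!: sets.finite_UN\<close>)
  also have "\<dots> \<le> (\<Sum>i\<in>{..k}. \<Sum>e\<in>(UNIV :: 'n set). \<Sum>z\<in>Z i e. emeasure lborel (B i e z))"
    by (intro sum_mono emeasure_subadditive_finite) (use Bm fin in auto)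
  also have "\<dots> = (\<Sum>i\<in>{..k}. \<Sum>e\<in>(UNIV :: 'n set). ennreal (real (card (Z i e)) * (2 * r i)))"
    using r(1) by (simp add: B ennreal_mult less_imp_le flip: ennreal_of_nat_eq_real_of_nat)
  also have "\<dots> \<le> (\<Sum>i\<in>{..k}. \<Sum>e\<in>(UNIV :: 'n set). ennreal (4 * 2 ^ i * (2 * r i)))"
    using r(1) by (intro sum_mono ennreal_leI mult_right_mono card) (simp add: less_imp_le)
  also have "\<dots> = (\<Sum>i\<in>{..k}. ennreal (8 * real CARD('n) * c\<^sub>0 * H * \<rho> ^ (k - i)))"
  proof (rule sum.cong)
    fix i
    have "(\<Sum>e\<in>(UNIV :: 'n set). ennreal (4 * 2 ^ i * (2 * r i))) = ennreal (real CARD('n)) * ennreal (4 * 2 ^ i * (2 * r i))"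
      by (simp add: ennreal_of_nat_eq_real_of_nat)
    also have "\<dots> = ennreal (real CARD('n) * (4 * 2 ^ i * (2 * r i)))"
      using r(1)[of i] by (intro ennreal_mult[symmetric]) auto
    also have "real CARD('n) * (4 * 2 ^ i * (2 * r i)) = 8 * real CARD('n) * c\<^sub>0 * H * \<rho> ^ (k - i)"
      by (simp add: r_def side_def)
    finally show "(\<Sum>e\<in>(UNIV :: 'n set). ennreal (4 * 2 ^ i * (2 * r i))) = ennreal (8 * real CARD('n) * c\<^sub>0 * H * \<rho> ^ (k - i))" .
  qed simp
  also have "\<dots> = ennreal (\<Sum>i\<in>{..k}. 8 * real CARD('n) * c\<^sub>0 * H * \<rho> ^ (k - i))"
    by (rule sum_ennreal) (use c\<^sub>0 \<rho> H in auto)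
  also have "\<dots> \<le> ennreal (H / 2)"
  proof (rule ennreal_leI)
    have "(\<Sum>i\<in>{..k}. \<rho> ^ (k - i)) = (\<Sum>i\<in>{..k}. \<rho> ^ i)"
      by (rule sum.reindex_bij_witness[of _ "\<lambda>i. k - i" "\<lambda>i. k - i"]) auto
    also have "\<dots> \<le> (\<Sum>i. \<rho> ^ i)" by (rule sum_le_suminf) (use \<rho> in auto)
    also have "\<dots> = 1 / (1 - \<rho>)" by (rule suminf_geometric) (use \<rho> in simp)
    finally have geo: "(\<Sum>i\<in>{..k}. \<rho> ^ (k - i)) \<le> 1 / (1 - \<rho>)" .
    have "(\<Sum>i\<in>{..k}. 8 * real CARD('n) * c\<^sub>0 * H * \<rho> ^ (k - i)) = 8 * real CARD('n) * c\<^sub>0 * H * (\<Sum>i\<in>{..k}. \<rho> ^ (k - i))"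
      by (rule sum_distrib_left[symmetric])
    also have "\<dots> \<le> 8 * real CARD('n) * c\<^sub>0 * H * (1 / (1 - \<rho>))"
      by (rule mult_left_mono[OF geo]) (use c\<^sub>0 H in auto)
    also have "\<dots> = (8 / 20) * H"
    proof -
      have "c\<^sub>0 * (1 / (1 - \<rho>)) = 1 / (20 * real CARD('n))" using \<rho>(2) by (simp add: c\<^sub>0_def)
      then have "8 * real CARD('n) * c\<^sub>0 * H * (1 / (1 - \<rho>)) = 8 * real CARD('n) * H * (1 / (20 * real CARD('n)))"
        by (simp only: mult.assoc mult.left_commute[of c\<^sub>0] mult.commute[of c\<^sub>0])
      then show ?thesis by simp
    qed
    also have "\<dots> \<le> H / 2" using H by simp
    finally show "(\<Sum>i\<in>{..k}. 8 * real CARD('n) * c\<^sub>0 * H * \<rho> ^ (k - i)) \<le> H / 2" .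
  qed
  finally show ?thesis .
qed

lemma good_point_measurable [measurable (raw)]:
  assumes [measurable]: "f \<in> borel_measurable M" "h \<in> borel_measurable M"
  shows "Measurable.pred M (\<lambda>p. good_point c\<^sub>0 \<rho> (h p) H k (f p :: real ^ 'n))"
proof -
  have [measurable]: "(\<lambda>p. f p $ e) \<in> borel_measurable M" for e
    by (rule measurable_compose[OF assms(1)]) (intro borel_measurable_continuous_onI continuous_intros)
  have "Measurable.pred M (\<lambda>p. c\<^sub>0 * \<rho> ^ (k - i) * side H i \<le> \<bar>f p $ e - h p - real_of_int z * side H i\<bar>)" for i e z
    by measurable
  then show ?thesis
    unfolding good_point_def by (intro pred_intros_countable pred_intros_logic) measurable
qed

lemma good_shifts_large:
  fixes x :: "real ^ 'n"
  assumes H: "0 < H"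
  shows "ennreal (H / 2) \<le> (\<integral>\<^sup>+\<tau>\<in>{0..H}. (if good_point c\<^sub>0 \<rho> \<tau> H k x then 1 else 0) \<partial>lborel)"
proof -
  let ?G = "\<lambda>\<tau>. good_point c\<^sub>0 \<rho> \<tau> H k x"
  have [measurable]: "{\<tau> \<in> {0..H}. \<not> ?G \<tau>} \<in> sets borel" "{\<tau> \<in> {0..H}. ?G \<tau>} \<in> sets borel" by measurable
  have "ennreal H = emeasure lborel ({\<tau> \<in> {0..H}. ?G \<tau>} \<union> {\<tau> \<in> {0..H}. \<not> ?G \<tau>})"
  proof -
    have "{\<tau> \<in> {0..H}. ?G \<tau>} \<union> {\<tau> \<in> {0..H}. \<not> ?G \<tau>} = {0..H}" by auto
    then show ?thesis using H by simp
  qed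
  also have "\<dots> \<le> emeasure lborel {\<tau> \<in> {0..H}. ?G \<tau>} + emeasure lborel {\<tau> \<in> {0..H}. \<not> ?G \<tau>}"
    by (rule emeasure_subadditive) auto
  also have "\<dots> \<le> emeasure lborel {\<tau> \<in> {0..H}. ?G \<tau>} + ennreal (H / 2)"
    by (rule add_left_mono[OF bad_shifts_small[OF H]])
  finally have "ennreal (H / 2) + ennreal (H / 2) \<le> emeasure lborel {\<tau> \<in> {0..H}. ?G \<tau>} + ennreal (H / 2)"
    using H by (simp add: ennreal_plus[symmetric] del: ennreal_plus)
  then have "ennreal (H / 2) \<le> emeasure lborel {\<tau> \<in> {0..H}. ?G \<tau>}" by simp
  also have "\<dots> = (\<integral>\<^sup>+\<tau>. indicator {\<tau> \<in> {0..H}. ?G \<tau>} \<tau> \<partial>lborel)" by simp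
  also have "\<dots> = (\<integral>\<^sup>+\<tau>\<in>{0..H}. (if ?G \<tau> then 1 else 0) \<partial>lborel)"
    by (rule nn_integral_cong) (auto simp: indicator_def)
  finally show ?thesis .
qed

text \<open>By Tonelli's theorem: for each \<open>x\<close> only the single shift \<open>\<tau> = x $ e - r\<close> is relevant.\<close>

lemma AE_hyperplane_null:
  fixes e :: 'n
  shows "AE \<tau> in lborel. emeasure \<mu> {x. x $ e = \<tau> + r} = 0"
proof -
  have [measurable]: "(\<lambda>x :: real ^ 'n. x $ e) \<in> borel_measurable borel"
    by (intro borel_measurable_continuous_onI continuous_intros)
  have "(\<integral>\<^sup>+\<tau>. emeasure \<mu> {x. x $ e = \<tau> + r} \<partial>lborel)
      = (\<integral>\<^sup>+\<tau>. \<integral>\<^sup>+x. indicator {0} (x $ e - \<tau> - r) \<partial>\<mu> \<partial>lborel)"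
  proof (rule nn_integral_cong)
    fix \<tau>
    have "{x. x $ e = \<tau> + r} \<in> sets \<mu>" by simp
    then have "emeasure \<mu> {x. x $ e = \<tau> + r} = (\<integral>\<^sup>+x. indicator {x. x $ e = \<tau> + r} x \<partial>\<mu>)" by simp
    also have "\<dots> = (\<integral>\<^sup>+x. indicator {0} (x $ e - \<tau> - r) \<partial>\<mu>)"
      by (rule nn_integral_cong) (auto simp: indicator_def)
    finally show "emeasure \<mu> {x. x $ e = \<tau> + r} = (\<integral>\<^sup>+x. indicator {0} (x $ e - \<tau> - r) \<partial>\<mu>)" .
  qed
  also have "\<dots> = (\<integral>\<^sup>+x. \<integral>\<^sup>+\<tau>. indicator {0} (x $ e - \<tau> - r) \<partial>lborel \<partial>\<mu>)"
    by (rule half_space.Fubini') measurable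
  also have "\<dots> = (\<integral>\<^sup>+x. 0 \<partial>\<mu>)"
  proof (rule nn_integral_cong)
    fix x :: "real ^ 'n"
    have "(\<integral>\<^sup>+\<tau>. indicator {0} (x $ e - \<tau> - r) \<partial>lborel) = (\<integral>\<^sup>+\<tau>. indicator {x $ e - r} \<tau> \<partial>lborel)"
      by (rule nn_integral_cong) (auto simp: indicator_def)
    also have "\<dots> = 0" by simp
    finally show "(\<integral>\<^sup>+\<tau>. indicator {0} (x $ e - \<tau> - r) \<partial>lborel) = 0" .
  qed
  finally have z: "(\<integral>\<^sup>+\<tau>. emeasure \<mu> {x. x $ e = \<tau> + r} \<partial>lborel) = 0" by simp
  have "(\<lambda>\<tau>. emeasure \<mu> {x. x $ e = \<tau> + r}) \<in> borel_measurable lborel"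
  proof -
    have "(\<lambda>\<tau>. \<integral>\<^sup>+x. indicator {0} (x $ e - \<tau> - r) \<partial>\<mu>) \<in> borel_measurable lborel" by measurable
    also have "(\<lambda>\<tau>. \<integral>\<^sup>+x. indicator {0} (x $ e - \<tau> - r) \<partial>\<mu>) = (\<lambda>\<tau>. emeasure \<mu> {x. x $ e = \<tau> + r})"
    proof
      fix \<tau>
      have "(\<integral>\<^sup>+x. indicator {0} (x $ e - \<tau> - r) \<partial>\<mu>) = (\<integral>\<^sup>+x. indicator {x. x $ e = \<tau> + r} x \<partial>\<mu>)"
        by (rule nn_integral_cong) (auto simp: indicator_def)
      then show "(\<integral>\<^sup>+x. indicator {0} (x $ e - \<tau> - r) \<partial>\<mu>) = emeasure \<mu> {x. x $ e = \<tau> + r}" by simp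
    qed
    finally show ?thesis .
  qed
  with z show ?thesis by (subst (asm) nn_integral_0_iff_AE) auto
qed

lemma AE_grid_null_boundary:
  "AE \<tau> in lborel. \<forall>j. \<forall>z :: 'n \<Rightarrow> int. emeasure \<mu> (cube (grid_center \<tau> H j z) (side H j) - {x. grid_index \<tau> H j x = z}) = 0"
  if H: "0 < H"
proof -
  have "AE \<tau> in lborel. \<forall>e. \<forall>j. \<forall>k::int. emeasure \<mu> {x. x $ e = \<tau> + real_of_int k * side H j} = 0"
    by (simp add: AE_all_countable AE_hyperplane_null)
  then show ?thesis
  proof eventually_elim
    case (elim \<tau>)
    show ?case
    proof (intro allI)
      fix j and z :: "'n \<Rightarrow> int"
      have N: "(\<Union>e. {x. x $ e = \<tau> + real_of_int (z e + 1) * side H j}) \<in> null_sets \<mu>"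
      proof (rule null_sets_UN')
        fix e
        have "emeasure \<mu> {x. x $ e = \<tau> + real_of_int (z e + 1) * side H j} = 0" using elim by blast
        then show "{x. x $ e = \<tau> + real_of_int (z e + 1) * side H j} \<in> null_sets \<mu>" by (rule null_setsI) simp
      qed simp
      have "cube (grid_center \<tau> H j z) (side H j) - {x. grid_index \<tau> H j x = z}
          \<subseteq> (\<Union>e. {x. x $ e = \<tau> + real_of_int (z e + 1) * side H j})"
      proof
        fix x assume x: "x \<in> cube (grid_center \<tau> H j z) (side H j) - {x. grid_index \<tau> H j x = z}"
        then have c: "\<bar>x $ e - \<tau> - (real_of_int (z e) + 1 / 2) * side H j\<bar> \<le> side H j / 2" for e
          by (simp add: mem_grid_cube)
        from x obtain e where e: "\<not> (real_of_int (z e) * side H j \<le> x $ e - \<tau> \<and> x $ e - \<tau> < (real_of_int (z e) + 1) * side H j)"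
          using grid_index_eq_iff[OF H, of \<tau> j x z] by auto
        have "real_of_int (z e) * side H j \<le> x $ e - \<tau>" "x $ e - \<tau> \<le> (real_of_int (z e) + 1) * side H j"
        proof -
          have eq1: "(real_of_int (z e) + 1 / 2) * side H j = real_of_int (z e) * side H j + side H j / 2"
            and eq2: "(real_of_int (z e) + 1) * side H j = real_of_int (z e) * side H j + side H j"
            by (simp_all add: distrib_right)
          have between: "a \<le> u" "u \<le> a + l" if "\<bar>u - (a + l / 2)\<bar> \<le> l / 2" for u a l :: real
            using that by linarith+
          show "real_of_int (z e) * side H j \<le> x $ e - \<tau>" "x $ e - \<tau> \<le> (real_of_int (z e) + 1) * side H j"
            using between[OF c[of e, unfolded eq1]] unfolding eq2 by auto
        qed
        with e have "x $ e = \<tau> + real_of_int (z e + 1) * side H j" by simp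
        then show "x \<in> (\<Union>e. {x. x $ e = \<tau> + real_of_int (z e + 1) * side H j})" by blast
      qed
      then have "emeasure \<mu> (cube (grid_center \<tau> H j z) (side H j) - {x. grid_index \<tau> H j x = z})
          \<le> emeasure \<mu> (\<Union>e. {x. x $ e = \<tau> + real_of_int (z e + 1) * side H j})"
        by (rule emeasure_mono) (use N in auto)
      also have "\<dots> = 0" using N by auto
      finally show "emeasure \<mu> (cube (grid_center \<tau> H j z) (side H j) - {x. grid_index \<tau> H j x = z}) = 0" by simp
    qed
  qed
qed

lemma square_integral_eq:
  assumes [measurable]: "f \<in> borel_measurable \<mu>" "A \<in> sets \<mu>" "T \<in> sets borel" and T: "T \<subseteq> {0<..}"
  shows "square_integral \<mu> s (A \<times> T) f = (\<integral>\<^sup>+x\<in>A. (\<integral>\<^sup>+t\<in>T. square_density f x t \<partial>lborel) \<partial>\<mu>)"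
proof -
  have "square_integral \<mu> s (A \<times> T) f
      = (\<integral>\<^sup>+p. indicator A (fst p) * (square_density f (fst p) (snd p) * indicator T (snd p)) \<partial>(\<mu> \<Otimes>\<^sub>M lborel))"
    unfolding square_integral_def
    by (rule nn_integral_cong) (use T in \<open>auto simp: indicator_def square_density_def\<close>)
  also have "\<dots> = (\<integral>\<^sup>+x. \<integral>\<^sup>+t. indicator A x * (square_density f x t * indicator T t) \<partial>lborel \<partial>\<mu>)"
    by (subst lborel.nn_integral_fst[symmetric]) auto
  also have "\<dots> = (\<integral>\<^sup>+x\<in>A. (\<integral>\<^sup>+t\<in>T. square_density f x t \<partial>lborel) \<partial>\<mu>)"
    by (simp add: nn_integral_cmult mult.commute)
  finally show ?thesis .
qed

text \<open>The indicator of a good shift has integral at least \<open>H / 2\<close> over \<open>[0, H]\<close>, whereas the bound \<open>F\<close> is integrated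
  over an interval of length \<open>H\<close>; hence the factor \<open>2\<close>.\<close>

lemma average_over_shifts:
  assumes f [measurable]: "f \<in> borel_measurable \<mu>" and H: "0 < H"
    and grid: "AE \<tau> in lborel. (\<Sum>k<N. \<integral>\<^sup>+x. (if good_point c\<^sub>0 \<rho> \<tau> H k x then \<integral>\<^sup>+t\<in>{side H k..<2 * side H k}. square_density f x t \<partial>lborel else 0) \<partial>\<mu>) \<le> F"
  shows "(\<Sum>k<N. \<integral>\<^sup>+x. (\<integral>\<^sup>+t\<in>{side H k..<2 * side H k}. square_density f x t \<partial>lborel) \<partial>\<mu>) \<le> 2 * F"
proof -
  define u where "u k x = (\<integral>\<^sup>+t\<in>{side H k..<2 * side H k}. square_density f x t \<partial>lborel)" for k x
  have [measurable]: "u k \<in> borel_measurable \<mu>" for k unfolding u_def by measurable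
  let ?g = "\<lambda>\<tau> k x. if good_point c\<^sub>0 \<rho> \<tau> H k x then 1 else (0 :: ennreal)"
  have one: "ennreal (H / 2) * (\<integral>\<^sup>+x. u k x \<partial>\<mu>)
      \<le> (\<integral>\<^sup>+\<tau>\<in>{0..H}. (\<integral>\<^sup>+x. (if good_point c\<^sub>0 \<rho> \<tau> H k x then u k x else 0) \<partial>\<mu>) \<partial>lborel)" for k
  proof -
    have "ennreal (H / 2) * (\<integral>\<^sup>+x. u k x \<partial>\<mu>) = (\<integral>\<^sup>+x. ennreal (H / 2) * u k x \<partial>\<mu>)"
      by (rule nn_integral_cmult[symmetric]) measurable
    also have "\<dots> \<le> (\<integral>\<^sup>+x. (\<integral>\<^sup>+\<tau>\<in>{0..H}. ?g \<tau> k x \<partial>lborel) * u k x \<partial>\<mu>)"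
      by (intro nn_integral_mono mult_right_mono good_shifts_large H) simp
    also have "\<dots> = (\<integral>\<^sup>+x. \<integral>\<^sup>+\<tau>. ?g \<tau> k x * indicator {0..H} \<tau> * u k x \<partial>lborel \<partial>\<mu>)"
      by (intro nn_integral_cong nn_integral_multc[symmetric]) measurable
    also have "\<dots> = (\<integral>\<^sup>+\<tau>. \<integral>\<^sup>+x. ?g \<tau> k x * indicator {0..H} \<tau> * u k x \<partial>\<mu> \<partial>lborel)"
      by (rule half_space.Fubini'[symmetric]) measurable
    also have "\<dots> = (\<integral>\<^sup>+\<tau>\<in>{0..H}. (\<integral>\<^sup>+x. (if good_point c\<^sub>0 \<rho> \<tau> H k x then u k x else 0) \<partial>\<mu>) \<partial>lborel)"
    proof (rule nn_integral_cong)
      fix \<tau>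
      have "(\<integral>\<^sup>+x. ?g \<tau> k x * indicator {0..H} \<tau> * u k x \<partial>\<mu>)
          = (\<integral>\<^sup>+x. (if good_point c\<^sub>0 \<rho> \<tau> H k x then u k x else 0) * indicator {0..H} \<tau> \<partial>\<mu>)"
        by (rule nn_integral_cong) (auto simp: mult.commute)
      also have "\<dots> = (\<integral>\<^sup>+x. (if good_point c\<^sub>0 \<rho> \<tau> H k x then u k x else 0) \<partial>\<mu>) * indicator {0..H} \<tau>"
        by (rule nn_integral_multc) measurable
      finally show "(\<integral>\<^sup>+x. ?g \<tau> k x * indicator {0..H} \<tau> * u k x \<partial>\<mu>)
          = (\<integral>\<^sup>+x. (if good_point c\<^sub>0 \<rho> \<tau> H k x then u k x else 0) \<partial>\<mu>) * indicator {0..H} \<tau>" .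
    qed
    finally show ?thesis .
  qed
  have "ennreal (H / 2) * (\<Sum>k<N. \<integral>\<^sup>+x. u k x \<partial>\<mu>)
      \<le> (\<Sum>k<N. \<integral>\<^sup>+\<tau>\<in>{0..H}. (\<integral>\<^sup>+x. (if good_point c\<^sub>0 \<rho> \<tau> H k x then u k x else 0) \<partial>\<mu>) \<partial>lborel)"
    unfolding sum_distrib_left by (rule sum_mono[OF one])
  also have "\<dots> = (\<integral>\<^sup>+\<tau>. (\<Sum>k<N. (\<integral>\<^sup>+x. (if good_point c\<^sub>0 \<rho> \<tau> H k x then u k x else 0) \<partial>\<mu>) * indicator {0..H} \<tau>) \<partial>lborel)"
    by (rule nn_integral_sum[symmetric]) measurable
  also have "\<dots> \<le> (\<integral>\<^sup>+\<tau>. F * indicator {0..H} \<tau> \<partial>lborel)"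
  proof (rule nn_integral_mono_AE)
    show "AE \<tau> in lborel. (\<Sum>k<N. (\<integral>\<^sup>+x. (if good_point c\<^sub>0 \<rho> \<tau> H k x then u k x else 0) \<partial>\<mu>) * indicator {0..H} \<tau>) \<le> F * indicator {0..H} \<tau>"
      using grid unfolding u_def[symmetric]
      by eventually_elim (simp add: sum_distrib_right[symmetric] mult_right_mono)
  qed
  also have "\<dots> = F * ennreal H" using H by (subst nn_integral_cmult_indicator) auto
  finally have le: "ennreal (H / 2) * (\<Sum>k<N. \<integral>\<^sup>+x. u k x \<partial>\<mu>) \<le> F * ennreal H" .
  have "ennreal (2 / H) * (ennreal (H / 2) * (\<Sum>k<N. \<integral>\<^sup>+x. u k x \<partial>\<mu>)) \<le> ennreal (2 / H) * (F * ennreal H)"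
    by (rule mult_left_mono[OF le]) simp
  moreover have "ennreal (2 / H) * (ennreal (H / 2) * (\<Sum>k<N. \<integral>\<^sup>+x. u k x \<partial>\<mu>)) = (\<Sum>k<N. \<integral>\<^sup>+x. u k x \<partial>\<mu>)"
    using H by (simp add: mult.assoc[symmetric] ennreal_mult[symmetric])
  moreover have "ennreal (2 / H) * (F * ennreal H) = 2 * F"
  proof -
    have "ennreal (2 / H) * (F * ennreal H) = (ennreal (2 / H) * ennreal H) * F" by (simp only: ac_simps)
    also have "ennreal (2 / H) * ennreal H = 2" using H by (simp add: ennreal_mult[symmetric])
    finally show ?thesis .
  qed
  ultimately show ?thesis by (simp add: u_def)
qed

text \<open>Monotone convergence along \<open>[2\<^bsup>-p\<^esup>, 2\<^bsup>p\<^esup>)\<close>, each of which is covered by the scales of the grid with top side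
  \<open>H = 2\<^bsup>p\<^esup>\<close>.\<close>

lemma square_integral_le_of_scales:
  assumes f [measurable]: "f \<in> borel_measurable \<mu>"
    and scales: "\<And>H N. 0 < H \<Longrightarrow> (\<Sum>k<N. \<integral>\<^sup>+x. (\<integral>\<^sup>+t\<in>{side H k..<2 * side H k}. square_density f x t \<partial>lborel) \<partial>\<mu>) \<le> F"
  shows "square_integral \<mu> s (UNIV \<times> {0<..}) f \<le> F"
proof -
  define A where "A p = {1 / 2 ^ p ..< (2 :: real) ^ p}" for p :: nat
  have A_mono: "A p \<subseteq> A q" if "p \<le> q" for p q
  proof -
    have "(2 :: real) ^ p \<le> 2 ^ q" using that by (intro power_increasing) auto
    moreover have "1 / 2 ^ q \<le> 1 / (2 :: real) ^ p" using that by (intro divide_left_mono power_increasing) auto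
    ultimately show ?thesis by (auto simp: A_def)
  qed
  have step: "(\<integral>\<^sup>+x. (\<integral>\<^sup>+t\<in>A p. square_density f x t \<partial>lborel) \<partial>\<mu>) \<le> F" for p
  proof -
    let ?H = "(2 :: real) ^ p" and ?N = "Suc (2 * p)"
    have "(\<integral>\<^sup>+x. (\<integral>\<^sup>+t\<in>A p. square_density f x t \<partial>lborel) \<partial>\<mu>)
        \<le> (\<integral>\<^sup>+x. (\<Sum>k<?N. \<integral>\<^sup>+t\<in>{side ?H k..<2 * side ?H k}. square_density f x t \<partial>lborel) \<partial>\<mu>)"
    proof (rule nn_integral_mono)
      fix x
      have "square_density f x t * indicator (A p) t
          \<le> (\<Sum>k<?N. square_density f x t * indicator {side ?H k..<2 * side ?H k} t)" for t
      proof (cases "t \<in> A p")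
        case True
        define k where "k = (LEAST k. side ?H k \<le> t)"
        have ex: "side ?H (2 * p) \<le> t" using True by (simp add: A_def side_def mult_2 power_add)
        have k1: "side ?H k \<le> t" unfolding k_def by (rule LeastI[of _ "2 * p"]) (rule ex)
        have kN: "k < ?N" unfolding k_def using Least_le[of "\<lambda>k. side ?H k \<le> t" "2 * p", OF ex] by simp
        have k2: "t < 2 * side ?H k"
        proof (cases k)
          case 0
          then show ?thesis using k1 True by (simp add: A_def side_def)
        next
          case (Suc k')
          then have "\<not> side ?H k' \<le> t" using not_less_Least[of k' "\<lambda>k. side ?H k \<le> t"] k_def by simp
          then show ?thesis using Suc side_Suc[of ?H k'] by simp
        qed
        have "square_density f x t * indicator (A p) t = square_density f x t * indicator {side ?H k..<2 * side ?H k} t"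
          using True k1 k2 by simp
        also have "\<dots> \<le> (\<Sum>k<?N. square_density f x t * indicator {side ?H k..<2 * side ?H k} t)"
          by (rule member_le_sum[where f = "\<lambda>k. square_density f x t * indicator {side ?H k..<2 * side ?H k} t"]) (use kN in auto)
        finally show ?thesis .
      qed simp
      then have "(\<integral>\<^sup>+t\<in>A p. square_density f x t \<partial>lborel)
          \<le> (\<integral>\<^sup>+t. (\<Sum>k<?N. square_density f x t * indicator {side ?H k..<2 * side ?H k} t) \<partial>lborel)"
        by (rule nn_integral_mono)
      also have "\<dots> = (\<Sum>k<?N. \<integral>\<^sup>+t\<in>{side ?H k..<2 * side ?H k}. square_density f x t \<partial>lborel)"
        by (rule nn_integral_sum) measurable
      finally show "(\<integral>\<^sup>+t\<in>A p. square_density f x t \<partial>lborel)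
          \<le> (\<Sum>k<?N. \<integral>\<^sup>+t\<in>{side ?H k..<2 * side ?H k}. square_density f x t \<partial>lborel)" .
    qed
    also have "\<dots> = (\<Sum>k<?N. \<integral>\<^sup>+x. (\<integral>\<^sup>+t\<in>{side ?H k..<2 * side ?H k}. square_density f x t \<partial>lborel) \<partial>\<mu>)"
      by (rule nn_integral_sum) measurable
    also have "\<dots> \<le> F" by (rule scales) simp
    finally show ?thesis .
  qed
  let ?h = "\<lambda>p q. square_density f (fst q) (snd q) * indicator (A p) (snd q)"
  have Am [measurable]: "A p \<in> sets borel" for p by (simp add: A_def)
  have "square_integral \<mu> s (UNIV \<times> {0<..}) f = (\<integral>\<^sup>+q. (SUP p. ?h p q) \<partial>(\<mu> \<Otimes>\<^sub>M lborel))"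
    unfolding square_integral_def
  proof (rule nn_integral_cong)
    fix q :: "(real ^ 'n) \<times> real"
    show "ennreal ((norm (theta \<mu> s (snd q) f (fst q)))\<^sup>2 / snd q) * indicator (UNIV \<times> {0<..}) q = (SUP p. ?h p q)"
    proof (cases "0 < snd q")
      case True
      obtain p1 where p1: "snd q < 2 ^ p1" using real_arch_pow[of 2 "snd q"] by auto
      obtain p2 where p2: "1 / snd q < 2 ^ p2" using real_arch_pow[of 2 "1 / snd q"] by auto
      have "snd q \<in> A (max p1 p2)"
      proof -
        have "(2 :: real) ^ p1 \<le> 2 ^ max p1 p2" "(2 :: real) ^ p2 \<le> 2 ^ max p1 p2" by (auto intro!: power_increasing)
        then have "snd q < 2 ^ max p1 p2" "1 / snd q < 2 ^ max p1 p2" using p1 p2 by linarith+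
        then show ?thesis using True by (auto simp: A_def field_simps)
      qed
      then have "square_density f (fst q) (snd q) = ?h (max p1 p2) q" by simp
      also have "\<dots> \<le> (SUP p. ?h p q)" by (rule SUP_upper) simp
      finally have "square_density f (fst q) (snd q) \<le> (SUP p. ?h p q)" .
      moreover have "(SUP p. ?h p q) \<le> square_density f (fst q) (snd q)"
        by (rule SUP_least) (auto simp: indicator_def)
      ultimately show ?thesis using True by (auto simp: square_density_def indicator_def mem_Times_iff)
    next
      case False
      then show ?thesis by (auto simp: square_density_def indicator_def mem_Times_iff)
    qed
  qed
  also have "\<dots> = (SUP p. \<integral>\<^sup>+q. ?h p q \<partial>(\<mu> \<Otimes>\<^sub>M lborel))"
  proof (rule nn_integral_monotone_convergence_SUP)
    show "incseq ?h"
    proof (intro incseq_SucI le_funI)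
      fix p q
      have "A p \<subseteq> A (Suc p)" by (rule A_mono) simp
      then show "?h p q \<le> ?h (Suc p) q" by (intro mult_left_mono) (auto simp: indicator_def)
    qed
  qed measurable
  also have "\<dots> \<le> F"
  proof (rule SUP_least)
    fix p
    have "(\<integral>\<^sup>+q. ?h p q \<partial>(\<mu> \<Otimes>\<^sub>M lborel)) = (\<integral>\<^sup>+x. \<integral>\<^sup>+t. square_density f x t * indicator (A p) t \<partial>lborel \<partial>\<mu>)"
      by (subst lborel.nn_integral_fst[symmetric]) auto
    then show "(\<integral>\<^sup>+q. ?h p q \<partial>(\<mu> \<Otimes>\<^sub>M lborel)) \<le> F" using step[of p] by simp
  qed
  finally show ?thesis .
qed

end

section \<open>The local Tb theorem\<close>

text \<open>For \<open>b = 0\<close> a finite bound for \<open>a / b\<close> forces \<open>a = 0\<close>.\<close>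

lemma ennreal_le_of_divide_le:
  fixes a b c :: ennreal
  assumes "a / b \<le> c" "b \<noteq> \<top>" "c \<noteq> \<top>"
  shows "a \<le> c * b"
proof (cases "b = 0")
  case True
  have "a = 0"
  proof (rule ccontr)
    assume "a \<noteq> 0"
    then have "a / b = \<top>" using True by (simp add: divide_ennreal_def ennreal_mult_top)
    with assms show False by (simp add: top_unique)
  qed
  then show ?thesis by simp
next
  case False
  have "b / b = 1" using False assms(2) by (intro ennreal_divide_self) (auto simp: less_top)
  then have "a = a / b * b" by (simp add: ennreal_divide_times)
  also have "\<dots> \<le> c * b" by (rule mult_right_mono[OF assms(1)]) simp
  finally show ?thesis .
qed

lemma cube_in_cubes: "0 < l \<Longrightarrow> cube c l \<in> cubes"
  by (auto simp: cubes_def)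

context kernel_family begin

lemma emeasure_cube_finite: "emeasure \<mu> (cube c l) \<noteq> \<top>"
proof -
  have "bounded (cube c l)" by (simp add: cube_def)
  from emeasure_bounded_finite[OF this] show ?thesis by simp
qed

lemma cube_measurable [measurable]: "cube c l \<in> sets \<mu>"
  by (simp add: cube_def)

lemma carleson_sup_testing:
  assumes g [measurable]: "g \<in> borel_measurable \<mu>" and sup: "carleson_sup \<mu> s g \<le> ennreal C" and l: "0 < l"
  shows "(\<integral>\<^sup>+x\<in>cube c l. (\<integral>\<^sup>+t\<in>{0<..<l}. square_density g x t \<partial>lborel) \<partial>\<mu>) \<le> ennreal C * emeasure \<mu> (cube c (3 * l))"
proof -
  have "square_integral \<mu> s (carleson_box c l) g / emeasure \<mu> (cube c (3 * l)) \<le> carleson_sup \<mu> s g"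
    unfolding carleson_sup_def
    by (rule SUP_upper2[of "(c, l)"]) (use l in auto)
  also note sup
  finally have "square_integral \<mu> s (carleson_box c l) g \<le> ennreal C * emeasure \<mu> (cube c (3 * l))"
    by (rule ennreal_le_of_divide_le[OF _ emeasure_cube_finite]) simp
  then show ?thesis
    unfolding carleson_box_def by (subst (asm) square_integral_eq[OF g cube_measurable]) auto
qed

text \<open>The test function of a cell is that of its closure, which differs from the cell by a \<open>\<mu>\<close>-null set for almost every
  shift.\<close>

lemma local_Tb_bounded_tests:
  fixes b :: "(real ^ 'n) set \<Rightarrow> real ^ 'n \<Rightarrow> complex"
  assumes b: "\<And>Q. Q \<in> cubes \<Longrightarrow> b Q \<in> borel_measurable \<mu>"
    and bK: "\<And>Q y. Q \<in> cubes \<Longrightarrow> norm (b Q y) \<le> K" and K: "1 \<le> K" and \<delta>: "0 < \<delta>"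
    and acc: "\<And>Q. Q \<in> cubes \<Longrightarrow> emeasure \<mu> Q \<noteq> 0 \<Longrightarrow> \<delta> \<le> norm (average \<mu> Q (b Q))"
    and C: "0 \<le> C" and test: "\<And>Q. Q \<in> cubes \<Longrightarrow> carleson_sup \<mu> s (b Q) \<le> ennreal C"
    and f: "f \<in> borel_measurable \<mu>" and sq: "L2_square \<mu> f < \<infinity>"
  shows "square_integral \<mu> s (UNIV \<times> {0<..}) f
    \<le> 2 * (ennreal (local_Tb_grid.grid_const TYPE('n) m \<alpha> C\<^sub>\<mu> C\<^sub>s C\<^sub>c K \<delta> C) * L2_square \<mu> f)"
proof (rule square_integral_le_of_scales[OF f])
  fix H :: real and N :: nat assume H: "0 < H"
  show "(\<Sum>k<N. \<integral>\<^sup>+x. (\<integral>\<^sup>+t\<in>{side H k..<2 * side H k}. square_density f x t \<partial>lborel) \<partial>\<mu>)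
    \<le> 2 * (ennreal (local_Tb_grid.grid_const TYPE('n) m \<alpha> C\<^sub>\<mu> C\<^sub>s C\<^sub>c K \<delta> C) * L2_square \<mu> f)"
  proof (rule average_over_shifts[OF f H])
    show "AE \<tau> in lborel. (\<Sum>k<N. \<integral>\<^sup>+x. (if good_point c\<^sub>0 \<rho> \<tau> H k x then \<integral>\<^sup>+t\<in>{side H k..<2 * side H k}. square_density f x t \<partial>lborel else 0) \<partial>\<mu>)
        \<le> ennreal (local_Tb_grid.grid_const TYPE('n) m \<alpha> C\<^sub>\<mu> C\<^sub>s C\<^sub>c K \<delta> C) * L2_square \<mu> f"
      using AE_grid_null_boundary[OF H]
    proof eventually_elim
      case (elim \<tau>)
      define Q where "Q j z = cube (grid_center \<tau> H j z) (side H j)" for j and z :: "'n \<Rightarrow> int"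
      have Q: "Q j z \<in> cubes" for j z unfolding Q_def by (rule cube_in_cubes[OF side_pos[OF H]])
      interpret dyadic_grid \<mu> m \<alpha> s C\<^sub>\<mu> C\<^sub>s C\<^sub>c \<tau> H by unfold_locales (rule H)
      interpret local_Tb_grid \<mu> m \<alpha> s C\<^sub>\<mu> C\<^sub>s C\<^sub>c \<tau> H "\<lambda>j z. b (Q j z)" K \<delta> C
      proof unfold_locales
        fix j and x :: "real ^ 'n"
        define z where "z = grid_index \<tau> H j x"
        have cell: "cell j x = {y. grid_index \<tau> H j y = z}" by (simp add: cell_def z_def)
        have sub: "cell j x \<subseteq> Q j z"
          unfolding cell Q_def using grid_cell_subset_cube[OF H] by blast
        have Qm: "Q j z \<in> sets \<mu>" unfolding Q_def by (rule cube_measurable)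
        have null: "Q j z - cell j x \<in> null_sets \<mu>"
        proof (rule null_setsI)
          show "emeasure \<mu> (Q j z - cell j x) = 0" unfolding cell Q_def using elim by blast
          show "Q j z - cell j x \<in> sets \<mu>" using Qm cell_measurable[of j x] by (rule sets.Diff)
        qed
        have ae: "AE y in \<mu>. indicat_real (Q j z) y *\<^sub>R b (Q j z) y = indicat_real (cell j x) y *\<^sub>R b (Q j z) y"
          using AE_not_in[OF null] by eventually_elim (use sub in \<open>auto simp: indicator_def\<close>)
        have int: "(LINT y:Q j z|\<mu>. b (Q j z) y) = (LINT y:cell j x|\<mu>. b (Q j z) y)"
          unfolding set_lebesgue_integral_def
          by (rule integral_cong_AE) (use ae b[OF Q] Qm in auto)
        have "emeasure \<mu> (Q j z) = emeasure \<mu> (cell j x \<union> (Q j z - cell j x))" using sub by (simp add: Un_absorb1)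
        also have "\<dots> = emeasure \<mu> (cell j x)" by (rule emeasure_Un_null_set[OF _ null]) measurable
        finally have meas: "emeasure \<mu> (Q j z) = emeasure \<mu> (cell j x)" .
        show "\<delta> * measure \<mu> (cell j x) \<le> norm (LINT y:cell j x|\<mu>. b (Q j (grid_index \<tau> H j x)) y)"
        proof (cases "emeasure \<mu> (Q j z) = 0")
          case True
          then show ?thesis using meas by (simp add: measure_def)
        next
          case False
          have pos: "0 < measure \<mu> (Q j z)"
            using False emeasure_cube_finite[of "grid_center \<tau> H j z" "side H j"]
            by (simp add: Q_def measure_def enn2real_positive_iff top.not_eq_extremum zero_less_iff_neq_zero)
          have "\<delta> \<le> norm (LINT y:Q j z|\<mu>. b (Q j z) y) / measure \<mu> (Q j z)"
            using acc[OF Q False] by (simp add: average_def divide_inverse mult.commute)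
          then have "\<delta> * measure \<mu> (Q j z) \<le> norm (LINT y:Q j z|\<mu>. b (Q j z) y)"
            using pos by (simp add: pos_le_divide_eq)
          then show ?thesis using meas unfolding int by (simp add: measure_def z_def[symmetric])
        qed
      next
        fix j z c l assume "0 < (l :: real)"
        then show "(\<integral>\<^sup>+x\<in>cube c l. (\<integral>\<^sup>+t\<in>{0<..<l}. square_density (b (Q j z)) x t \<partial>lborel) \<partial>\<mu>) \<le> ennreal C * emeasure \<mu> (cube c (3 * l))"
          by (rule carleson_sup_testing[OF b[OF Q] test[OF Q]])
      qed (use b[OF Q] bK[OF Q] K \<delta> C in auto)
      show ?case
        using good_square_function_bound[OF f sq, of N] unfolding good_part_def good_def .
    qed
  qed
qed

end

theorem theorem1p4:
  fixes \<mu> :: "(real ^ 'n) measure"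
    and m \<alpha> :: real
    and s :: "real \<Rightarrow> real ^ 'n \<Rightarrow> real ^ 'n \<Rightarrow> complex"
    and b :: "(real ^ 'n) set \<Rightarrow> real ^ 'n \<Rightarrow> complex"
  assumes "m > 0" and "\<alpha> > 0"
    and "sets \<mu> = sets borel"
    and "power_bound m \<mu>"
    and "kernel_measurable s"
    and "kernel_size m \<alpha> s"
    and "kernel_continuity m \<alpha> s"
    and "\<forall>Q\<in>cubes. b Q \<in> borel_measurable \<mu>"
    and "\<forall>Q\<in>cubes. AE x in \<mu>. x \<notin> Q \<longrightarrow> b Q x = 0"
    and "\<exists>\<delta>>0. \<forall>Q\<in>cubes. emeasure \<mu> Q \<noteq> 0 \<longrightarrow> \<delta> \<le> norm (average \<mu> Q (b Q))"
    and "\<exists>C::real. \<forall>Q\<in>cubes. esssup \<mu> (\<lambda>x. ereal (norm (b Q x))) \<le> ereal C"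
    and "\<exists>C::real. \<forall>Q\<in>cubes. carleson_sup \<mu> s (b Q) \<le> ennreal C"
  shows "\<exists>C::real. \<forall>f \<in> borel_measurable \<mu>. integrable \<mu> (\<lambda>x. (norm (f x))\<^sup>2) \<longrightarrow>
           square_integral \<mu> s (UNIV \<times> {0<..}) f
             \<le> ennreal (C * (LINT x|\<mu>. (norm (f x))\<^sup>2))"
proof -
  obtain C1 where C1: "\<And>x r. 0 < r \<Longrightarrow> emeasure \<mu> (ball x r) \<le> ennreal (C1 * r powr m)"
    using assms(4) unfolding power_bound_def by blast
  obtain C2 where C2: "\<And>t x y. 0 < t \<Longrightarrow> norm (s t x y) \<le> C2 * (t powr \<alpha> / (t + norm (x - y)) powr (m + \<alpha>))"
    using assms(6) unfolding kernel_size_def by blast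
  obtain C3 where C3: "\<And>t x y z. 0 < t \<Longrightarrow> norm (y - z) < t / 2 \<Longrightarrow>
      norm (s t x y - s t x z) \<le> C3 * (norm (y - z) powr \<alpha> / (t + norm (x - y)) powr (m + \<alpha>))"
    using assms(7) unfolding kernel_continuity_def by blast
  obtain \<delta> where \<delta>: "0 < \<delta>" "\<And>Q. Q \<in> cubes \<Longrightarrow> emeasure \<mu> Q \<noteq> 0 \<Longrightarrow> \<delta> \<le> norm (average \<mu> Q (b Q))"
    using assms(10) by blast
  obtain K0 where K0: "\<And>Q. Q \<in> cubes \<Longrightarrow> esssup \<mu> (\<lambda>x. ereal (norm (b Q x))) \<le> ereal K0"
    using assms(11) by blast
  obtain C4 where C4: "\<And>Q. Q \<in> cubes \<Longrightarrow> carleson_sup \<mu> s (b Q) \<le> ennreal C4"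
    using assms(12) by blast
  define K where "K = max K0 1"
  interpret kernel_family \<mu> m \<alpha> s "max C1 0" "max C2 0" "max C3 0"
  proof
    show "emeasure \<mu> (ball x r) \<le> ennreal (max C1 0 * r powr m)" if "0 < r" for x r
      using C1[OF that] by (rule order.trans) (intro ennreal_leI mult_right_mono; simp)
    show "norm (s t x y) \<le> max C2 0 * poisson m \<alpha> t x y" if "0 < t" for t x y
      unfolding poisson_def using C2[OF that] by (rule order.trans) (intro mult_right_mono; simp)
    show "norm (s t x y - s t x z) \<le> max C3 0 * (norm (y - z) powr \<alpha> / (t + norm (x - y)) powr (m + \<alpha>))"
      if "0 < t" "norm (y - z) < t / 2" for t x y z
      using C3[OF that] by (rule order.trans) (intro mult_right_mono; simp)
  qed (use assms in auto)
  \<comment> \<open>The test functions are bounded only almost everywhere. Truncation changes them on a null set, which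
      affects neither the averages nor the operators.\<close>
  define b' where "b' Q y = (if norm (b Q y) \<le> K then b Q y else 0)" for Q y
  have bm: "b Q \<in> borel_measurable \<mu>" if "Q \<in> cubes" for Q using assms(8) that by blast
  have b'm: "b' Q \<in> borel_measurable \<mu>" if "Q \<in> cubes" for Q
  proof -
    note [measurable] = bm[OF that]
    show ?thesis unfolding b'_def by measurable
  qed
  have eq: "AE y in \<mu>. b Q y = b' Q y" if "Q \<in> cubes" for Q
  proof -
    note [measurable] = bm[OF that]
    have "AE y in \<mu>. ereal (norm (b Q y)) \<le> esssup \<mu> (\<lambda>x. ereal (norm (b Q x)))"
      by (rule esssup_AE)
    then show ?thesis
    proof eventually_elim
      case (elim y)
      then have "ereal (norm (b Q y)) \<le> ereal K0" using K0[OF that] by (rule order.trans)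
      then show ?case by (simp add: b'_def K_def)
    qed
  qed
  have theta: "theta \<mu> s t (b Q) x = theta \<mu> s t (b' Q) x" if "Q \<in> cubes" "0 < t" for Q t x
  proof -
    note [measurable] = bm[OF that(1)] b'm[OF that(1)] kernel_measurable[OF that(2)]
    show ?thesis unfolding theta_def
      by (rule integral_cong_AE) (use eq[OF that(1)] in auto)
  qed
  have carl: "carleson_sup \<mu> s (b' Q) = carleson_sup \<mu> s (b Q)" if "Q \<in> cubes" for Q
  proof -
    have "square_integral \<mu> s (carleson_box c l) (b' Q) = square_integral \<mu> s (carleson_box c l) (b Q)" for c l
      unfolding square_integral_def
      by (rule nn_integral_cong) (auto simp: indicator_def carleson_box_def theta[OF that])
    then show ?thesis unfolding carleson_sup_def by (simp only:)
  qed
  have av: "average \<mu> Q (b' Q) = average \<mu> Q (b Q)" if "Q \<in> cubes" for Q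
  proof -
    note [measurable] = bm[OF that] b'm[OF that]
    obtain c l where "Q = cube c l" using \<open>Q \<in> cubes\<close> by (auto simp: cubes_def)
    then have [measurable]: "Q \<in> sets \<mu>" by (simp only: cube_measurable)
    have "(LINT x:Q|\<mu>. b' Q x) = (LINT x:Q|\<mu>. b Q x)"
      unfolding set_lebesgue_integral_def by (rule integral_cong_AE) (use eq[OF that] in auto)
    then show ?thesis by (simp add: average_def)
  qed
  define Cg where "Cg = local_Tb_grid.grid_const TYPE('n) m \<alpha> (max C1 0) (max C2 0) (max C3 0) K \<delta> (max C4 0)"
  show ?thesis
  proof (intro exI[of _ "2 * Cg"] ballI impI)
    fix f :: "real ^ 'n \<Rightarrow> complex"
    assume f: "f \<in> borel_measurable \<mu>" and i: "integrable \<mu> (\<lambda>x. (norm (f x))\<^sup>2)"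
    have nn: "L2_square \<mu> f = ennreal (LINT x|\<mu>. (norm (f x))\<^sup>2)"
      by (rule nn_integral_eq_integral[OF i]) simp
    have "square_integral \<mu> s (UNIV \<times> {0<..}) f \<le> 2 * (ennreal Cg * L2_square \<mu> f)"
      unfolding Cg_def
    proof (rule local_Tb_bounded_tests[OF b'm _ _ \<delta>(1)])
      show "norm (b' Q y) \<le> K" for Q y by (simp add: b'_def K_def le_max_iff_disj)
      show "1 \<le> K" by (simp add: K_def)
      show "\<delta> \<le> norm (average \<mu> Q (b' Q))" if "Q \<in> cubes" "emeasure \<mu> Q \<noteq> 0" for Q
        using \<delta>(2)[OF that] by (simp add: av[OF that(1)])
      show "carleson_sup \<mu> s (b' Q) \<le> ennreal (max C4 0)" if "Q \<in> cubes" for Q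
        unfolding carl[OF that] using C4[OF that] by (rule order.trans) (simp add: ennreal_leI)
      show "L2_square \<mu> f < \<infinity>" unfolding nn by simp
    qed (use f in auto)
    also have "\<dots> = ennreal (2 * Cg * (LINT x|\<mu>. (norm (f x))\<^sup>2))"
      unfolding nn by (simp add: ennreal_mult'' mult.assoc ennreal_mult')
    finally show "square_integral \<mu> s (UNIV \<times> {0<..}) f \<le> ennreal (2 * Cg * (LINT x|\<mu>. (norm (f x))\<^sup>2))" .
  qed
qed

end
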